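(* (Soundness) (1) If $\Gamma\vdash\mathrm{wf}$ is derivable, then $|\Gamma|$ is defined, i.e. for every prefix $\Gamma'(x:A)$ of $\Gamma$ and every $\mathcal I\in|\Gamma'|$, $|\Gamma'\vdash A|_{\mathcal I}$ is defined. (2) If $\Gamma\vdash t:T$ is derivable and $\mathcal I\in|\Gamma|$, then $|\Gamma\vdash t|_{\mathcal I}$ and $|\Gamma\vdash T|_{\mathcal I}$ are both defined and $|\Gamma\vdash t|_{\mathcal I}\in|\Gamma\vdash T|_{\mathcal I}$.
   Context: Type theory: sorts $\mathsf{Prop}$, $\mathsf{Type}(i)$ ($i\in\mathbb N$), ordered $\mathsf{Prop}<\mathsf{Type}(0)<\dots$; tags $*,\diamond$ on variables; raw terms $t ::= s \mid x_{\mathsf s} \mid \lambda x_{\mathsf s}:t.\,t \mid (t\;t) \mid \Pi x_{\mathsf s}:t.\,t \mid \Sigma^{\mathsf s} x_{\mathsf s}:t.\,t \mid \langle t,t\rangle_{\Sigma^{\mathsf s}x_{\mathsf s}:t.\,t} \mid \pi_1(t) \mid \pi_2^{\mathsf s}(t) \mid \varepsilon$; contexts $\Gamma::=[]\mid\Gamma(x:t)$. Extraction $\rhd_\varepsilon$: contextual closure of $x_*\rhd\varepsilon$, $\lambda x:A.\varepsilon\rhd\varepsilon$, $(\varepsilon\;t)\rhd\varepsilon$, $\pi_2^*(t)\rhd\varepsilon$; tag $s(t)=*$ iff $t\rhd_\varepsilon^*\varepsilon$, else $\diamond$. $\rhd_\beta$: contextual closure of $((\lambda x_{\mathsf s}:A.t)\;u)\rhd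 t[x\setminus u]$ if $s(u)=\mathsf s$; $\pi_1(\langle a,b\rangle_{\Sigma x:A.B})\rhd a$ if $s(a)=\diamond$; $\pi_2^{\mathsf s}(\langle a,b\rangle_{\Sigma x:A.B})\rhd b$ if $s(b)=\mathsf s$. $=_{\beta\varepsilon}$: equivalence closure of $\rhd_\beta\cup\rhd_\varepsilon$. Subtyping $\le$: smallest transitive relation with $\mathsf{Type}(i)\le\mathsf{Type}(i+1)$, $T=_{\beta\varepsilon}T'\Rightarrow T\le T'$, $B\le B'\Rightarrow\Pi x:A.B\le\Pi x:A.B'$. Typing: $[]\vdash\mathrm{wf}$; $\Gamma\vdash A:\mathsf{Type}(i)\Rightarrow\Gamma(x_\diamond:A)\vdash\mathrm{wf}$; $\Gamma\vdash A:\mathsf{Prop}\Rightarrow\Gamma(x_*:A)\vdash\mathrm{wf}$; in well-formed $\Gamma$: $\mathsf{Prop}:\mathsf{Type}(i)$, $\mathsf{Type}(i):\mathsf{Type}(i+p)$ ($p\ge1$), $x:A$ if $(x:A)\in\Gamma$; $t:A$, $\Gamma\vdash B:s$, $A\le B\Rightarrow t:B$; $A:s$, $\Gamma(x_{\mathsf s}:A)\vdash B:\mathsf{Type}(i)\Rightarrow\Pi x_{\mathsf s}:A.B:\max(s,\mathsf{Type}(i))$; $A:s$, $\Gamma(x_{\mathsf s}:A)\vdash B:\mathsf{Prop}\Rightarrow\Pi x_{\mathsf s}:A.B:\mathsf{Prop}$; $\Gamma(x:A)\vdash t:B\Rightarrow\lambda x:A.t:\Pi x:A.B$; $t:\Pi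 x_{\mathsf s}:A.B$, $u:A$, $s(u)=\mathsf s\Rightarrow(t\,u):B[x\setminus u]$; $\Gamma(x_\diamond:A)\vdash B:\mathsf{Type}(i)\Rightarrow\Sigma^\diamond x_\diamond:A.B:\mathsf{Type}(i)$; $A:\mathsf{Type}(i)$, $\Gamma(x_\diamond:A)\vdash B:\mathsf{Prop}\Rightarrow\Sigma^*x_\diamond:A.B:\mathsf{Type}(i)$; $a:A$, $b:B[x\setminus a]$, $\Sigma^{\mathsf s}x:A.B:\mathsf{Type}(i)\Rightarrow\langle a,b\rangle_{\Sigma^{\mathsf s}x:A.B}:\Sigma^{\mathsf s}x:A.B$; $t:\Sigma^{\mathsf s}x:A.B\Rightarrow\pi_1(t):A$ and $\pi_2^{\mathsf s}(t):B[x\setminus\pi_1(t)]$. Semantics: assume sets $\mathcal U_n$ ($n\in\mathbb N$) with $\mathcal U_n\in\mathcal U_{n+1}$, each closed under all set-theoretic operations (universes given by inaccessible cardinals). $\emptyset$ is the empty set, $\mathbb I=\{\emptyset\}$. Functions are set-theoretic, $f(x)$ defined only if $x$ is in the domain of $f$; $\Pi_{a\in A}B_a=\{f:A\to\bigcup_a B_a\mid\forall a\in A,f(a)\in B_a\}$, $\Sigma_{a\in A}B_a=\{(a,b)\mid a\in A,b\in B_a\}$. For a map $\mathcal I$ from variables to $\bigcup_i\mathcal U_i$, $\mathcal I;x\leftarrow\alpha$ is $\mathcal I$ updated at $x$. For typable $t$ (in $\Gamma$), the partial interpretation $|\Gamma\vdash t|_{\mathcal I}$ is defined by induction on the size of $t$: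 it is $\emptyset$ if $s(t)=*$; otherwise $|x_\diamond|=\mathcal I(x_\diamond)$; $|\lambda x:A.t|=(\alpha\in|\Gamma\vdash A|_{\mathcal I}\mapsto|\Gamma(x:A)\vdash t|_{\mathcal I;x\leftarrow\alpha})$; $|(t\,u)|=|\Gamma\vdash t|_{\mathcal I}(|\Gamma\vdash u|_{\mathcal I})$ (defined only if the former is a function whose domain contains the latter); $|\Sigma x:A.B|=\Sigma_{\alpha\in|\Gamma\vdash A|_{\mathcal I}}|\Gamma(x:A)\vdash B|_{\mathcal I;x\leftarrow\alpha}$; $|\Pi x:A.B|=\bigcap_{\alpha\in|\Gamma\vdash A|_{\mathcal I}}|\Gamma(x:A)\vdash B|_{\mathcal I;x\leftarrow\alpha}$ if $\Gamma\vdash\Pi x:A.B:\mathsf{Prop}$, and $\Pi_{\alpha\in|\Gamma\vdash A|_{\mathcal I}}|\Gamma(x:A)\vdash B|_{\mathcal I;x\leftarrow\alpha}$ otherwise; $|\langle t,u\rangle|=(|\Gamma\vdash t|_{\mathcal I},|\Gamma\vdash u|_{\mathcal I})$; $|\pi_k(t)|=\alpha_k$ if $|\Gamma\vdash t|_{\mathcal I}$ is a pair $(\alpha_1,\alpha_2)$ (undefined otherwise); $|\mathsf{Prop}|=\{\emptyset,\mathbb I\}$; $|\mathsf{Type}(i)|=\mathcal U_i$. Valid valuations: $\mathcal I\in|[]|$ always; $\mathcal I\in|\Gamma(x:A)|$ iff $\mathcal I\in|\Gamma|$ and $\mathcal I(x)\in|\Gamma\vdash A|_{\mathcal I}$ 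(defined).
   Formalization: The rule for Σ^⋄x:A.B : Type(i) gets the extra premise Γ ⊢ A : Type(i), since otherwise Σ^⋄x:Type(1).Prop : Type(0) is derivable and unsound; and the intersection interpreting a propositional Π over an empty domain is taken to be I. *)

theory Defs
  imports Main
begin

section \<open>Syntax\<close>

datatype tag = Star | Dia

datatype sort = Prop | Type nat

text \<open>
  Terms modulo \<open>\<alpha>\<close>. A tag is part of the identity of a variable (\<open>x\<^sub>*\<close> and \<open>x\<^sub>\<diamond>\<close> are different
  variables), so there is one space of de Bruijn indices per tag: \<open>Var s n\<close> refers to the
  \<open>n\<close>-th enclosing binder \<^emph>\<open>with tag\<close> \<open>s\<close>, binders of the other tag not being counted. Hence
  an occurrence always carries the tag of its binder.

  \<open>Lam s A t\<close> is \<open>\<lambda>x\<^sub>s:A. t\<close>, and \<open>Pi s A B\<close> is \<open>\<Pi>x\<^sub>s:A. B\<close>. The tag of a \<open>\<Sigma>\<close> and the tag of its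
  bound variable differ in \<open>\<Sigma>\<^sup>*x\<^sub>\<diamond>:A. B\<close>, so \<open>Sig s r A B\<close> is \<open>\<Sigma>\<^sup>s x\<^sub>r:A. B\<close>. Finally
  \<open>Pair s r A B a b\<close> is the pair \<open>\<langle>a, b\<rangle>\<close> annotated with \<open>Sig s r A B\<close>.
\<close>

datatype tm =
    Srt sort
  | Var tag nat
  | Lam tag tm tm
  | App tm tm
  | Pi tag tm tm
  | Sig tag tag tm tm
  | Pair tag tag tm tm tm tm
  | Fst tm
  | Snd tag tm
  | Eps

definition under :: "tag \<Rightarrow> tag \<Rightarrow> nat \<Rightarrow> nat" where
  "under r s k = (if r = s then Suc k else k)"

text \<open>\<open>lift s k t\<close> makes room for a fresh variable of tag \<open>s\<close> at index \<open>k\<close>.\<close>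

primrec lift :: "tag \<Rightarrow> nat \<Rightarrow> tm \<Rightarrow> tm" where
  "lift s k (Srt q) = Srt q"
| "lift s k (Var r n) = (if r = s \<and> k \<le> n then Var r (Suc n) else Var r n)"
| "lift s k (Lam r A t) = Lam r (lift s k A) (lift s (under r s k) t)"
| "lift s k (App t u) = App (lift s k t) (lift s k u)"
| "lift s k (Pi r A B) = Pi r (lift s k A) (lift s (under r s k) B)"
| "lift s k (Sig q r A B) = Sig q r (lift s k A) (lift s (under r s k) B)"
| "lift s k (Pair q r A B a b) =
     Pair q r (lift s k A) (lift s (under r s k) B) (lift s k a) (lift s k b)"
| "lift s k (Fst t) = Fst (lift s k t)"
| "lift s k (Snd q t) = Snd q (lift s k t)"
| "lift s k Eps = Eps"

text \<open>\<open>subst s k u t\<close> replaces the variable of tag \<open>s\<close> and index \<open>k\<close> by \<open>u\<close> and removes it from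
  the scope.\<close>

primrec subst :: "tag \<Rightarrow> nat \<Rightarrow> tm \<Rightarrow> tm \<Rightarrow> tm" where
  "subst s k u (Srt q) = Srt q"
| "subst s k u (Var r n) =
     (if r = s then (if n = k then u else if k < n then Var r (n - 1) else Var r n) else Var r n)"
| "subst s k u (Lam r A t) = Lam r (subst s k u A) (subst s (under r s k) (lift r 0 u) t)"
| "subst s k u (App t v) = App (subst s k u t) (subst s k u v)"
| "subst s k u (Pi r A B) = Pi r (subst s k u A) (subst s (under r s k) (lift r 0 u) B)"
| "subst s k u (Sig q r A B) = Sig q r (subst s k u A) (subst s (under r s k) (lift r 0 u) B)"
| "subst s k u (Pair q r A B a b) =
     Pair q r (subst s k u A) (subst s (under r s k) (lift r 0 u) B) (subst s k u a) (subst s k u b)"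
| "subst s k u (Fst t) = Fst (subst s k u t)"
| "subst s k u (Snd q t) = Snd q (subst s k u t)"
| "subst s k u Eps = Eps"

abbreviation inst :: "tm \<Rightarrow> tag \<Rightarrow> tm \<Rightarrow> tm" where
  "inst t s u \<equiv> subst s 0 u t"


section \<open>Reduction, conversion and subtyping\<close>

inductive ctxt_closure :: "(tm \<Rightarrow> tm \<Rightarrow> bool) \<Rightarrow> tm \<Rightarrow> tm \<Rightarrow> bool" for R where
  base: "R t t' \<Longrightarrow> ctxt_closure R t t'"
| Lam1: "ctxt_closure R A A' \<Longrightarrow> ctxt_closure R (Lam s A t) (Lam s A' t)"
| Lam2: "ctxt_closure R t t' \<Longrightarrow> ctxt_closure R (Lam s A t) (Lam s A t')"
| App1: "ctxt_closure R t t' \<Longrightarrow> ctxt_closure R (App t u) (App t' u)"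
| App2: "ctxt_closure R u u' \<Longrightarrow> ctxt_closure R (App t u) (App t u')"
| Pi1: "ctxt_closure R A A' \<Longrightarrow> ctxt_closure R (Pi s A B) (Pi s A' B)"
| Pi2: "ctxt_closure R B B' \<Longrightarrow> ctxt_closure R (Pi s A B) (Pi s A B')"
| Sig1: "ctxt_closure R A A' \<Longrightarrow> ctxt_closure R (Sig s r A B) (Sig s r A' B)"
| Sig2: "ctxt_closure R B B' \<Longrightarrow> ctxt_closure R (Sig s r A B) (Sig s r A B')"
| Pair1: "ctxt_closure R A A' \<Longrightarrow> ctxt_closure R (Pair s r A B a b) (Pair s r A' B a b)"
| Pair2: "ctxt_closure R B B' \<Longrightarrow> ctxt_closure R (Pair s r A B a b) (Pair s r A B' a b)"
| Pair3: "ctxt_closure R a a' \<Longrightarrow> ctxt_closure R (Pair s r A B a b) (Pair s r A B a' b)"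
| Pair4: "ctxt_closure R b b' \<Longrightarrow> ctxt_closure R (Pair s r A B a b) (Pair s r A B a b')"
| Fst: "ctxt_closure R t t' \<Longrightarrow> ctxt_closure R (Fst t) (Fst t')"
| Snd: "ctxt_closure R t t' \<Longrightarrow> ctxt_closure R (Snd s t) (Snd s t')"

inductive ext_step :: "tm \<Rightarrow> tm \<Rightarrow> bool" where
  "ext_step (Var Star n) Eps"
| "ext_step (Lam s A Eps) Eps"
| "ext_step (App Eps t) Eps"
| "ext_step (Snd Star t) Eps"

abbreviation ext :: "tm \<Rightarrow> tm \<Rightarrow> bool" (infix \<open>\<rhd>\<^sub>\<epsilon>\<close> 50) where
  "ext \<equiv> ctxt_closure ext_step"

definition tag_of :: "tm \<Rightarrow> tag" where
  "tag_of t = (if ext\<^sup>*\<^sup>* t Eps then Star else Dia)"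

inductive beta_step :: "tm \<Rightarrow> tm \<Rightarrow> bool" where
  "tag_of u = s \<Longrightarrow> beta_step (App (Lam s A t) u) (inst t s u)"
| "tag_of a = Dia \<Longrightarrow> beta_step (Fst (Pair q r A B a b)) a"
| "tag_of b = s \<Longrightarrow> beta_step (Snd s (Pair q r A B a b)) b"

abbreviation beta :: "tm \<Rightarrow> tm \<Rightarrow> bool" (infix \<open>\<rhd>\<^sub>\<beta>\<close> 50) where
  "beta \<equiv> ctxt_closure beta_step"

definition conv :: "tm \<Rightarrow> tm \<Rightarrow> bool" (infix \<open>=\<^sub>\<beta>\<^sub>\<epsilon>\<close> 50) where
  "conv = equivclp (\<lambda>t t'. t \<rhd>\<^sub>\<beta> t' \<or> t \<rhd>\<^sub>\<epsilon> t')"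

inductive subtype :: "tm \<Rightarrow> tm \<Rightarrow> bool" (infix \<open>\<preceq>\<close> 50) where
  Type: "Srt (Type i) \<preceq> Srt (Type (Suc i))"
| conv: "T =\<^sub>\<beta>\<^sub>\<epsilon> T' \<Longrightarrow> T \<preceq> T'"
| Pi: "B \<preceq> B' \<Longrightarrow> Pi s A B \<preceq> Pi s A B'"
| trans: "T \<preceq> T' \<Longrightarrow> T' \<preceq> T'' \<Longrightarrow> T \<preceq> T''"


section \<open>Typing\<close>

text \<open>The most recent declaration comes first: \<open>(s, A) # \<Gamma>\<close> is \<open>\<Gamma>(x\<^sub>s:A)\<close>.\<close>

type_synonym ctx = "(tag \<times> tm) list"

text \<open>\<open>lookup \<Gamma> s n A\<close> says that \<open>\<Gamma>\<close> declares the variable \<open>Var s n\<close> with type \<open>A\<close>, lifted to \<open>\<Gamma>\<close>.\<close>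

inductive lookup :: "ctx \<Rightarrow> tag \<Rightarrow> nat \<Rightarrow> tm \<Rightarrow> bool" where
  here: "lookup ((s, A) # \<Gamma>) s 0 (lift s 0 A)"
| there: "lookup \<Gamma> s n A \<Longrightarrow> lookup ((r, B) # \<Gamma>) s (under r s n) (lift r 0 A)"

primrec max_Type :: "sort \<Rightarrow> nat \<Rightarrow> sort" where
  "max_Type Prop i = Type i"
| "max_Type (Type j) i = Type (max j i)"

text \<open>
  In rule \<open>Sig_Dia\<close>, the domain \<open>A\<close> has to live in \<open>Type i\<close>, as in rule \<open>Sig_Star\<close>. Without this
  premise, \<open>\<Sigma>\<^sup>\<diamond>x\<^sub>\<diamond>:Type(1). Prop\<close> would be a term of type \<open>Type(0)\<close>, which is unsound.
\<close>

inductive wf_ctx :: "ctx \<Rightarrow> bool" (\<open>\<turnstile> _ wf\<close> [60] 60)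
  and typing :: "ctx \<Rightarrow> tm \<Rightarrow> tm \<Rightarrow> bool" (\<open>_ \<turnstile> _ \<Colon> _\<close> [60, 60, 60] 60)
where
  Nil: "\<turnstile> [] wf"
| Cons_Dia: "\<Gamma> \<turnstile> A \<Colon> Srt (Type i) \<Longrightarrow> \<turnstile> (Dia, A) # \<Gamma> wf"
| Cons_Star: "\<Gamma> \<turnstile> A \<Colon> Srt Prop \<Longrightarrow> \<turnstile> (Star, A) # \<Gamma> wf"
| Prop: "\<turnstile> \<Gamma> wf \<Longrightarrow> \<Gamma> \<turnstile> Srt Prop \<Colon> Srt (Type i)"
| Type: "\<turnstile> \<Gamma> wf \<Longrightarrow> 1 \<le> p \<Longrightarrow> \<Gamma> \<turnstile> Srt (Type i) \<Colon> Srt (Type (i + p))"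
| Var: "\<turnstile> \<Gamma> wf \<Longrightarrow> lookup \<Gamma> s n A \<Longrightarrow> \<Gamma> \<turnstile> Var s n \<Colon> A"
| Conv: "\<Gamma> \<turnstile> t \<Colon> A \<Longrightarrow> \<Gamma> \<turnstile> B \<Colon> Srt q \<Longrightarrow> A \<preceq> B \<Longrightarrow> \<Gamma> \<turnstile> t \<Colon> B"
| Pi_Type: "\<Gamma> \<turnstile> A \<Colon> Srt q \<Longrightarrow> (s, A) # \<Gamma> \<turnstile> B \<Colon> Srt (Type i) \<Longrightarrow>
    \<Gamma> \<turnstile> Pi s A B \<Colon> Srt (max_Type q i)"
| Pi_Prop: "\<Gamma> \<turnstile> A \<Colon> Srt q \<Longrightarrow> (s, A) # \<Gamma> \<turnstile> B \<Colon> Srt Prop \<Longrightarrow> \<Gamma> \<turnstile> Pi s A B \<Colon> Srt Prop"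
| Lam: "(s, A) # \<Gamma> \<turnstile> t \<Colon> B \<Longrightarrow> \<Gamma> \<turnstile> Lam s A t \<Colon> Pi s A B"
| App: "\<Gamma> \<turnstile> t \<Colon> Pi s A B \<Longrightarrow> \<Gamma> \<turnstile> u \<Colon> A \<Longrightarrow> tag_of u = s \<Longrightarrow> \<Gamma> \<turnstile> App t u \<Colon> inst B s u"
| Sig_Dia: "\<Gamma> \<turnstile> A \<Colon> Srt (Type i) \<Longrightarrow> (Dia, A) # \<Gamma> \<turnstile> B \<Colon> Srt (Type i) \<Longrightarrow>
    \<Gamma> \<turnstile> Sig Dia Dia A B \<Colon> Srt (Type i)"
| Sig_Star: "\<Gamma> \<turnstile> A \<Colon> Srt (Type i) \<Longrightarrow> (Dia, A) # \<Gamma> \<turnstile> B \<Colon> Srt Prop \<Longrightarrow>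
    \<Gamma> \<turnstile> Sig Star Dia A B \<Colon> Srt (Type i)"
| Pair: "\<Gamma> \<turnstile> a \<Colon> A \<Longrightarrow> \<Gamma> \<turnstile> b \<Colon> inst B r a \<Longrightarrow> \<Gamma> \<turnstile> Sig s r A B \<Colon> Srt (Type i) \<Longrightarrow>
    \<Gamma> \<turnstile> Pair s r A B a b \<Colon> Sig s r A B"
| Fst: "\<Gamma> \<turnstile> t \<Colon> Sig s r A B \<Longrightarrow> \<Gamma> \<turnstile> Fst t \<Colon> A"
| Snd: "\<Gamma> \<turnstile> t \<Colon> Sig s r A B \<Longrightarrow> \<Gamma> \<turnstile> Snd s t \<Colon> inst B r (Fst t)"


section \<open>Set theory\<close>

text \<open>
  The ambient set theory of the semantics: a type whose elements are the sets of ZFC, with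
  \<open>elts x\<close> the collection of the members of \<open>x\<close>. Separation and replacement are second-order;
  the axiom of choice then follows from the choice operator of HOL.
\<close>

class zf =
  fixes elts :: "'a \<Rightarrow> 'a set"
  assumes extensionality: "elts x = elts y \<Longrightarrow> x = y"
    and foundation: "elts x \<noteq> {} \<Longrightarrow> \<exists>y\<in>elts x. elts y \<inter> elts x = {}"
    and pairing: "\<exists>z. elts z = {x, y}"
    and union: "\<exists>u. elts u = (\<Union>y\<in>elts x. elts y)"
    and powerset: "\<exists>p. elts p = {y. elts y \<subseteq> elts x}"
    and infinity: "\<exists>w. (\<exists>z\<in>elts w. elts z = {}) \<and>
          (\<forall>y\<in>elts w. \<exists>z\<in>elts w. elts z = insert y (elts y))"
    and separation: "\<exists>z. elts z = {y \<in> elts x. P y}"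
    and replacement: "\<exists>z. elts z = F ` elts x"

text \<open>\<open>mk X\<close> is the set with the members \<open>X\<close>, provided that there is one; by the axioms there
  is one for all the \<open>X\<close> below.\<close>

definition mk :: "'v::zf set \<Rightarrow> 'v" where
  "mk X = (THE x. elts x = X)"

definition vempty :: "'v::zf" where
  "vempty = mk {}"

text \<open>\<open>\<bbbI>\<close>\<close>

definition vone :: "'v::zf" where
  "vone = mk {vempty}"

definition vpair :: "'v::zf \<Rightarrow> 'v \<Rightarrow> 'v" where
  "vpair x y = mk {mk {x}, mk {x, y}}"

definition is_vpair :: "'v::zf \<Rightarrow> bool" where
  "is_vpair p \<longleftrightarrow> (\<exists>x y. p = vpair x y)"

definition vfst :: "'v::zf \<Rightarrow> 'v" where
  "vfst p = (THE x. \<exists>y. p = vpair x y)"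

definition vsnd :: "'v::zf \<Rightarrow> 'v" where
  "vsnd p = (THE y. \<exists>x. p = vpair x y)"

definition is_vfun :: "'v::zf \<Rightarrow> bool" where
  "is_vfun f \<longleftrightarrow> (\<forall>p\<in>elts f. is_vpair p) \<and>
     (\<forall>x y y'. vpair x y \<in> elts f \<longrightarrow> vpair x y' \<in> elts f \<longrightarrow> y = y')"

definition vdom :: "'v::zf \<Rightarrow> 'v set" where
  "vdom f = {x. \<exists>y. vpair x y \<in> elts f}"

definition vapp :: "'v::zf \<Rightarrow> 'v \<Rightarrow> 'v" where
  "vapp f x = (THE y. vpair x y \<in> elts f)"

definition vlam :: "'v::zf \<Rightarrow> ('v \<Rightarrow> 'v) \<Rightarrow> 'v" where
  "vlam a F = mk ((\<lambda>x. vpair x (F x)) ` elts a)"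

definition vPi :: "'v::zf \<Rightarrow> ('v \<Rightarrow> 'v) \<Rightarrow> 'v" where
  "vPi a B = mk {f. is_vfun f \<and> vdom f = elts a \<and> (\<forall>x\<in>elts a. vapp f x \<in> elts (B x))}"

definition vSigma :: "'v::zf \<Rightarrow> ('v \<Rightarrow> 'v) \<Rightarrow> 'v" where
  "vSigma a B = mk {vpair x y | x y. x \<in> elts a \<and> y \<in> elts (B x)}"

text \<open>
  Interpretations of propositions are subsets of \<open>\<bbbI>\<close>, so the intersection of the empty family
  of propositions is \<open>\<bbbI>\<close>.
\<close>

definition vInter :: "'v::zf \<Rightarrow> ('v \<Rightarrow> 'v) \<Rightarrow> 'v" where
  "vInter a B = (if elts a = {} then vone else mk (\<Inter>x\<in>elts a. elts (B x)))"

text \<open>Grothendieck universes with an infinite member, that is, \<open>V\<^sub>\<kappa>\<close> for an inaccessible \<open>\<kappa>\<close>.\<close>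

definition universe :: "'v::zf \<Rightarrow> bool" where
  "universe u \<longleftrightarrow>
     (\<forall>x\<in>elts u. elts x \<subseteq> elts u) \<and>
     (\<forall>x\<in>elts u. \<forall>y\<in>elts u. mk {x, y} \<in> elts u) \<and>
     (\<forall>x\<in>elts u. mk {y. elts y \<subseteq> elts x} \<in> elts u) \<and>
     (\<forall>x\<in>elts u. \<forall>F. F ` elts x \<subseteq> elts u \<longrightarrow> mk (\<Union>y\<in>elts x. elts (F y)) \<in> elts u) \<and>
     (\<exists>w\<in>elts u. vempty \<in> elts w \<and> (\<forall>y\<in>elts w. mk (insert y (elts y)) \<in> elts w))"

definition universes :: "(nat \<Rightarrow> 'v::zf) \<Rightarrow> bool" where
  "universes U \<longleftrightarrow> (\<forall>n. universe (U n) \<and> U n \<in> elts (U (Suc n)))"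


section \<open>Interpretation\<close>

type_synonym 'v valuation = "tag \<Rightarrow> nat \<Rightarrow> 'v"

text \<open>\<open>upd s \<alpha> I\<close> is \<open>I; x\<^sub>s \<leftarrow> \<alpha>\<close> for a new variable \<open>x\<^sub>s\<close> of index 0; \<open>tail s I\<close> forgets the
  value of that variable.\<close>

definition upd :: "tag \<Rightarrow> 'v \<Rightarrow> 'v valuation \<Rightarrow> 'v valuation" where
  "upd s \<alpha> I = (\<lambda>r n. if r = s then (case n of 0 \<Rightarrow> \<alpha> | Suc m \<Rightarrow> I r m) else I r n)"

definition tail :: "tag \<Rightarrow> 'v valuation \<Rightarrow> 'v valuation" where
  "tail s I = (\<lambda>r n. I r (under s r n))"

text \<open>A construction applied to a family over a set is defined if the set and all the members
  of the family are.\<close>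

definition over :: "('v::zf \<Rightarrow> ('v \<Rightarrow> 'v) \<Rightarrow> 'v) \<Rightarrow> 'v option \<Rightarrow> ('v \<Rightarrow> 'v option) \<Rightarrow> 'v option" where
  "over op a F = (case a of None \<Rightarrow> None
     | Some x \<Rightarrow> if \<forall>\<alpha>\<in>elts x. F \<alpha> \<noteq> None then Some (op x (\<lambda>\<alpha>. the (F \<alpha>))) else None)"

text \<open>\<open>interp U \<Gamma> t I\<close> is \<open>|\<Gamma> \<turnstile> t|\<close> under \<open>I\<close>; the value \<open>None\<close> means undefined.\<close>

function interp :: "(nat \<Rightarrow> 'v::zf) \<Rightarrow> ctx \<Rightarrow> tm \<Rightarrow> 'v valuation \<Rightarrow> 'v option" where
  "interp U \<Gamma> t I =
    (if \<nexists>T. \<Gamma> \<turnstile> t \<Colon> T then None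
     else if tag_of t = Star then Some vempty
     else case t of
       Srt Prop \<Rightarrow> Some (mk {vempty, vone})
     | Srt (Type i) \<Rightarrow> Some (U i)
     | Var s n \<Rightarrow> Some (I s n)
     | Lam s A b \<Rightarrow>
         over vlam (interp U \<Gamma> A I) (\<lambda>\<alpha>. interp U ((s, A) # \<Gamma>) b (upd s \<alpha> I))
     | App f u \<Rightarrow>
         (case (interp U \<Gamma> f I, interp U \<Gamma> u I) of
            (Some x, Some y) \<Rightarrow> if is_vfun x \<and> y \<in> vdom x then Some (vapp x y) else None
          | _ \<Rightarrow> None)
     | Pi s A B \<Rightarrow>
         over (if \<Gamma> \<turnstile> Pi s A B \<Colon> Srt Prop then vInter else vPi)
           (interp U \<Gamma> A I) (\<lambda>\<alpha>. interp U ((s, A) # \<Gamma>) B (upd s \<alpha> I))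
     | Sig q s A B \<Rightarrow>
         over vSigma (interp U \<Gamma> A I) (\<lambda>\<alpha>. interp U ((s, A) # \<Gamma>) B (upd s \<alpha> I))
     | Pair q s A B a b \<Rightarrow>
         (case (interp U \<Gamma> a I, interp U \<Gamma> b I) of
            (Some x, Some y) \<Rightarrow> Some (vpair x y)
          | _ \<Rightarrow> None)
     | Fst p \<Rightarrow>
         (case interp U \<Gamma> p I of
            Some x \<Rightarrow> if is_vpair x then Some (vfst x) else None
          | None \<Rightarrow> None)
     | Snd q p \<Rightarrow>
         (case interp U \<Gamma> p I of
            Some x \<Rightarrow> if is_vpair x then Some (vsnd x) else None
          | None \<Rightarrow> None)
     | Eps \<Rightarrow> None)"
  by pat_completeness auto
termination
  by (relation "measure (\<lambda>(U, \<Gamma>, t, I). size t)") auto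

declare interp.simps [simp del]

text \<open>\<open>valid U \<Gamma> I\<close> is \<open>I \<in> |\<Gamma>|\<close>. Valuations take their values in \<open>\<Union>\<^sub>i U\<^sub>i\<close>.\<close>

primrec valid :: "(nat \<Rightarrow> 'v::zf) \<Rightarrow> ctx \<Rightarrow> 'v valuation \<Rightarrow> bool" where
  "valid U [] I \<longleftrightarrow> (\<forall>s n. \<exists>i. I s n \<in> elts (U i))"
| "valid U (d # \<Gamma>) I \<longleftrightarrow> (case d of (s, A) \<Rightarrow>
     valid U \<Gamma> (tail s I) \<and>
     (\<exists>a. interp U \<Gamma> A (tail s I) = Some a \<and> I s 0 \<in> elts a))"

end

theory Submission
  imports Defs
begin

text \<open>
  The tag of a term can be read off its structure, and replacing all subterms of tag \<open>*\<close> by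
  \<open>\<epsilon>\<close> computes the extraction normal form. Extraction commutes with \<open>\<beta>\<close>, and \<open>\<beta>\<close> alone is
  orthogonal, so \<open>\<beta>\<close> is confluent and \<open>A =\<^sub>\<beta>\<^sub>\<epsilon> B\<close> holds iff the extractions of \<open>A\<close> and \<open>B\<close> have a
  common \<open>\<beta>\<close>-reduct. A \<open>\<beta>\<close>-step of an extraction lifts to the term itself; hence
  \<open>A \<le> B\<close> yields typed reducts \<open>A'\<close>, \<open>B'\<close> of \<open>A\<close>, \<open>B\<close> whose extractions agree up to the levels of
  universes in the codomain. So the untyped conversion path between two types never has to be
  interpreted: the interpretation is preserved by typed \<open>\<beta>\<close>-steps (where it is defined), it depends
  on the extraction only, and it is monotone in the levels.

  The interpretation of a product asks whether the product is a proposition. That this is stable under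
  substitution, reduction and extraction follows from the uniqueness of types up to proofs and levels.

  Subject reduction for \<open>\<pi>\<^sub>1\<close> inside the type of a second projection needs that tags agree with
  sorts, and that agreement for a converted type needs subject reduction. The circle is broken by an
  auxiliary system whose rules carry the tags as premises; it turns out to be equivalent to the
  original one.
\<close>

text \<open>\<open>Eps\<close> has no type, so the extraction of a typable term is in general
  untypable, and the intermediate terms of a conversion may be untypable as well;
  \<open>interp\<close> is undefined on such terms. This is why reductions found among extractions
  are pulled back to the terms themselves: subject reduction then gives them types.

  Definedness is never obtained from reduction. A \<beta>-step can make a term more defined, since a
  redex needs a value of its argument in the domain of the function, and a projection of a pair
  needs a value of the discarded component. Invariance is therefore a one-way statement about terms
  that already have a value. This suffices for the conversion rule: by induction, both of its types
  have values, the source as the type of the subject and the target as a member of a sort.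

  A product in \<open>Prop\<close> is an intersection whose proofs are all the empty set, whereas a
  product in some \<open>Type\<close> is a set of functions. Confusing the two would break every
  comparison of values, hence the weight put on the agreement of tags and sorts.\<close>

section \<open>Structural tags and erasure\<close>

primrec tg :: "tm \<Rightarrow> tag" where
  "tg (Srt q) = Dia"
| "tg (Var s n) = s"
| "tg (Lam s A t) = tg t"
| "tg (App t u) = tg t"
| "tg (Pi s A B) = Dia"
| "tg (Sig q s A B) = Dia"
| "tg (Pair q s A B a b) = Dia"
| "tg (Fst t) = Dia"
| "tg (Snd q t) = q"
| "tg Eps = Star"

text \<open>
  Extraction, with a function applied to all sorts on the way: the identity gives the extraction normal
  form, and collapsing the levels makes subtyping invisible.
\<close>

primrec erase :: "(sort \<Rightarrow> sort) \<Rightarrow> tm \<Rightarrow> tm" where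
  "erase f (Srt q) = Srt (f q)"
| "erase f (Var s n) = (if s = Star then Eps else Var s n)"
| "erase f (Lam s A t) = (if tg t = Star then Eps else Lam s (erase f A) (erase f t))"
| "erase f (App t u) = (if tg t = Star then Eps else App (erase f t) (erase f u))"
| "erase f (Pi s A B) = Pi s (erase f A) (erase f B)"
| "erase f (Sig q s A B) = Sig q s (erase f A) (erase f B)"
| "erase f (Pair q s A B a b) = Pair q s (erase f A) (erase f B) (erase f a) (erase f b)"
| "erase f (Fst t) = Fst (erase f t)"
| "erase f (Snd q t) = (if q = Star then Eps else Snd q (erase f t))"
| "erase f Eps = Eps"

abbreviation extr :: "tm \<Rightarrow> tm" where
  "extr \<equiv> erase (\<lambda>q. q)"

lemma tag_not_Dia [simp]: "s \<noteq> Dia \<longleftrightarrow> s = Star" "Dia \<noteq> s \<longleftrightarrow> s = Star"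
  by (cases s; simp)+

lemma tag_not_Star [simp]: "s \<noteq> Star \<longleftrightarrow> s = Dia" "Star \<noteq> s \<longleftrightarrow> s = Dia"
  by (cases s; simp)+

lemma erase_Star [simp]: "tg t = Star \<Longrightarrow> erase f t = Eps"
  by (cases t) auto

lemma tg_erase [simp]: "tg (erase f t) = tg t"
  by (induction t) auto

lemma erase_erase: "erase f (erase g t) = erase (\<lambda>q. f (g q)) t"
  by (induction t) auto

section \<open>Many-step reduction inside contexts\<close>

lemma rtranclp_map:
  assumes "\<And>x y. R x y \<Longrightarrow> R (F x) (F y)" "R\<^sup>*\<^sup>* x y"
  shows "R\<^sup>*\<^sup>* (F x) (F y)"
  using assms(2) by induction (auto intro: assms(1) rtranclp.rtrancl_into_rtrancl)

lemma closure_rtranclp_Lam: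
  assumes "(ctxt_closure R)\<^sup>*\<^sup>* A A'" "(ctxt_closure R)\<^sup>*\<^sup>* t t'"
  shows "(ctxt_closure R)\<^sup>*\<^sup>* (Lam s A t) (Lam s A' t')"
  using rtranclp_map[of "ctxt_closure R" "\<lambda>A. Lam s A t", OF _ assms(1)]
    rtranclp_map[of "ctxt_closure R" "Lam s A'", OF _ assms(2)]
  by (auto intro: ctxt_closure.intros rtranclp_trans)

lemma closure_rtranclp_App:
  assumes "(ctxt_closure R)\<^sup>*\<^sup>* t t'" "(ctxt_closure R)\<^sup>*\<^sup>* u u'"
  shows "(ctxt_closure R)\<^sup>*\<^sup>* (App t u) (App t' u')"
  using rtranclp_map[of "ctxt_closure R" "\<lambda>t. App t u", OF _ assms(1)]
    rtranclp_map[of "ctxt_closure R" "App t'", OF _ assms(2)]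
  by (auto intro: ctxt_closure.intros rtranclp_trans)

lemma closure_rtranclp_Pi:
  assumes "(ctxt_closure R)\<^sup>*\<^sup>* A A'" "(ctxt_closure R)\<^sup>*\<^sup>* B B'"
  shows "(ctxt_closure R)\<^sup>*\<^sup>* (Pi s A B) (Pi s A' B')"
  using rtranclp_map[of "ctxt_closure R" "\<lambda>A. Pi s A B", OF _ assms(1)]
    rtranclp_map[of "ctxt_closure R" "Pi s A'", OF _ assms(2)]
  by (auto intro: ctxt_closure.intros rtranclp_trans)

lemma closure_rtranclp_Sig:
  assumes "(ctxt_closure R)\<^sup>*\<^sup>* A A'" "(ctxt_closure R)\<^sup>*\<^sup>* B B'"
  shows "(ctxt_closure R)\<^sup>*\<^sup>* (Sig q s A B) (Sig q s A' B')"
  using rtranclp_map[of "ctxt_closure R" "\<lambda>A. Sig q s A B", OF _ assms(1)]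
    rtranclp_map[of "ctxt_closure R" "Sig q s A'", OF _ assms(2)]
  by (auto intro: ctxt_closure.intros rtranclp_trans)

lemma closure_rtranclp_Pair:
  assumes "(ctxt_closure R)\<^sup>*\<^sup>* A A'" "(ctxt_closure R)\<^sup>*\<^sup>* B B'"
    "(ctxt_closure R)\<^sup>*\<^sup>* a a'" "(ctxt_closure R)\<^sup>*\<^sup>* b b'"
  shows "(ctxt_closure R)\<^sup>*\<^sup>* (Pair q s A B a b) (Pair q s A' B' a' b')"
proof -
  have "(ctxt_closure R)\<^sup>*\<^sup>* (Pair q s A B a b) (Pair q s A' B a b)"
    by (rule rtranclp_map[of _ "\<lambda>A. Pair q s A B a b", OF _ assms(1)]) (rule ctxt_closure.intros)
  also have "(ctxt_closure R)\<^sup>*\<^sup>* \<dots> (Pair q s A' B' a b)"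
    by (rule rtranclp_map[of _ "\<lambda>B. Pair q s A' B a b", OF _ assms(2)]) (rule ctxt_closure.intros)
  also have "(ctxt_closure R)\<^sup>*\<^sup>* \<dots> (Pair q s A' B' a' b)"
    by (rule rtranclp_map[of _ "\<lambda>a. Pair q s A' B' a b", OF _ assms(3)]) (rule ctxt_closure.intros)
  also have "(ctxt_closure R)\<^sup>*\<^sup>* \<dots> (Pair q s A' B' a' b')"
    by (rule rtranclp_map[of _ "Pair q s A' B' a'", OF _ assms(4)]) (rule ctxt_closure.intros)
  finally show ?thesis .
qed

lemma closure_rtranclp_Fst: "(ctxt_closure R)\<^sup>*\<^sup>* t t' \<Longrightarrow> (ctxt_closure R)\<^sup>*\<^sup>* (Fst t) (Fst t')"
  using rtranclp_map[of "ctxt_closure R" Fst] by (auto intro: ctxt_closure.intros)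

lemma closure_rtranclp_Snd: "(ctxt_closure R)\<^sup>*\<^sup>* t t' \<Longrightarrow> (ctxt_closure R)\<^sup>*\<^sup>* (Snd q t) (Snd q t')"
  using rtranclp_map[of "ctxt_closure R" "Snd q"] by (auto intro: ctxt_closure.intros)

lemmas closure_rtranclp_intros = closure_rtranclp_Lam closure_rtranclp_App closure_rtranclp_Pi
  closure_rtranclp_Sig closure_rtranclp_Pair closure_rtranclp_Fst closure_rtranclp_Snd

section \<open>Extraction reaches its normal form\<close>

text \<open>Subterms are normalised first: once the body of an abstraction or the head of an
  application is \<open>Eps\<close>, one further step collapses the whole term.\<close>

lemma ext_erase: "ext\<^sup>*\<^sup>* t (extr t)"
proof (induction t)
  case (Var s n)
  then show ?case by (auto intro!: r_into_rtranclp ctxt_closure.base ext_step.intros)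
next
  case (Lam s A t)
  show ?case
  proof (cases "tg t = Star")
    case True
    then have "ext\<^sup>*\<^sup>* (Lam s A t) (Lam s A Eps)"
      using Lam.IH by (simp add: closure_rtranclp_Lam)
    moreover have "ext (Lam s A Eps) Eps" by (intro ctxt_closure.base ext_step.intros)
    ultimately show ?thesis using True by (simp add: rtranclp.rtrancl_into_rtrancl)
  qed (use Lam.IH in \<open>simp add: closure_rtranclp_intros\<close>)
next
  case (App t u)
  show ?case
  proof (cases "tg t = Star")
    case True
    then have "ext\<^sup>*\<^sup>* (App t u) (App Eps u)"
      using App.IH by (simp add: closure_rtranclp_App)
    moreover have "ext (App Eps u) Eps" by (intro ctxt_closure.base ext_step.intros)
    ultimately show ?thesis using True by (simp add: rtranclp.rtrancl_into_rtrancl)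
  qed (use App.IH in \<open>simp add: closure_rtranclp_intros\<close>)
next
  case (Snd q t)
  show ?case
  proof (cases "q = Star")
    case True
    then show ?thesis by (auto intro!: r_into_rtranclp ctxt_closure.base ext_step.intros)
  qed (use Snd.IH in \<open>simp add: closure_rtranclp_intros\<close>)
qed (simp_all add: closure_rtranclp_intros)

lemma tg_ext: "ext t t' \<Longrightarrow> tg t' = tg t"
  by (induction rule: ctxt_closure.induct) (auto elim: ext_step.cases)

text \<open>\<open>tag_of\<close> asks for a reduction to \<open>Eps\<close>, which is awkward to
  refute. Extraction steps preserve \<open>tg\<close>, and \<open>tg Eps = Star\<close>, so a term
  with structural tag \<open>Dia\<close> never reaches \<open>Eps\<close>; conversely,
  \<open>extr\<close> collapses every term with tag \<open>Star\<close>.\<close>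

lemma tag_of_eq: "tag_of t = tg t"
proof -
  have "ext\<^sup>*\<^sup>* t t' \<Longrightarrow> tg t' = tg t" for t'
    by (induction rule: rtranclp_induct) (auto dest: tg_ext)
  moreover have "ext\<^sup>*\<^sup>* t Eps" if "tg t = Star"
    using ext_erase[of t] that by simp
  ultimately show ?thesis unfolding tag_of_def by (cases "tg t") force+
qed

text \<open>Redex and contractum of an extraction step both have tag \<open>Star\<close>, so both
  are erased to \<open>Eps\<close>, and the tags of the surrounding terms do not change.\<close>

lemma erase_ext: "ext t t' \<Longrightarrow> erase f t' = erase f t"
  by (induction rule: ctxt_closure.induct) (auto elim!: ext_step.cases dest: tg_ext)

section \<open>Parallel renaming and substitution\<close>

type_synonym ren = "tag \<Rightarrow> nat \<Rightarrow> nat"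
type_synonym sbs = "tag \<Rightarrow> nat \<Rightarrow> tm"

text \<open>Each tag has its own index space, so crossing a binder with tag \<open>r\<close> moves
  the indices of that tag only.\<close>

definition shf :: "tag \<Rightarrow> ren" where
  "shf r = (\<lambda>s n. if s = r then Suc n else n)"

definition upr :: "tag \<Rightarrow> ren \<Rightarrow> ren" where
  "upr r \<rho> = (\<lambda>s n. if s = r then (case n of 0 \<Rightarrow> 0 | Suc m \<Rightarrow> Suc (\<rho> s m)) else \<rho> s n)"

primrec ren :: "ren \<Rightarrow> tm \<Rightarrow> tm" where
  "ren \<rho> (Srt q) = Srt q"
| "ren \<rho> (Var s n) = Var s (\<rho> s n)"
| "ren \<rho> (Lam s A t) = Lam s (ren \<rho> A) (ren (upr s \<rho>) t)"
| "ren \<rho> (App t u) = App (ren \<rho> t) (ren \<rho> u)"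
| "ren \<rho> (Pi s A B) = Pi s (ren \<rho> A) (ren (upr s \<rho>) B)"
| "ren \<rho> (Sig q s A B) = Sig q s (ren \<rho> A) (ren (upr s \<rho>) B)"
| "ren \<rho> (Pair q s A B a b) = Pair q s (ren \<rho> A) (ren (upr s \<rho>) B) (ren \<rho> a) (ren \<rho> b)"
| "ren \<rho> (Fst t) = Fst (ren \<rho> t)"
| "ren \<rho> (Snd q t) = Snd q (ren \<rho> t)"
| "ren \<rho> Eps = Eps"

definition ups :: "tag \<Rightarrow> sbs \<Rightarrow> sbs" where
  "ups r \<sigma> = (\<lambda>s n. if s = r then (case n of 0 \<Rightarrow> Var s 0 | Suc m \<Rightarrow> ren (shf r) (\<sigma> s m))
     else ren (shf r) (\<sigma> s n))"

primrec sb :: "sbs \<Rightarrow> tm \<Rightarrow> tm" where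
  "sb \<sigma> (Srt q) = Srt q"
| "sb \<sigma> (Var s n) = \<sigma> s n"
| "sb \<sigma> (Lam s A t) = Lam s (sb \<sigma> A) (sb (ups s \<sigma>) t)"
| "sb \<sigma> (App t u) = App (sb \<sigma> t) (sb \<sigma> u)"
| "sb \<sigma> (Pi s A B) = Pi s (sb \<sigma> A) (sb (ups s \<sigma>) B)"
| "sb \<sigma> (Sig q s A B) = Sig q s (sb \<sigma> A) (sb (ups s \<sigma>) B)"
| "sb \<sigma> (Pair q s A B a b) = Pair q s (sb \<sigma> A) (sb (ups s \<sigma>) B) (sb \<sigma> a) (sb \<sigma> b)"
| "sb \<sigma> (Fst t) = Fst (sb \<sigma> t)"
| "sb \<sigma> (Snd q t) = Snd q (sb \<sigma> t)"
| "sb \<sigma> Eps = Eps"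

definition single :: "tag \<Rightarrow> tm \<Rightarrow> sbs" where
  "single s u = (\<lambda>r n. if r = s then (case n of 0 \<Rightarrow> u | Suc m \<Rightarrow> Var r m) else Var r n)"

text \<open>First of the composition laws \<open>ren_ren\<close>, \<open>sb_ren\<close>,
  \<open>ren_sb\<close>, \<open>sb_sb\<close>; the later ones pass under binders by means of the
  earlier ones.\<close>

lemma ren_ren: "ren \<rho> (ren \<tau> t) = ren (\<lambda>s n. \<rho> s (\<tau> s n)) t"
proof -
  have [simp]: "(\<lambda>s n. upr r \<rho> s (upr r \<tau> s n)) = upr r (\<lambda>s n. \<rho> s (\<tau> s n))" for r \<rho> \<tau>
    by (auto simp: upr_def fun_eq_iff split: nat.splits)
  show ?thesis by (induction t arbitrary: \<rho> \<tau>) auto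
qed

lemma sb_ren: "sb \<sigma> (ren \<rho> t) = sb (\<lambda>s n. \<sigma> s (\<rho> s n)) t"
proof -
  have [simp]: "(\<lambda>s n. ups r \<sigma> s (upr r \<rho> s n)) = ups r (\<lambda>s n. \<sigma> s (\<rho> s n))" for r \<sigma> \<rho>
    by (auto simp: upr_def ups_def fun_eq_iff split: nat.splits)
  show ?thesis by (induction t arbitrary: \<sigma> \<rho>) auto
qed

lemma ren_shf: "ren (upr r \<rho>) (ren (shf r) t) = ren (shf r) (ren \<rho> t)"
  unfolding ren_ren by (rule arg_cong[where f = "\<lambda>\<rho>. ren \<rho> t"]) (auto simp: upr_def shf_def fun_eq_iff)

lemma ren_sb: "ren \<rho> (sb \<sigma> t) = sb (\<lambda>s n. ren \<rho> (\<sigma> s n)) t"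
proof -
  have [simp]: "(\<lambda>s n. ren (upr r \<rho>) (ups r \<sigma> s n)) = ups r (\<lambda>s n. ren \<rho> (\<sigma> s n))" for r \<sigma> \<rho>
    by (auto simp: ups_def ren_shf fun_eq_iff split: nat.splits) (auto simp: upr_def)
  show ?thesis by (induction t arbitrary: \<sigma> \<rho>) auto
qed

lemma sb_shf: "sb (ups r \<sigma>) (ren (shf r) t) = ren (shf r) (sb \<sigma> t)"
  unfolding sb_ren ren_sb
  by (rule arg_cong[where f = "\<lambda>\<rho>. sb \<rho> t"]) (auto simp: ups_def shf_def fun_eq_iff)

lemma sb_sb: "sb \<tau> (sb \<sigma> t) = sb (\<lambda>s n. sb \<tau> (\<sigma> s n)) t"
proof -
  have [simp]: "(\<lambda>s n. sb (ups r \<tau>) (ups r \<sigma> s n)) = ups r (\<lambda>s n. sb \<tau> (\<sigma> s n))" for r \<sigma> \<tau>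
    by (auto simp: ups_def sb_shf[unfolded ups_def] fun_eq_iff split: nat.splits)
  show ?thesis by (induction t arbitrary: \<sigma> \<tau>) auto
qed

lemma ups_Var [simp]: "ups r (\<lambda>s n. Var s (\<rho> s n)) = (\<lambda>s n. Var s (upr r \<rho> s n))"
  by (auto simp: ups_def upr_def shf_def fun_eq_iff split: nat.splits)

lemma ren_eq_sb: "ren \<rho> t = sb (\<lambda>s n. Var s (\<rho> s n)) t"
  by (induction t arbitrary: \<rho>) auto

lemma upr_id [simp]: "upr r (\<lambda>s n. n) = (\<lambda>s n. n)"
  by (auto simp: upr_def fun_eq_iff split: nat.splits)

lemma ren_id [simp]: "ren (\<lambda>s n. n) t = t"
  by (induction t) auto

lemma sb_Var [simp]: "sb Var t = t"
  using ren_eq_sb[of "\<lambda>s n. n" t] by (simp add: eta_contract_eq)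

lemma lift_eq_ren: "lift s k t = ren (\<lambda>r n. if r = s \<and> k \<le> n then Suc n else n) t"
proof -
  have [simp]: "upr r (\<lambda>r n. if r = s \<and> k \<le> n then Suc n else n) =
      (\<lambda>r' n. if r' = s \<and> under r s k \<le> n then Suc n else n)" for r k
    by (auto simp: upr_def under_def fun_eq_iff split: nat.splits)
  show ?thesis by (induction t arbitrary: k) auto
qed

lemma lift_0 [simp]: "lift s 0 t = ren (shf s) t"
  unfolding lift_eq_ren shf_def by (rule arg_cong[where f = "\<lambda>\<rho>. ren \<rho> t"]) auto

text \<open>\<open>subst\<close> lifts the substituted term at each binder, which is the effect of
  \<open>ups\<close>. With this and \<open>lift_eq_ren\<close>, the composition laws of parallel
  substitutions apply to the given operations.\<close>

lemma subst_eq_sb: "subst s k u t =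
  sb (\<lambda>r n. if r = s then (if n = k then u else if k < n then Var r (n - 1) else Var r n) else Var r n) t"
proof -
  have "ups r (\<lambda>r n. if r = s then (if n = k then u else if k < n then Var r (n - 1) else Var r n) else Var r n) =
      (\<lambda>r' n. if r' = s then (if n = under r s k then ren (shf r) u else if under r s k < n then Var r' (n - 1)
          else Var r' n) else Var r' n)" for r k u
    by (auto simp: ups_def shf_def under_def fun_eq_iff split: nat.splits)
  then show ?thesis by (induction t arbitrary: k u) (auto simp del: One_nat_def)
qed

lemma inst_eq_sb [simp]: "subst s 0 u t = sb (single s u) t"
  unfolding subst_eq_sb single_def by (rule arg_cong[where f = "\<lambda>\<rho>. sb \<rho> t"]) (auto simp: fun_eq_iff split: nat.splits)

lemma single_shf [simp]: "sb (single s u) (ren (shf s) t) = t"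
proof -
  have "(\<lambda>r n. single s u r (shf s r n)) = Var"
    by (auto simp: single_def shf_def fun_eq_iff)
  then show ?thesis by (simp add: sb_ren)
qed

lemma sb_single: "sb \<sigma> (sb (single s u) t) = sb (single s (sb \<sigma> u)) (sb (ups s \<sigma>) t)"
proof -
  have "sb \<sigma> (single s u r n) = sb (single s (sb \<sigma> u)) (ups s \<sigma> r n)" for r n
    by (cases n) (auto simp: ups_def, auto simp: single_def)
  then show ?thesis by (simp add: sb_sb)
qed

lemma ren_single: "ren \<rho> (sb (single s u) t) = sb (single s (ren \<rho> u)) (ren (upr s \<rho>) t)"
  unfolding ren_sb sb_ren
  by (rule arg_cong[where f = "\<lambda>\<rho>. sb \<rho> t"])
    (auto simp: single_def upr_def fun_eq_iff split: nat.splits)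

text \<open>A variable may only be replaced by a term with its own tag. This makes tags of terms
  invariant under substitution, and with them the side conditions of redexes.\<close>

definition good :: "sbs \<Rightarrow> bool" where
  "good \<sigma> \<longleftrightarrow> (\<forall>s n. tg (\<sigma> s n) = s)"

lemma tg_ren [simp]: "tg (ren \<rho> t) = tg t"
  by (induction t arbitrary: \<rho>) auto

lemma good_ups [intro]: "good \<sigma> \<Longrightarrow> good (ups s \<sigma>)"
  by (auto simp: good_def ups_def split: nat.splits)

lemma good_single [intro]: "tg u = s \<Longrightarrow> good (single s u)"
  by (auto simp: good_def single_def split: nat.splits)

lemma good_Var [simp]: "good Var" "good (\<lambda>s n. Var s (\<rho> s n))"
  by (auto simp: good_def)

lemma tg_sb [simp]: "good \<sigma> \<Longrightarrow> tg (sb \<sigma> t) = tg t"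
proof (induction t arbitrary: \<sigma>)
  case (Var s n)
  then show ?case by (simp add: good_def)
qed auto

lemma erase_ren [simp]: "erase f (ren \<rho> t) = ren \<rho> (erase f t)"
  by (induction t arbitrary: \<rho>) auto

text \<open>A variable with tag \<open>Star\<close> is erased on one side and replaced by a term of
  tag \<open>Star\<close>, hence erased, on the other; so \<open>\<sigma>'\<close> is constrained on
  \<open>Dia\<close> variables only.\<close>

lemma erase_sb:
  assumes "good \<sigma>" "\<And>n. \<sigma>' Dia n = erase f (\<sigma> Dia n)"
  shows "erase f (sb \<sigma> t) = sb \<sigma>' (erase f t)"
proof -
  have *: "good \<sigma> \<Longrightarrow> (\<And>n. \<sigma>' Dia n = erase f (\<sigma> Dia n)) \<Longrightarrow> ups r \<sigma>' Dia n = erase f (ups r \<sigma> Dia n)" for r \<sigma> \<sigma>' n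
    by (auto simp: ups_def split: nat.splits)
  show ?thesis using assms
  proof (induction t arbitrary: \<sigma> \<sigma>')
    case (Var s n)
    then show ?case by (cases s) (auto simp: good_def)
  next
    case (Lam s A t)
    show ?case using Lam.prems by (auto simp: good_ups intro!: Lam.IH *)
  next
    case (App t u)
    show ?case using App.prems by (auto intro!: App.IH)
  next
    case (Pi s A B)
    show ?case using Pi.prems by (auto simp: good_ups intro!: Pi.IH *)
  next
    case (Sig q s A B)
    show ?case using Sig.prems by (auto simp: good_ups intro!: Sig.IH *)
  next
    case (Pair q s A B a b)
    show ?case using Pair.prems by (auto simp: good_ups intro!: Pair.IH *)
  next
    case (Fst t)
    show ?case using Fst.prems by (auto intro!: Fst.IH)
  next
    case (Snd q t)
    show ?case using Snd.prems by (auto intro!: Snd.IH)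
  qed auto
qed

section \<open>Confluence\<close>

text \<open>The side conditions on tags do no harm: tags are stable under reduction and under
  substitutions that respect tags.\<close>

inductive par :: "tm \<Rightarrow> tm \<Rightarrow> bool" where
  Srt: "par (Srt q) (Srt q)"
| Var: "par (Var s n) (Var s n)"
| Lam: "par A A' \<Longrightarrow> par t t' \<Longrightarrow> par (Lam s A t) (Lam s A' t')"
| App: "par t t' \<Longrightarrow> par u u' \<Longrightarrow> par (App t u) (App t' u')"
| Pi: "par A A' \<Longrightarrow> par B B' \<Longrightarrow> par (Pi s A B) (Pi s A' B')"
| Sig: "par A A' \<Longrightarrow> par B B' \<Longrightarrow> par (Sig q s A B) (Sig q s A' B')"
| Pair: "par A A' \<Longrightarrow> par B B' \<Longrightarrow> par a a' \<Longrightarrow> par b b' \<Longrightarrow>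
    par (Pair q s A B a b) (Pair q s A' B' a' b')"
| Fst: "par t t' \<Longrightarrow> par (Fst t) (Fst t')"
| Snd: "par t t' \<Longrightarrow> par (Snd q t) (Snd q t')"
| Eps: "par Eps Eps"
| Beta: "par t t' \<Longrightarrow> par u u' \<Longrightarrow> tg u = s \<Longrightarrow> par (App (Lam s A t) u) (sb (single s u') t')"
| Fst_Pair: "par a a' \<Longrightarrow> tg a = Dia \<Longrightarrow> par (Fst (Pair q s A B a b)) a'"
| Snd_Pair: "par b b' \<Longrightarrow> tg b = q \<Longrightarrow> par (Snd q (Pair p s A B a b)) b'"

lemma par_refl [intro, simp]: "par t t"
  by (induction t) (auto intro: par.intros)

lemma tg_par: "par t t' \<Longrightarrow> tg t' = tg t"
  by (induction rule: par.induct) (auto simp: good_single)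

lemma par_ren: "par t t' \<Longrightarrow> par (ren \<rho> t) (ren \<rho> t')"
proof (induction arbitrary: \<rho> rule: par.induct)
  case (Beta t t' u u' s A)
  then show ?case by (simp add: ren_single par.Beta)
qed (auto intro: par.intros)

lemma par_ups: "(\<And>s n. par (\<sigma> s n) (\<sigma>' s n)) \<Longrightarrow> par (ups r \<sigma> s n) (ups r \<sigma>' s n)"
  by (cases n) (auto simp: ups_def par_ren)

lemma par_sb:
  "par t t' \<Longrightarrow> good \<sigma> \<Longrightarrow> (\<And>s n. par (\<sigma> s n) (\<sigma>' s n)) \<Longrightarrow> par (sb \<sigma> t) (sb \<sigma>' t')"
proof (induction arbitrary: \<sigma> \<sigma>' rule: par.induct)
  case (Beta t t' u u' s A)
  have "par (App (Lam s (sb \<sigma> A) (sb (ups s \<sigma>) t)) (sb \<sigma> u)) (sb (single s (sb \<sigma>' u')) (sb (ups s \<sigma>') t'))"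
    by (intro par.Beta Beta.IH Beta.prems par_ups good_ups) (use Beta in auto)
  then show ?case by (simp add: sb_single)
next
  case (Lam A A' t t' s)
  show ?case by (auto intro!: par.Lam Lam.IH Lam.prems par_ups)
next
  case (Pi A A' t t' s)
  show ?case by (auto intro!: par.Pi Pi.IH Pi.prems par_ups)
next
  case (Sig A A' t t' s)
  show ?case by (auto intro!: par.Sig Sig.IH Sig.prems par_ups)
next
  case (Pair A A' t t' s)
  show ?case by (auto intro!: par.Pair Pair.IH Pair.prems par_ups)
qed (auto intro: par.intros)

lemma par_single:
  assumes "par t t'" "par u u'" "tg u = s"
  shows "par (sb (single s u) t) (sb (single s u') t')"
  using assms(1) good_single[OF assms(3)]
  by (rule par_sb) (use assms(2) in \<open>auto simp: single_def split: nat.split\<close>)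

section \<open>Complete developments\<close>

text \<open>Takahashi's complete development: all redexes visible in the term whose tag condition
  holds are contracted at once.\<close>

fun dev :: "tm \<Rightarrow> tm" where
  "dev (Srt q) = Srt q"
| "dev (Var s n) = Var s n"
| "dev (Lam s A t) = Lam s (dev A) (dev t)"
| "dev (App t u) = (case t of Lam s A b \<Rightarrow> if tg u = s then sb (single s (dev u)) (dev b) else App (dev t) (dev u)
     | _ \<Rightarrow> App (dev t) (dev u))"
| "dev (Pi s A B) = Pi s (dev A) (dev B)"
| "dev (Sig q s A B) = Sig q s (dev A) (dev B)"
| "dev (Pair q s A B a b) = Pair q s (dev A) (dev B) (dev a) (dev b)"
| "dev (Fst t) = (case t of Pair q s A B a b \<Rightarrow> if tg a = Dia then dev a else Fst (dev t) | _ \<Rightarrow> Fst (dev t))"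
| "dev (Snd q t) = (case t of Pair p s A B a b \<Rightarrow> if tg b = q then dev b else Snd q (dev t) | _ \<Rightarrow> Snd q (dev t))"
| "dev Eps = Eps"

inductive_cases par_LamE: "par (Lam s A t) x"
inductive_cases par_PairE: "par (Pair q s A B a b) x"

text \<open>The triangle property: a parallel reduct reaches \<open>dev t\<close> by contracting the
  redexes that it left over, so any two parallel reducts meet.\<close>

lemma par_dev: "par t t' \<Longrightarrow> par t' (dev t)"
proof (induction rule: par.induct)
  case (App t t' u u')
  show ?case
  proof (cases "\<exists>s A b. t = Lam s A b \<and> tg u = s")
    case True
    \<comment> \<open>The step at hand left this redex in place, but reduction inside an abstraction
      cannot destroy it and the tag of the argument is stable, so it can still be
      contracted.\<close>
    then obtain s A b where [simp]: "t = Lam s A b" "tg u = s" by blast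
    from App(1) obtain A' b' where [simp]: "t' = Lam s A' b'" and "par b b'" by (auto elim: par_LamE)
    from App(3) have "par b' (dev b)" by (auto elim: par_LamE)
    then show ?thesis using App(4) tg_par[OF App(2)] by (auto intro: par.Beta)
  next
    case False
    then have "dev (App t u) = App (dev t) (dev u)" by (cases t) auto
    then show ?thesis using App by (simp add: par.App)
  qed
next
  case (Fst t t')
  show ?case
  proof (cases "\<exists>q s A B a b. t = Pair q s A B a b \<and> tg a = Dia")
    case True
    then obtain q s A B a b where [simp]: "t = Pair q s A B a b" "tg a = Dia" by blast
    from Fst(1) obtain A' B' a' b' where [simp]: "t' = Pair q s A' B' a' b'" and "par a a'" by (auto elim: par_PairE)
    from Fst(2) have "par a' (dev a)" by (auto elim: par_PairE)
    then show ?thesis using tg_par[OF \<open>par a a'\<close>] by (auto intro: par.Fst_Pair)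
  next
    case False
    then have "dev (Fst t) = Fst (dev t)" by (cases t) auto
    then show ?thesis using Fst by (simp add: par.Fst)
  qed
next
  case (Snd t t' q)
  show ?case
  proof (cases "\<exists>p s A B a b. t = Pair p s A B a b \<and> tg b = q")
    case True
    then obtain p s A B a b where [simp]: "t = Pair p s A B a b" "tg b = q" by blast
    from Snd(1) obtain A' B' a' b' where [simp]: "t' = Pair p s A' B' a' b'" and "par b b'" by (auto elim: par_PairE)
    from Snd(2) have "par b' (dev b)" by (auto elim: par_PairE)
    then show ?thesis using tg_par[OF \<open>par b b'\<close>] by (auto intro: par.Snd_Pair)
  next
    case False
    then have "dev (Snd q t) = Snd q (dev t)" by (cases t) auto
    then show ?thesis using Snd by (simp add: par.Snd)
  qed
next
  case (Beta t t' u u' s A)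
  then show ?case using tg_par[OF Beta(2)] by (auto intro: par_single)
qed (auto intro: par.intros)

lemma par_confluent:
  assumes "par\<^sup>*\<^sup>* t u" "par\<^sup>*\<^sup>* t v"
  shows "\<exists>w. par\<^sup>*\<^sup>* u w \<and> par\<^sup>*\<^sup>* v w"
proof -
  have strip: "\<exists>w. par u w \<and> par\<^sup>*\<^sup>* v w" if "par\<^sup>*\<^sup>* t u" "par t v" for t u v
    using that
  proof (induction arbitrary: v rule: converse_rtranclp_induct)
    case (step x y)
    then obtain w where "par u w" "par\<^sup>*\<^sup>* (dev x) w" using par_dev by blast
    then show ?case using par_dev[OF step.prems] by (meson converse_rtranclp_into_rtranclp)
  qed auto
  show ?thesis using assms(2,1)
  proof (induction arbitrary: u rule: converse_rtranclp_induct)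
    case (step x y)
    then obtain w where w: "par u w" "par\<^sup>*\<^sup>* y w"
      by (meson strip)
    then show ?case using step.IH[OF w(2)] by (meson converse_rtranclp_into_rtranclp)
  qed auto
qed

lemma beta_imp_par: "beta t t' \<Longrightarrow> par t t'"
proof (induction rule: ctxt_closure.induct)
  case (base t t')
  then show ?case
  proof cases
    case (1 u s A t)
    then show ?thesis by (simp add: tag_of_eq par.Beta)
  qed (simp_all add: tag_of_eq par.Fst_Pair par.Snd_Pair)
qed (simp_all add: par.intros)

lemma par_imp_beta: "par t t' \<Longrightarrow> beta\<^sup>*\<^sup>* t t'"
proof (induction rule: par.induct)
  case (Beta t t' u u' s A)
  then have "beta\<^sup>*\<^sup>* (App (Lam s A t) u) (App (Lam s A t') u')"
    by (intro closure_rtranclp_intros) auto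
  moreover have "beta (App (Lam s A t') u') (inst t' s u')"
    using Beta by (intro ctxt_closure.base beta_step.intros) (auto simp: tag_of_eq tg_par)
  ultimately show ?case by (simp add: rtranclp.rtrancl_into_rtrancl)
next
  case (Fst_Pair a a' q s A B b)
  then have "beta\<^sup>*\<^sup>* (Fst (Pair q s A B a b)) a"
    by (intro r_into_rtranclp ctxt_closure.base beta_step.intros) (auto simp: tag_of_eq)
  with Fst_Pair show ?case by simp
next
  case (Snd_Pair b b' q p s A B a)
  then have "beta\<^sup>*\<^sup>* (Snd q (Pair p s A B a b)) b"
    by (intro r_into_rtranclp ctxt_closure.base beta_step.intros) (auto simp: tag_of_eq)
  with Snd_Pair show ?case by simp
qed (auto intro: closure_rtranclp_intros)

lemma par_rtranclp: "par\<^sup>*\<^sup>* = beta\<^sup>*\<^sup>*"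
proof (intro ext iffI)
  fix x y
  show "beta\<^sup>*\<^sup>* x y" if "par\<^sup>*\<^sup>* x y"
    using that by induction (auto dest: par_imp_beta)
  show "par\<^sup>*\<^sup>* x y" if "beta\<^sup>*\<^sup>* x y"
    using that by induction (auto dest!: beta_imp_par)
qed

lemmas beta_confluent = par_confluent[unfolded par_rtranclp]

lemma beta_tg: "beta t t' \<Longrightarrow> tg t' = tg t"
  by (auto dest: beta_imp_par tg_par)

section \<open>Conversion and subtyping\<close>

inductive_cases beta_LamE: "beta (Lam s A t) x"
inductive_cases beta_AppE: "beta (App t u) x"
inductive_cases beta_PiE: "beta (Pi s A B) x"
inductive_cases beta_SigE: "beta (Sig q s A B) x"
inductive_cases beta_PairE: "beta (Pair q s A B a b) x"
inductive_cases beta_FstE: "beta (Fst t) x"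
inductive_cases beta_SndE: "beta (Snd q t) x"
inductive_cases beta_SrtE: "beta (Srt q) x"
inductive_cases beta_VarE: "beta (Var s n) x"
inductive_cases beta_EpsE: "beta Eps x"

inductive_cases beta_step_AppE: "beta_step (App t u) x"
inductive_cases beta_step_FstE: "beta_step (Fst t) x"
inductive_cases beta_step_SndE: "beta_step (Snd q t) x"

lemma beta_step_head [simp]:
  "\<not> beta_step (Lam s A t) x" "\<not> beta_step (Pi s A t) x" "\<not> beta_step (Sig q s A t) x"
  "\<not> beta_step (Pair q s A B a b) x" "\<not> beta_step (Srt p) x" "\<not> beta_step (Var s n) x" "\<not> beta_step Eps x"
  by (auto elim: beta_step.cases)

lemma erase_single:
  "tg u = s \<Longrightarrow> erase f (sb (single s u) t) = sb (single s (erase f u)) (erase f t)"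
  by (rule erase_sb, erule good_single) (auto simp: single_def split: nat.splits)

text \<open>A step inside an erased subterm, or the contraction of a redex that is itself a proof,
  becomes an equality; every other redex survives, because \<open>erase\<close> preserves the tag
  conditions.\<close>

lemma erase_beta: "beta t t' \<Longrightarrow> erase f t = erase f t' \<or> beta (erase f t) (erase f t')"
proof (induction rule: ctxt_closure.induct)
  case (base t t')
  then show ?case
  proof cases
    case (1 u s A t)
    show ?thesis
    proof (cases "tg t = Star")
      case True
      then show ?thesis using 1 by (simp add: tag_of_eq good_single)
    next
      case False
      have "beta (App (Lam s (erase f A) (erase f t)) (erase f u)) (inst (erase f t) s (erase f u))"
        using 1 by (intro ctxt_closure.base beta_step.intros) (simp add: tag_of_eq)
      then show ?thesis using 1 False by (simp add: tag_of_eq erase_single)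
    qed
  next
    case 2
    then show ?thesis by (simp add: ctxt_closure.base beta_step.intros tag_of_eq)
  next
    case 3
    then show ?thesis by (auto simp: ctxt_closure.base beta_step.intros tag_of_eq)
  qed
qed (use ctxt_closure.intros beta_tg in auto)

lemma erase_eq_LamD: "erase f t = Lam s A' b' \<Longrightarrow> \<exists>A b. t = Lam s A b \<and> erase f A = A' \<and> erase f b = b' \<and> tg b = Dia"
  by (cases t) (auto split: if_splits)

lemma erase_eq_PairD: "erase f t = Pair q s A' B' a' b' \<Longrightarrow>
    \<exists>A B a b. t = Pair q s A B a b \<and> erase f A = A' \<and> erase f B = B' \<and> erase f a = a' \<and> erase f b = b'"
  by (cases t) (auto split: if_splits)

text \<open>Apart from mapping sorts, \<open>erase\<close> only replaces whole subterms by
  \<open>Eps\<close>, which is not the head of any redex pattern. So a redex of the erased term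
  stands over a redex of the same shape with the same tags.\<close>

lemma beta_lift: "beta (erase f t) c \<Longrightarrow> \<exists>t'. beta t t' \<and> erase f t' = c"
proof (induction t arbitrary: c)
  case (Lam s A t)
  then have tg: "tg t = Dia" by (auto split: if_splits elim: beta_EpsE)
  with Lam.prems have "beta (Lam s (erase f A) (erase f t)) c" by simp
  then consider A' where "c = Lam s A' (erase f t)" "beta (erase f A) A'"
    | t' where "c = Lam s (erase f A) t'" "beta (erase f t) t'"
    by (auto elim: beta_LamE)
  then show ?case
  proof cases
    case 1
    with Lam.IH(1) obtain A1 where "beta A A1" "erase f A1 = A'" by blast
    with 1 tg show ?thesis by (intro exI[of _ "Lam s A1 t"]) (simp add: ctxt_closure.Lam1)
  next
    case 2
    with Lam.IH(2) obtain t1 where "beta t t1" "erase f t1 = t'" by blast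
    with 2 tg show ?thesis by (intro exI[of _ "Lam s A t1"]) (simp add: ctxt_closure.Lam2 beta_tg)
  qed
next
  case (App t u)
  then have tg: "tg t = Dia" by (auto split: if_splits elim: beta_EpsE)
  with App.prems have "beta (App (erase f t) (erase f u)) c" by simp
  then consider s A' b' where "erase f t = Lam s A' b'" "tg u = s" "c = sb (single s (erase f u)) b'"
    | t' where "c = App t' (erase f u)" "beta (erase f t) t'"
    | u' where "c = App (erase f t) u'" "beta (erase f u) u'"
    by (auto elim!: beta_AppE beta_step_AppE simp: tag_of_eq)
  then show ?case
  proof cases
    case 1
    then obtain A b where t: "t = Lam s A b" "erase f b = b'" using erase_eq_LamD by blast
    have "beta (App t u) (inst b s u)" using t 1
      by (auto intro!: ctxt_closure.base beta_step.intros simp del: inst_eq_sb simp: tag_of_eq)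
    then show ?thesis using 1 t by (auto simp: erase_single)
  next
    case 2
    with App.IH(1) obtain t1 where "beta t t1" "erase f t1 = t'" by blast
    with 2 tg show ?thesis by (intro exI[of _ "App t1 u"]) (simp add: ctxt_closure.App1 beta_tg)
  next
    case 3
    with App.IH(2) obtain u1 where "beta u u1" "erase f u1 = u'" by blast
    with 3 tg show ?thesis by (intro exI[of _ "App t u1"]) (simp add: ctxt_closure.App2)
  qed
next
  case (Fst t)
  then have "beta (Fst (erase f t)) c" by simp
  then consider q s A' B' b' where "erase f t = Pair q s A' B' c b'" "tg c = Dia"
    | t' where "c = Fst t'" "beta (erase f t) t'"
    by (auto elim!: beta_FstE beta_step_FstE simp: tag_of_eq)
  then show ?case
  proof cases
    case 1
    then obtain A B a b where t: "t = Pair q s A B a b" "erase f a = c" "tg a = Dia"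
      using erase_eq_PairD by (metis tg_erase)
    then have "beta (Fst t) a" by (auto intro!: ctxt_closure.base beta_step.intros simp: tag_of_eq)
    then show ?thesis using t by blast
  next
    case 2
    with Fst.IH obtain t1 where "beta t t1" "erase f t1 = t'" by blast
    with 2 show ?thesis by (intro exI[of _ "Fst t1"]) (simp add: ctxt_closure.Fst)
  qed
next
  case (Snd q t)
  then have q: "q = Dia" by (auto split: if_splits elim: beta_EpsE)
  with Snd.prems have "beta (Snd q (erase f t)) c" by simp
  then consider p s A' B' a' where "erase f t = Pair p s A' B' a' c" "tg c = q"
    | t' where "c = Snd q t'" "beta (erase f t) t'"
    by (auto elim!: beta_SndE beta_step_SndE simp: tag_of_eq)
  then show ?case
  proof cases
    case 1
    then obtain A B a b where t: "t = Pair p s A B a b" "erase f b = c" "tg b = q"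
      using erase_eq_PairD by (metis tg_erase)
    then have "beta (Snd q t) b" by (auto intro!: ctxt_closure.base beta_step.intros simp: tag_of_eq)
    then show ?thesis using t by blast
  next
    case 2
    with Snd.IH obtain t1 where "beta t t1" "erase f t1 = t'" by blast
    with 2 q show ?thesis by (intro exI[of _ "Snd q t1"]) (simp add: ctxt_closure.Snd)
  qed
next
  case (Pi s A B)
  then show ?case by (auto elim!: beta_PiE dest!: Pi.IH) (metis ctxt_closure.Pi1 ctxt_closure.Pi2 erase.simps(5))+
next
  case (Sig q s A B)
  then show ?case by (auto elim!: beta_SigE dest!: Sig.IH) (metis ctxt_closure.Sig1 ctxt_closure.Sig2 erase.simps(6))+
next
  case (Pair q s A B a b)
  then show ?case by (auto elim!: beta_PairE dest!: Pair.IH)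
     (metis ctxt_closure.Pair1 ctxt_closure.Pair2 ctxt_closure.Pair3 ctxt_closure.Pair4 erase.simps(7))+
qed (auto elim: beta_SrtE beta_VarE beta_EpsE split: if_splits)

lemma beta_rtranclp_lift: "beta\<^sup>*\<^sup>* (erase f t) c \<Longrightarrow> \<exists>t'. beta\<^sup>*\<^sup>* t t' \<and> erase f t' = c"
proof (induction rule: rtranclp_induct)
  case (step y z)
  then show ?case by (metis beta_lift rtranclp.rtrancl_into_rtrancl)
qed auto

section \<open>Joinability and conversion\<close>

text \<open>Stated as joinability so that it can be inverted on head constructors; confluence makes
  it transitive.\<close>

definition eqb :: "tm \<Rightarrow> tm \<Rightarrow> bool" where
  "eqb t u \<longleftrightarrow> (\<exists>v. beta\<^sup>*\<^sup>* t v \<and> beta\<^sup>*\<^sup>* u v)"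

lemma eqb_refl [simp]: "eqb t t"
  by (auto simp: eqb_def)

lemma eqb_sym: "eqb t u \<Longrightarrow> eqb u t"
  by (auto simp: eqb_def)

lemma eqb_trans [trans]:
  assumes "eqb t u" "eqb u v"
  shows "eqb t v"
proof -
  obtain x y where *: "beta\<^sup>*\<^sup>* t x" "beta\<^sup>*\<^sup>* u x" "beta\<^sup>*\<^sup>* u y" "beta\<^sup>*\<^sup>* v y"
    using assms by (auto simp: eqb_def)
  then obtain w where "beta\<^sup>*\<^sup>* x w" "beta\<^sup>*\<^sup>* y w" using beta_confluent by blast
  with * show ?thesis unfolding eqb_def by (meson rtranclp_trans)
qed

lemma eqb_beta: "beta t u \<Longrightarrow> eqb t u"
  by (auto simp: eqb_def)

lemma eqb_erase_conv: "conv t u \<Longrightarrow> eqb (erase f t) (erase f u)"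
  unfolding conv_def equivclp_def
proof (induction rule: rtranclp_induct)
  case (step y z)
  from step(2) have "eqb (erase f y) (erase f z)"
    unfolding symclp_def using erase_beta[of y z f] erase_beta[of z y f]
    by (metis eqb_refl eqb_sym eqb_beta erase_ext)
  with step.IH show ?case by (rule eqb_trans)
qed simp

lemma conv_refl [simp]: "conv t t"
  by (simp add: conv_def)

lemma conv_sym: "conv t u \<Longrightarrow> conv u t"
  by (simp add: conv_def equivclp_sym)

lemma conv_trans [trans]: "conv t u \<Longrightarrow> conv u v \<Longrightarrow> conv t v"
  unfolding conv_def by (rule equivclp_trans)

lemma conv_beta_rtranclp: "beta\<^sup>*\<^sup>* t u \<Longrightarrow> conv t u"
  unfolding conv_def
  by (induction rule: rtranclp_induct) (auto intro: equivclp_into_equivclp)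

lemma conv_beta: "beta t u \<Longrightarrow> conv t u"
  by (rule conv_beta_rtranclp) simp

lemma conv_erase: "conv t (extr t)"
proof -
  have "ext\<^sup>*\<^sup>* t u \<Longrightarrow> conv t u" for u
    unfolding conv_def by (induction rule: rtranclp_induct) (auto intro: equivclp_into_equivclp)
  then show ?thesis by (simp add: ext_erase)
qed

text \<open>Every term converts to its extraction, and between extractions only \<beta>-steps
  remain, so confluence replaces the zigzag by a common reduct.\<close>

lemma conv_iff_eqb: "conv t u \<longleftrightarrow> eqb (extr t) (extr u)"
proof
  assume "eqb (extr t) (extr u)"
  then obtain v where "conv (extr t) v" "conv (extr u) v"
    by (auto simp: eqb_def dest: conv_beta_rtranclp)
  then show "conv t u" by (rule conv_trans[OF conv_trans[OF conv_erase] conv_sym[OF conv_trans[OF conv_erase]]])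
qed (rule eqb_erase_conv)

lemma conv_if_erase_eq: "extr t = extr u \<Longrightarrow> conv t u"
  by (simp add: conv_iff_eqb)

text \<open>\<open>good \<sigma>\<close> serves both kinds of steps: it keeps the tag conditions of
  \<beta>-redexes, and it lets substitution commute with extraction, so that an extraction step
  becomes an equality of extractions.\<close>

lemma conv_sb:
  assumes "conv t u" "good \<sigma>"
  shows "conv (sb \<sigma> t) (sb \<sigma> u)"
  using assms(1)[unfolded conv_def equivclp_def]
proof (induction rule: rtranclp_induct)
  case (step y z)
  have "conv (sb \<sigma> y) (sb \<sigma> z)" if "y \<rhd>\<^sub>\<beta> z \<or> y \<rhd>\<^sub>\<epsilon> z" for y z
    using that
  proof
    assume "beta y z"
    then have "par (sb \<sigma> y) (sb \<sigma> z)" by (intro par_sb assms(2) par_refl) (rule beta_imp_par)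
    then show ?thesis by (intro conv_beta_rtranclp par_imp_beta)
  next
    assume "ext y z"
    then show ?thesis
      using erase_sb[OF assms(2), where \<sigma>' = "\<lambda>s n. extr (\<sigma> s n)" and f = "\<lambda>q. q"]
      by (intro conv_if_erase_eq) (simp add: erase_ext)
  qed
  with step show ?case unfolding symclp_def by (meson conv_sym conv_trans)
qed simp

lemma subtype_refl [simp]: "subtype t t"
  by (simp add: subtype.conv)

lemma subtype_sb: "subtype t u \<Longrightarrow> good \<sigma> \<Longrightarrow> subtype (sb \<sigma> t) (sb \<sigma> u)"
  by (induction arbitrary: \<sigma> rule: subtype.induct)
    (auto intro: subtype.intros conv_sb subtype.trans)

lemma subtype_ren: "subtype t u \<Longrightarrow> subtype (ren \<rho> t) (ren \<rho> u)"
  unfolding ren_eq_sb by (rule subtype_sb) auto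

lemma conv_single:
  assumes "beta u u'" "tg u = s"
  shows "conv (sb (single s u) t) (sb (single s u') t)"
  using par_single[OF par_refl beta_imp_par[OF assms(1)] assms(2)]
  by (intro conv_beta_rtranclp par_imp_beta)

section \<open>Cumulativity separated from conversion\<close>

text \<open>What subtyping adds to conversion: a difference of universe levels at the end of a chain
  of codomains. Admitting all \<open>i \<le> j\<close> makes the relation transitive.\<close>

inductive le :: "tm \<Rightarrow> tm \<Rightarrow> bool" where
  Refl: "le t t"
| Type: "i \<le> j \<Longrightarrow> le (Srt (Type i)) (Srt (Type j))"
| Pi: "le B B' \<Longrightarrow> le (Pi s A B) (Pi s A B')"

inductive_cases le_SrtE: "le (Srt q) x"
inductive_cases le_PiE: "le (Pi s A B) x"
inductive_cases le_SigE: "le (Sig q s A B) x"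

lemma le_trans: "le t u \<Longrightarrow> le u v \<Longrightarrow> le t v"
  by (induction arbitrary: v rule: le.induct) (auto elim!: le_SrtE le_PiE intro: le.intros)

text \<open>No level occurs in a redex pattern, so reduction does not see the difference between
  related terms. The transitive case of \<open>subtype_join\<close> uses both directions.\<close>

lemma le_beta:
  assumes "le t u"
  shows "beta t t' \<Longrightarrow> \<exists>u'. beta u u' \<and> le t' u'" and "beta u u' \<Longrightarrow> \<exists>t'. beta t t' \<and> le t' u'"
  using assms
proof (induction arbitrary: t' u' rule: le.induct)
  case (Pi B B' s A)
  { case 1
    then show ?case using Pi.hyps
      by (auto elim!: beta_PiE dest!: Pi.IH(1)) (meson ctxt_closure.intros le.intros)+
  next
    case 2
    then show ?case using Pi.hyps
      by (auto elim!: beta_PiE dest!: Pi.IH(2)) (meson ctxt_closure.intros le.intros)+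
  }
qed (auto intro: le.intros elim!: beta_SrtE)

lemma le_beta_rtranclp:
  shows "beta\<^sup>*\<^sup>* t t' \<Longrightarrow> le t u \<Longrightarrow> \<exists>u'. beta\<^sup>*\<^sup>* u u' \<and> le t' u'"
    and "beta\<^sup>*\<^sup>* u u' \<Longrightarrow> le t u \<Longrightarrow> \<exists>t'. beta\<^sup>*\<^sup>* t t' \<and> le t' u'"
proof -
  show "\<exists>u'. beta\<^sup>*\<^sup>* u u' \<and> le t' u'" if "beta\<^sup>*\<^sup>* t t'" "le t u"
    using that by (induction rule: rtranclp_induct) (meson le_beta(1) rtranclp.rtrancl_into_rtrancl rtranclp.rtrancl_refl)+
  show "\<exists>t'. beta\<^sup>*\<^sup>* t t' \<and> le t' u'" if "beta\<^sup>*\<^sup>* u u'" "le t u"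
    using that by (induction rule: rtranclp_induct) (meson le_beta(2) rtranclp.rtrancl_into_rtrancl rtranclp.rtrancl_refl)+
qed

text \<open>Subtyping interleaves conversion and cumulativity freely; here all conversion is moved
  to the outside, leaving a single use of \<open>le\<close> in the middle.\<close>

lemma subtype_join: "subtype t u \<Longrightarrow> \<exists>v w. beta\<^sup>*\<^sup>* (extr t) v \<and> beta\<^sup>*\<^sup>* (extr u) w \<and> le v w"
proof (induction rule: subtype.induct)
  case (Type i)
  then show ?case by (intro exI[of _ "Srt (Type i)"] exI[of _ "Srt (Type (Suc i))"]) (auto intro: le.intros)
next
  case (conv T T')
  then show ?case unfolding eqb_def conv_iff_eqb by (meson le.Refl)
next
  case (Pi B B' s A)
  then show ?case by (metis closure_rtranclp_Pi erase.simps(5) le.Pi rtranclp.rtrancl_refl)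
next
  case (trans T T' T'')
  then obtain a b c d where *: "beta\<^sup>*\<^sup>* (extr T) a" "beta\<^sup>*\<^sup>* (extr T') b" "le a b"
    "beta\<^sup>*\<^sup>* (extr T') c" "beta\<^sup>*\<^sup>* (extr T'') d" "le c d" by blast
  \<comment> \<open>The two reducts of the middle term meet, and the reductions to the meeting point
    are transported along \<open>le\<close> to the outer terms.\<close>
  then obtain e where e: "beta\<^sup>*\<^sup>* b e" "beta\<^sup>*\<^sup>* c e" using beta_confluent by blast
  then obtain a' d' where "beta\<^sup>*\<^sup>* a a'" "le a' e" "beta\<^sup>*\<^sup>* d d'" "le e d'"
    using le_beta_rtranclp * by metis
  then show ?case using * by (meson le_trans rtranclp_trans)
qed

text \<open>Reducts of the terms themselves and not of their extractions, so that subject reduction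
  applies to them.\<close>

lemma subtype_lift:
  assumes "subtype t u"
  obtains v w where "beta\<^sup>*\<^sup>* t v" "beta\<^sup>*\<^sup>* u w" "le (extr v) (extr w)"
  using subtype_join[OF assms] by (metis beta_rtranclp_lift)

lemma le_imp_subtype: "le t u \<Longrightarrow> subtype t u"
proof (induction rule: le.induct)
  case (Type i j)
  then show ?case by (induction rule: dec_induct) (auto intro: subtype.intros)
qed (auto intro: subtype.intros)

lemma beta_rtranclp_PiD: "beta\<^sup>*\<^sup>* (Pi s A B) x \<Longrightarrow> \<exists>A' B'. x = Pi s A' B' \<and> beta\<^sup>*\<^sup>* A A' \<and> beta\<^sup>*\<^sup>* B B'"
proof (induction rule: rtranclp_induct)
  case (step y z)
  then show ?case by (auto elim!: beta_PiE intro: rtranclp.rtrancl_into_rtrancl)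
qed simp

lemma beta_rtranclp_SigD: "beta\<^sup>*\<^sup>* (Sig q s A B) x \<Longrightarrow> \<exists>A' B'. x = Sig q s A' B' \<and> beta\<^sup>*\<^sup>* A A' \<and> beta\<^sup>*\<^sup>* B B'"
proof (induction rule: rtranclp_induct)
  case (step y z)
  then show ?case by (auto elim!: beta_SigE intro: rtranclp.rtrancl_into_rtrancl)
qed simp

lemma beta_rtranclp_SrtD: "beta\<^sup>*\<^sup>* (Srt q) x \<Longrightarrow> x = Srt q"
  by (induction rule: rtranclp_induct) (auto elim: beta_SrtE)

lemma subtype_if_erase_beta:
  assumes "beta\<^sup>*\<^sup>* (extr t) v" "beta\<^sup>*\<^sup>* (extr u) w" "le v w"
  shows "subtype t u"
proof -
  have "conv t v" "conv u w"
    using assms(1,2) by (auto intro: conv_trans[OF conv_erase conv_beta_rtranclp])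
  then show ?thesis
    by (rule subtype.trans[OF subtype.conv subtype.trans[OF le_imp_subtype[OF assms(3)] subtype.conv[OF conv_sym]]])
qed

lemma conv_if_erase_beta:
  "beta\<^sup>*\<^sup>* (extr t) v \<Longrightarrow> beta\<^sup>*\<^sup>* (extr u) v \<Longrightarrow> conv t u"
  by (auto simp: conv_iff_eqb eqb_def)

text \<open>Reduction and \<open>le\<close> keep the head constructor, so the joined reducts are
  products. \<open>le\<close> changes codomains only, hence the domains share a reduct and are
  convertible.\<close>

lemma subtype_PiD:
  assumes "subtype (Pi s A B) (Pi s' A' B')"
  shows "s = s'" "conv A A'" "subtype B B'"
proof -
  obtain v w where "beta\<^sup>*\<^sup>* (Pi s (extr A) (extr B)) v" "beta\<^sup>*\<^sup>* (Pi s' (extr A') (extr B')) w" "le v w"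
    using subtype_join[OF assms] by auto
  then obtain P Q Q' where "s = s'" "beta\<^sup>*\<^sup>* (extr A) P" "beta\<^sup>*\<^sup>* (extr B) Q"
    "beta\<^sup>*\<^sup>* (extr A') P" "beta\<^sup>*\<^sup>* (extr B') Q'" "le Q Q'"
    by (auto dest!: beta_rtranclp_PiD elim!: le_PiE intro: le.Refl)
  then show "s = s'" "conv A A'" "subtype B B'"
    by (auto intro: subtype_if_erase_beta conv_if_erase_beta)
qed

lemma subtype_SigD:
  assumes "subtype (Sig q s A B) (Sig q' s' A' B')"
  shows "q = q'" "s = s'" "conv A A'" "conv B B'"
proof -
  obtain v w where "beta\<^sup>*\<^sup>* (Sig q s (extr A) (extr B)) v" "beta\<^sup>*\<^sup>* (Sig q' s' (extr A') (extr B')) w" "le v w"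
    using subtype_join[OF assms] by auto
  then obtain P Q where "s = s'" "q = q'" "beta\<^sup>*\<^sup>* (extr A) P" "beta\<^sup>*\<^sup>* (extr B) Q"
    "beta\<^sup>*\<^sup>* (extr A') P" "beta\<^sup>*\<^sup>* (extr B') Q"
    by (auto dest!: beta_rtranclp_SigD elim!: le_SigE)
  then show "q = q'" "s = s'" "conv A A'" "conv B B'"
    by (auto intro: conv_if_erase_beta)
qed

text \<open>Forgetting the universe levels turns subtyping into conversion.\<close>

primrec lvl :: "sort \<Rightarrow> sort" where
  "lvl Prop = Prop"
| "lvl (Type i) = Type 0"

abbreviation norm :: "tm \<Rightarrow> tm" where
  "norm \<equiv> erase lvl"

lemma eqb_Pi: "eqb A A' \<Longrightarrow> eqb B B' \<Longrightarrow> eqb (Pi s A B) (Pi s A' B')"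
  unfolding eqb_def by (meson closure_rtranclp_Pi)

lemma subtype_norm: "subtype t u \<Longrightarrow> eqb (norm t) (norm u)"
  by (induction rule: subtype.induct) (auto intro: eqb_Pi eqb_trans eqb_erase_conv)

lemma eqb_PiD: "eqb (Pi s A B) (Pi s' A' B') \<Longrightarrow> s = s' \<and> eqb A A' \<and> eqb B B'"
  by (auto simp: eqb_def dest!: beta_rtranclp_PiD)

lemma eqb_SigD: "eqb (Sig q s A B) (Sig q' s' A' B') \<Longrightarrow> q = q' \<and> s = s' \<and> eqb A A' \<and> eqb B B'"
  by (auto simp: eqb_def dest!: beta_rtranclp_SigD)

lemma eqb_SrtD: "eqb (Srt q) (Srt q') \<Longrightarrow> q = q'"
  by (auto simp: eqb_def dest!: beta_rtranclp_SrtD)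

lemma eqb_par:
  assumes "par t t'"
  shows "eqb t t'"
  using par_imp_beta[OF assms] by (auto simp: eqb_def)

lemma eqb_single:
  assumes "eqb t t'" "tg u = s"
  shows "eqb (sb (single s u) t) (sb (single s u) t')"
proof -
  have *: "eqb (sb (single s u) v) (sb (single s u) w)" if "par\<^sup>*\<^sup>* v w" for v w
    using that
  proof (induction rule: rtranclp_induct)
    case (step y z)
    then show ?case using eqb_par[OF par_single[OF step(2) par_refl assms(2)]] eqb_trans by blast
  qed simp
  obtain v where "par\<^sup>*\<^sup>* t v" "par\<^sup>*\<^sup>* t' v" using assms(1) unfolding eqb_def par_rtranclp by blast
  then show ?thesis using * eqb_sym eqb_trans by blast
qed

text \<open>The tag carried by the inhabitants of a type of sort \<open>q\<close>: proofs have tag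
  \<open>Star\<close>, all other terms have tag \<open>Dia\<close>.\<close>

definition st :: "sort \<Rightarrow> tag" where
  "st q = (if q = Prop then Star else Dia)"

lemma st_simps [simp]: "st Prop = Star" "st (Type i) = Dia" "st (max_Type q i) = Dia"
  by (simp_all add: st_def) (cases q; simp)

lemma st_lvl [simp]: "st (lvl q) = st q"
  by (cases q) simp_all

lemma lvl_cong: "st q = st q' \<Longrightarrow> lvl q = lvl q'"
  by (cases q; cases q') simp_all

lemma subtype_SrtD: "subtype (Srt q) (Srt q') \<Longrightarrow> st q = st q'"
  using eqb_SrtD[of "lvl q" "lvl q'"] subtype_norm[of "Srt q" "Srt q'"] st_lvl(1)[of q] st_lvl(1)[of q']
  by (simp del: st_lvl)

section \<open>Typing with tag annotations\<close>

text \<open>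
  Compared to \<^const>\<open>typing\<close>, the rules \<open>Conv\<close> and \<open>Pair\<close> fix the tag of the subject, so that it agrees
  with the sort of the type without any appeal to uniqueness of sorts; and the well-formedness of
  contexts is split off, so that renamings and substitutions need no side condition.
\<close>

inductive has_ty :: "ctx \<Rightarrow> tm \<Rightarrow> tm \<Rightarrow> bool" where
  Prop: "has_ty \<Gamma> (Srt Prop) (Srt (Type i))"
| Type: "1 \<le> p \<Longrightarrow> has_ty \<Gamma> (Srt (Type i)) (Srt (Type (i + p)))"
| Var: "lookup \<Gamma> s n A \<Longrightarrow> has_ty \<Gamma> (Var s n) A"
| Conv: "has_ty \<Gamma> t A \<Longrightarrow> has_ty \<Gamma> B (Srt q) \<Longrightarrow> A \<preceq> B \<Longrightarrow> tg t = st q \<Longrightarrow> has_ty \<Gamma> t B"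
| Pi_Type: "has_ty \<Gamma> A (Srt q) \<Longrightarrow> st q = s \<Longrightarrow> has_ty ((s, A) # \<Gamma>) B (Srt (Type i)) \<Longrightarrow>
    has_ty \<Gamma> (Pi s A B) (Srt (max_Type q i))"
| Pi_Prop: "has_ty \<Gamma> A (Srt q) \<Longrightarrow> st q = s \<Longrightarrow> has_ty ((s, A) # \<Gamma>) B (Srt Prop) \<Longrightarrow>
    has_ty \<Gamma> (Pi s A B) (Srt Prop)"
| Lam: "has_ty \<Gamma> A (Srt q) \<Longrightarrow> st q = s \<Longrightarrow> has_ty ((s, A) # \<Gamma>) t B \<Longrightarrow> has_ty \<Gamma> (Lam s A t) (Pi s A B)"
| App: "has_ty \<Gamma> t (Pi s A B) \<Longrightarrow> has_ty \<Gamma> u A \<Longrightarrow> tg u = s \<Longrightarrow> has_ty \<Gamma> (App t u) (sb (single s u) B)"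
| Sig: "has_ty \<Gamma> A (Srt (Type i)) \<Longrightarrow> has_ty ((Dia, A) # \<Gamma>) B (Srt q) \<Longrightarrow> st q = s \<Longrightarrow>
    q = Prop \<or> q = Type i \<Longrightarrow> has_ty \<Gamma> (Sig s Dia A B) (Srt (Type i))"
| Pair: "has_ty \<Gamma> a A \<Longrightarrow> has_ty \<Gamma> b (sb (single r a) B) \<Longrightarrow> has_ty \<Gamma> (Sig s r A B) (Srt (Type i)) \<Longrightarrow>
    tg a = r \<Longrightarrow> has_ty \<Gamma> (Pair s r A B a b) (Sig s r A B)"
| Fst: "has_ty \<Gamma> t (Sig s r A B) \<Longrightarrow> has_ty \<Gamma> (Fst t) A"
| Snd: "has_ty \<Gamma> t (Sig s r A B) \<Longrightarrow> has_ty \<Gamma> A (Srt (Type i)) \<Longrightarrow> has_ty ((r, A) # \<Gamma>) B (Srt q) \<Longrightarrow>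
    st q = s \<Longrightarrow> r = Dia \<Longrightarrow> has_ty \<Gamma> (Snd s t) (sb (single r (Fst t)) B)"

primrec wfc :: "ctx \<Rightarrow> bool" where
  "wfc [] \<longleftrightarrow> True"
| "wfc (d # \<Gamma>) \<longleftrightarrow> wfc \<Gamma> \<and> (\<exists>q. has_ty \<Gamma> (snd d) (Srt q) \<and> st q = fst d)"

subsection \<open>Renaming and substitution\<close>

lemma under_eq_shf: "under r s n = shf r s n"
  by (auto simp: under_def shf_def)

lemma lookup_here: "lookup ((s, A) # \<Gamma>) s 0 (ren (shf s) A)"
  using lookup.here[of s A \<Gamma>] by simp

lemma lookup_there: "lookup \<Gamma> s n A \<Longrightarrow> lookup ((r, B) # \<Gamma>) s (shf r s n) (ren (shf r) A)"
  using lookup.there[of \<Gamma> s n A r B] by (simp add: under_eq_shf)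

lemma lookup_ConsE:
  assumes "lookup ((r, B) # \<Gamma>) s n A"
  obtains "s = r" "n = 0" "A = ren (shf r) B"
  | m C where "n = shf r s m" "A = ren (shf r) C" "lookup \<Gamma> s m C"
  using assms by (cases rule: lookup.cases) (auto simp: under_eq_shf)

definition ren_ok :: "ren \<Rightarrow> ctx \<Rightarrow> ctx \<Rightarrow> bool" where
  "ren_ok \<rho> \<Gamma> \<Delta> \<longleftrightarrow> (\<forall>s n A. lookup \<Gamma> s n A \<longrightarrow> lookup \<Delta> s (\<rho> s n) (ren \<rho> A))"

lemma upr_simps [simp]: "upr r \<rho> s (shf r s m) = shf r s (\<rho> s m)" "upr r \<rho> r 0 = 0"
  by (auto simp: upr_def shf_def)

lemma ups_simps [simp]: "ups r \<sigma> s (shf r s m) = ren (shf r) (\<sigma> s m)" "ups r \<sigma> r 0 = Var r 0"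
  by (auto simp: ups_def shf_def)

lemma single_simps [simp]: "single r u s (shf r s m) = Var s m" "single r u r 0 = u"
  by (auto simp: single_def shf_def)

lemma ren_ok_upr: "ren_ok \<rho> \<Gamma> \<Delta> \<Longrightarrow> ren_ok (upr r \<rho>) ((r, A) # \<Gamma>) ((r, ren \<rho> A) # \<Delta>)"
  unfolding ren_ok_def
proof (intro allI impI)
  fix s n B
  assume *: "\<forall>s n A. lookup \<Gamma> s n A \<longrightarrow> lookup \<Delta> s (\<rho> s n) (ren \<rho> A)"
  assume "lookup ((r, A) # \<Gamma>) s n B"
  then show "lookup ((r, ren \<rho> A) # \<Delta>) s (upr r \<rho> s n) (ren (upr r \<rho>) B)"
  proof (cases rule: lookup_ConsE)
    case 1
    then show ?thesis using lookup_here[of r "ren \<rho> A" \<Delta>] by (simp add: ren_shf)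
  next
    case (2 m C)
    then show ?thesis using lookup_there[of \<Delta> s "\<rho> s m" "ren \<rho> C"] * by (simp add: ren_shf)
  qed
qed

lemma ren_ok_shf: "ren_ok (shf r) \<Gamma> ((r, A) # \<Gamma>)"
  by (simp add: ren_ok_def lookup_there)

lemma has_ty_ren: "has_ty \<Gamma> t T \<Longrightarrow> ren_ok \<rho> \<Gamma> \<Delta> \<Longrightarrow> has_ty \<Delta> (ren \<rho> t) (ren \<rho> T)"
proof (induction arbitrary: \<rho> \<Delta> rule: has_ty.induct)
  case (Var \<Gamma> s n A)
  then show ?case by (auto simp: ren_ok_def intro: has_ty.Var)
next
  case (Conv \<Gamma> t A B q)
  then show ?case by (auto intro!: has_ty.Conv[of \<Delta> "ren \<rho> t" "ren \<rho> A" "ren \<rho> B" q] subtype_ren)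
next
  case (App \<Gamma> t s A B u)
  then show ?case using has_ty.App[of \<Delta> "ren \<rho> t" s "ren \<rho> A" "ren (upr s \<rho>) B" "ren \<rho> u"] by (simp add: ren_single)
next
  case (Pair \<Gamma> a A b r B s i)
  then show ?case
    using has_ty.Pair[of \<Delta> "ren \<rho> a" "ren \<rho> A" "ren \<rho> b" r "ren (upr r \<rho>) B" s i] by (simp add: ren_single)
next
  case (Snd \<Gamma> t s r A B i q)
  then show ?case
    using has_ty.Snd[of \<Delta> "ren \<rho> t" s r "ren \<rho> A" "ren (upr r \<rho>) B" i q] by (simp add: ren_single ren_ok_upr)
next
  case (Fst \<Gamma> t s r A B)
  then show ?case using has_ty.Fst by (simp) blast
next
  case (Pi_Type \<Gamma> A q s B i)
  then show ?case using has_ty.Pi_Type[OF Pi_Type.IH(1)[simplified] Pi_Type.hyps(2) Pi_Type.IH(2)[simplified]] by (simp add: ren_ok_upr)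
next
  case (Pi_Prop \<Gamma> A q s B)
  then show ?case using has_ty.Pi_Prop[OF Pi_Prop.IH(1)[simplified] Pi_Prop.hyps(2) Pi_Prop.IH(2)[simplified]] by (simp add: ren_ok_upr)
next
  case (Lam \<Gamma> A q s t B)
  then show ?case using has_ty.Lam[OF Lam.IH(1)[simplified] Lam.hyps(2) Lam.IH(2)] by (simp add: ren_ok_upr)
next
  case (Sig \<Gamma> A i B q s)
  then show ?case using has_ty.Sig[OF Sig.IH(1)[simplified] Sig.IH(2)[simplified] Sig.hyps(3,4)] by (simp add: ren_ok_upr)
qed (auto intro: has_ty.Prop has_ty.Type)

lemmas has_ty_weaken = has_ty_ren[OF _ ren_ok_shf]

text \<open>Tags are required separately: the typing condition concerns only variables declared in
  \<open>\<Gamma>\<close>, and without well-formedness it does not tie the tag of a variable to that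
  of its substitute.\<close>

definition sb_ok :: "sbs \<Rightarrow> ctx \<Rightarrow> ctx \<Rightarrow> bool" where
  "sb_ok \<sigma> \<Gamma> \<Delta> \<longleftrightarrow> good \<sigma> \<and> (\<forall>s n A. lookup \<Gamma> s n A \<longrightarrow> has_ty \<Delta> (\<sigma> s n) (sb \<sigma> A))"

lemma sb_ok_good: "sb_ok \<sigma> \<Gamma> \<Delta> \<Longrightarrow> good \<sigma>"
  by (simp add: sb_ok_def)

lemma sb_ok_ups: 
  assumes "sb_ok \<sigma> \<Gamma> \<Delta>"
  shows "sb_ok (ups r \<sigma>) ((r, A) # \<Gamma>) ((r, sb \<sigma> A) # \<Delta>)"
  unfolding sb_ok_def
proof (intro allI impI conjI)
  show "good (ups r \<sigma>)" using assms by (auto simp: sb_ok_def)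
  fix s n B
  assume "lookup ((r, A) # \<Gamma>) s n B"
  then show "has_ty ((r, sb \<sigma> A) # \<Delta>) (ups r \<sigma> s n) (sb (ups r \<sigma>) B)"
  proof (cases rule: lookup_ConsE)
    case 1
    then show ?thesis using lookup_here[of r "sb \<sigma> A" \<Delta>] by (auto simp: sb_shf intro: has_ty.Var)
  next
    case (2 m C)
    then show ?thesis using assms has_ty_weaken[of \<Delta> "\<sigma> s m" "sb \<sigma> C"]
      by (simp add: sb_shf sb_ok_def)
  qed
qed

lemma has_ty_sb: "has_ty \<Gamma> t T \<Longrightarrow> sb_ok \<sigma> \<Gamma> \<Delta> \<Longrightarrow> has_ty \<Delta> (sb \<sigma> t) (sb \<sigma> T)"
proof (induction arbitrary: \<sigma> \<Delta> rule: has_ty.induct)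
  case (Var \<Gamma> s n A)
  then show ?case by (auto simp: sb_ok_def)
next
  case (Conv \<Gamma> t A B q)
  then show ?case
    by (auto intro!: has_ty.Conv[of \<Delta> "sb \<sigma> t" "sb \<sigma> A" "sb \<sigma> B" q] subtype_sb dest: sb_ok_good)
next
  case (App \<Gamma> t s A B u)
  then show ?case using has_ty.App[of \<Delta> "sb \<sigma> t" s "sb \<sigma> A" "sb (ups s \<sigma>) B" "sb \<sigma> u"]
    by (simp add: sb_single sb_ok_good)
next
  case (Pair \<Gamma> a A b r B s i)
  then show ?case
    using has_ty.Pair[of \<Delta> "sb \<sigma> a" "sb \<sigma> A" "sb \<sigma> b" r "sb (ups r \<sigma>) B" s i]
    by (simp add: sb_single sb_ok_good)
next
  case (Snd \<Gamma> t s r A B i q)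
  then show ?case
    using has_ty.Snd[of \<Delta> "sb \<sigma> t" s r "sb \<sigma> A" "sb (ups r \<sigma>) B" i q] by (simp add: sb_single sb_ok_ups)
next
  case (Fst \<Gamma> t s r A B)
  then show ?case using has_ty.Fst by (simp) blast
next
  case (Pi_Type \<Gamma> A q s B i)
  then show ?case using has_ty.Pi_Type[OF Pi_Type.IH(1)[simplified] Pi_Type.hyps(2) Pi_Type.IH(2)[simplified]] by (simp add: sb_ok_ups)
next
  case (Pi_Prop \<Gamma> A q s B)
  then show ?case using has_ty.Pi_Prop[OF Pi_Prop.IH(1)[simplified] Pi_Prop.hyps(2) Pi_Prop.IH(2)[simplified]] by (simp add: sb_ok_ups)
next
  case (Lam \<Gamma> A q s t B)
  then show ?case using has_ty.Lam[OF Lam.IH(1)[simplified] Lam.hyps(2) Lam.IH(2)] by (simp add: sb_ok_ups)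
next
  case (Sig \<Gamma> A i B q s)
  then show ?case using has_ty.Sig[OF Sig.IH(1)[simplified] Sig.IH(2)[simplified] Sig.hyps(3,4)] by (simp add: sb_ok_ups)
qed (auto intro: has_ty.Prop has_ty.Type)

lemma sb_ok_single:
  assumes "has_ty \<Gamma> u A" "tg u = s"
  shows "sb_ok (single s u) ((s, A) # \<Gamma>) \<Gamma>"
  unfolding sb_ok_def
proof (intro allI impI conjI)
  show "good (single s u)" using assms(2) by (rule good_single)
  fix r n B
  assume "lookup ((s, A) # \<Gamma>) r n B"
  then show "has_ty \<Gamma> (single s u r n) (sb (single s u) B)"
  proof (cases rule: lookup_ConsE)
    case 1
    then show ?thesis using assms by simp
  next
    case (2 m C)
    then show ?thesis using has_ty.Var[of \<Gamma> r m C] by simp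
  qed
qed

lemma has_ty_single:
  "has_ty ((s, A) # \<Gamma>) t T \<Longrightarrow> has_ty \<Gamma> u A \<Longrightarrow> tg u = s \<Longrightarrow> has_ty \<Gamma> (sb (single s u) t) (sb (single s u) T)"
  by (rule has_ty_sb[OF _ sb_ok_single])

subsection \<open>Generation\<close>

text \<open>\<open>Conv\<close> is the only rule not directed by the subject, and transitivity of
  subtyping absorbs its repeated uses. The shape of the subject is an equation so that the induction
  runs over a variable subject. The other inversions follow the same scheme.\<close>

lemma gen_Srt: "has_ty \<Gamma> t T \<Longrightarrow> t = Srt q \<Longrightarrow> \<exists>i. Srt (Type i) \<preceq> T"
  by (induction rule: has_ty.induct) (auto intro: subtype.trans subtype_refl)

lemma gen_Var: "has_ty \<Gamma> t T \<Longrightarrow> t = Var s n \<Longrightarrow> \<exists>A. lookup \<Gamma> s n A \<and> A \<preceq> T"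
  by (induction rule: has_ty.induct) (auto intro: subtype.trans subtype_refl)

lemma gen_Lam: "has_ty \<Gamma> t T \<Longrightarrow> t = Lam s A b \<Longrightarrow>
    \<exists>q B. has_ty \<Gamma> A (Srt q) \<and> st q = s \<and> has_ty ((s, A) # \<Gamma>) b B \<and> Pi s A B \<preceq> T"
  by (induction rule: has_ty.induct) (auto intro: subtype.trans subtype_refl)

lemma gen_App: "has_ty \<Gamma> t T \<Longrightarrow> t = App f u \<Longrightarrow>
    \<exists>s A B. has_ty \<Gamma> f (Pi s A B) \<and> has_ty \<Gamma> u A \<and> tg u = s \<and> sb (single s u) B \<preceq> T"
  by (induction rule: has_ty.induct) (auto intro: subtype.trans subtype_refl)

primrec pi_sort :: "sort \<Rightarrow> sort \<Rightarrow> sort" where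
  "pi_sort q Prop = Prop"
| "pi_sort q (Type i) = max_Type q i"

lemma st_pi_sort [simp]: "st (pi_sort q q') = st q'"
  by (cases q') auto

lemma has_ty_Pi: "has_ty \<Gamma> A (Srt q) \<Longrightarrow> st q = s \<Longrightarrow> has_ty ((s, A) # \<Gamma>) B (Srt q') \<Longrightarrow>
    has_ty \<Gamma> (Pi s A B) (Srt (pi_sort q q'))"
  by (cases q') (auto intro: has_ty.intros)

lemma gen_Pi: "has_ty \<Gamma> t T \<Longrightarrow> t = Pi s A B \<Longrightarrow>
    \<exists>q q'. has_ty \<Gamma> A (Srt q) \<and> st q = s \<and> has_ty ((s, A) # \<Gamma>) B (Srt q') \<and> Srt (pi_sort q q') \<preceq> T"
proof (induction rule: has_ty.induct)
  case (Pi_Type \<Gamma> A q s B i)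
  then show ?case by (intro exI[of _ q] exI[of _ "Type i"]) auto
next
  case (Pi_Prop \<Gamma> A q s B)
  then show ?case by (intro exI[of _ q] exI[of _ "Prop"]) auto
qed (auto intro: subtype.trans)

lemma gen_Sig: "has_ty \<Gamma> t T \<Longrightarrow> t = Sig s r A B \<Longrightarrow>
    \<exists>i q. has_ty \<Gamma> A (Srt (Type i)) \<and> has_ty ((Dia, A) # \<Gamma>) B (Srt q) \<and> st q = s \<and> r = Dia \<and>
      (q = Prop \<or> q = Type i) \<and> Srt (Type i) \<preceq> T"
  by (induction rule: has_ty.induct) (auto intro: subtype.trans subtype_refl)

lemma gen_Pair: "has_ty \<Gamma> t T \<Longrightarrow> t = Pair s r A B a b \<Longrightarrow>
    \<exists>i. has_ty \<Gamma> a A \<and> has_ty \<Gamma> b (sb (single r a) B) \<and> has_ty \<Gamma> (Sig s r A B) (Srt (Type i)) \<and>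
      tg a = r \<and> Sig s r A B \<preceq> T"
  by (induction rule: has_ty.induct) (auto intro: subtype.trans subtype_refl)

lemma gen_Fst: "has_ty \<Gamma> t T \<Longrightarrow> t = Fst p \<Longrightarrow> \<exists>s r A B. has_ty \<Gamma> p (Sig s r A B) \<and> A \<preceq> T"
  by (induction rule: has_ty.induct) (auto intro: subtype.trans subtype_refl)

lemma gen_Snd: "has_ty \<Gamma> t T \<Longrightarrow> t = Snd s p \<Longrightarrow>
    \<exists>A B. has_ty \<Gamma> p (Sig s Dia A B) \<and> sb (single Dia (Fst p)) B \<preceq> T"
  by (induction rule: has_ty.induct) (auto intro: subtype.trans subtype_refl)

lemma gen_Eps: "\<not> has_ty \<Gamma> Eps T"
proof -
  have "has_ty \<Gamma> t T \<Longrightarrow> t \<noteq> Eps" for t by (induction rule: has_ty.induct) auto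
  then show ?thesis by blast
qed

lemmas has_ty_LamD = gen_Lam[OF _ refl] and has_ty_AppD = gen_App[OF _ refl]
  and has_ty_PiD = gen_Pi[OF _ refl] and has_ty_SigD = gen_Sig[OF _ refl]
  and has_ty_PairD = gen_Pair[OF _ refl] and has_ty_FstD = gen_Fst[OF _ refl]
  and has_ty_SndD = gen_Snd[OF _ refl] and has_ty_VarD = gen_Var[OF _ refl] and has_ty_SrtD = gen_Srt[OF _ refl]

subsection \<open>Sorts of types\<close>

lemma lookup_has_ty: "lookup \<Gamma> s n A \<Longrightarrow> wfc \<Gamma> \<Longrightarrow> \<exists>q. has_ty \<Gamma> A (Srt q) \<and> st q = s"
proof (induction rule: lookup.induct)
  case (here s A \<Gamma>)
  then show ?case using has_ty_weaken by fastforce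
next
  case (there \<Gamma> s n A r B)
  then show ?case using has_ty_weaken by fastforce
qed

text \<open>The tag premise of \<open>Conv\<close> settles the case that would otherwise call for
  uniqueness of sorts. For an application, the type of the function yields a sort of the codomain,
  and substitution preserves it.\<close>

lemma has_ty_sort: "has_ty \<Gamma> t T \<Longrightarrow> wfc \<Gamma> \<Longrightarrow> \<exists>q. has_ty \<Gamma> T (Srt q) \<and> tg t = st q"
proof (induction rule: has_ty.induct)
  case (Prop \<Gamma> i)
  show ?case using has_ty.Type[of 1 \<Gamma> i] by (intro exI[of _ "Type (i + 1)"]) auto
next
  case (Type p \<Gamma> i)
  show ?case using has_ty.Type[of 1 \<Gamma> "i + p"] by (intro exI[of _ "Type (i + p + 1)"]) auto
next
  case (Var \<Gamma> s n A)
  then show ?case by (auto dest: lookup_has_ty)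
next
  case (Pi_Type \<Gamma> A q s B i)
  obtain j where "max_Type q i = Type j" by (cases q) auto
  then show ?case using has_ty.Type[of 1 \<Gamma> j] by (intro exI[of _ "Type (j + 1)"]) auto
next
  case (Pi_Prop \<Gamma> A q s B)
  show ?case using has_ty.Prop[of \<Gamma> 0] by (intro exI[of _ "Type 0"]) auto
next
  case (Lam \<Gamma> A q s t B)
  then obtain q' where "has_ty ((s, A) # \<Gamma>) B (Srt q')" "tg t = st q'" by auto
  then show ?case using has_ty_Pi[OF Lam(1,2)] by (intro exI[of _ "pi_sort q q'"]) auto
next
  case (App \<Gamma> t s A B u)
  then obtain q where q: "has_ty \<Gamma> (Pi s A B) (Srt q)" "tg t = st q" by auto
  then obtain q1 q' where "has_ty ((s, A) # \<Gamma>) B (Srt q')" "Srt (pi_sort q1 q') \<preceq> Srt q"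
    using has_ty_PiD by blast
  then show ?case using has_ty_single[OF _ App(2,3), of B "Srt q'"] q(2) subtype_SrtD[of "pi_sort q1 q'" q] by auto
next
  case (Sig \<Gamma> A i B q s)
  show ?case using has_ty.Type[of 1 \<Gamma> i] by (intro exI[of _ "Type (i + 1)"]) auto
next
  case (Fst \<Gamma> t s r A B)
  then show ?case by (force dest: has_ty_SigD)
next
  case (Snd \<Gamma> t s r A B i q)
  then show ?case using has_ty_single[OF Snd(3) has_ty.Fst[OF Snd(1)]] by auto
qed (auto intro: exI[of _ "Type i" for i])

lemma has_ty_Srt_Type: 
  assumes "has_ty \<Gamma> (Srt q) (Srt q')"
  shows "st q' = Dia"
  using has_ty_SrtD[OF assms] subtype_SrtD by force

text \<open>Types are not proofs, since the sort of a sort is never \<open>Prop\<close>. So the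
  hypothesis \<open>tg t = Dia\<close> of \<open>unique_type\<close> is available for types.\<close>

lemma tg_type: "has_ty \<Gamma> A (Srt q) \<Longrightarrow> wfc \<Gamma> \<Longrightarrow> tg A = Dia"
  using has_ty_sort[of \<Gamma> A "Srt q"] has_ty_Srt_Type by force

subsection \<open>Uniqueness of types up to levels and proofs\<close>

abbreviation norm_ctx :: "ctx \<Rightarrow> ctx" where
  "norm_ctx \<equiv> map (\<lambda>d. (fst d, norm (snd d)))"

lemma lookup_norm:
  "lookup \<Gamma> s n A \<Longrightarrow> lookup \<Gamma>' s n A' \<Longrightarrow> norm_ctx \<Gamma> = norm_ctx \<Gamma>' \<Longrightarrow> norm A = norm A'"
proof (induction arbitrary: \<Gamma>' A' rule: lookup.induct)
  case (here s A \<Gamma>)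
  then obtain B \<Delta> where "\<Gamma>' = (s, B) # \<Delta>" "norm A = norm B" by (cases \<Gamma>') auto
  with here(1) show ?case by (auto elim!: lookup_ConsE) (simp add: shf_def)
next
  case (there \<Gamma> s n A r B)
  then obtain C \<Delta> where \<Gamma>': "\<Gamma>' = (r, C) # \<Delta>" "norm_ctx \<Gamma> = norm_ctx \<Delta>" by (cases \<Gamma>') auto
  have inj: "shf r s n = shf r s m \<Longrightarrow> n = m" for m by (simp add: shf_def split: if_splits)
  from there.prems(1) \<Gamma>' obtain D where "A' = ren (shf r) D" "lookup \<Delta> s n D"
    by (auto elim!: lookup_ConsE simp: under_eq_shf dest: inj) (simp add: shf_def)
  then show ?case using there.IH \<Gamma>' by simp
qed

lemma erase_eq_SrtD: "erase f t = Srt q \<Longrightarrow> \<exists>q'. t = Srt q' \<and> q = f q'"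
  by (cases t) (auto split: if_splits)

lemma erase_eq_VarD: "erase f t = Var s n \<Longrightarrow> t = Var s n"
  by (cases t) (auto split: if_splits)

lemma erase_eq_AppD: "erase f t = App a b \<Longrightarrow> \<exists>a' b'. t = App a' b' \<and> a = erase f a' \<and> b = erase f b'"
  by (cases t) (auto split: if_splits)

lemma erase_eq_PiD: "erase f t = Pi s A B \<Longrightarrow> \<exists>A' B'. t = Pi s A' B' \<and> A = erase f A' \<and> B = erase f B'"
  by (cases t) (auto split: if_splits)

lemma erase_eq_SigD: "erase f t = Sig q s A B \<Longrightarrow> \<exists>A' B'. t = Sig q s A' B' \<and> A = erase f A' \<and> B = erase f B'"
  by (cases t) (auto split: if_splits)

lemma erase_eq_FstD: "erase f t = Fst p \<Longrightarrow> \<exists>p'. t = Fst p' \<and> p = erase f p'"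
  by (cases t) (auto split: if_splits)

lemma erase_eq_SndD: "erase f t = Snd q p \<Longrightarrow> \<exists>p'. t = Snd q p' \<and> p = erase f p'"
  by (cases t) (auto split: if_splits)

lemma tg_Sig_elem: "has_ty \<Gamma> t (Sig s r A B) \<Longrightarrow> wfc \<Gamma> \<Longrightarrow> tg t = Dia"
  using has_ty_sort[of \<Gamma> t "Sig s r A B"] by (force dest!: has_ty_SigD subtype_SrtD)

lemma eqb_norm_SrtD: "eqb (norm (Srt q)) (norm (Srt q')) \<Longrightarrow> st q = st q'"
  using eqb_SrtD[of "lvl q" "lvl q'"] st_lvl[of q] st_lvl[of q'] by (simp del: st_lvl)

text \<open>Terms and contexts are compared after \<open>norm\<close>, so that different proofs and
  different levels may be involved on the two sides. A term with tag \<open>Star\<close> becomes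
  \<open>Eps\<close>, which remembers nothing of its type, hence \<open>tg t = Dia\<close>.
  Generation inverts the second derivation, and \<open>subtype_norm\<close> absorbs the
  conversions.\<close>

lemma unique_type:
  assumes "has_ty \<Gamma> t T" "has_ty \<Gamma>' t' T'" "norm_ctx \<Gamma> = norm_ctx \<Gamma>'" "norm t = norm t'"
    "tg t = Dia" "wfc \<Gamma>" "wfc \<Gamma>'"
  shows "eqb (norm T) (norm T')"
  using assms
proof (induction arbitrary: \<Gamma>' t' T' rule: has_ty.induct)
  case (Prop \<Gamma> i)
  then obtain q where "t' = Srt q" by (auto dest!: erase_eq_SrtD[OF sym])
  with Prop show ?case by (auto dest!: has_ty_SrtD subtype_norm)
next
  case (Type p \<Gamma> i)
  then obtain q where "t' = Srt q" by (auto dest!: erase_eq_SrtD[OF sym])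
  with Type show ?case by (auto dest!: has_ty_SrtD subtype_norm)
next
  case (Var \<Gamma> s n A)
  then have "t' = Var s n" by (auto dest!: erase_eq_VarD[OF sym])
  with Var obtain A' where "lookup \<Gamma>' s n A'" "A' \<preceq> T'" by (auto dest!: has_ty_VarD)
  then show ?case using lookup_norm[OF Var(1), of \<Gamma>' A'] Var.prems by (auto dest: subtype_norm)
next
  case (Conv \<Gamma> t A B q)
  then show ?case by (meson eqb_trans eqb_sym subtype_norm)
next
  case (Pi_Type \<Gamma> A q s B i)
  then obtain A' B' where t': "t' = Pi s A' B'" "norm A' = norm A" "norm B' = norm B"
    by (auto dest!: erase_eq_PiD[OF sym])
  then obtain p p' where *: "has_ty \<Gamma>' A' (Srt p)" "st p = s" "has_ty ((s, A') # \<Gamma>') B' (Srt p')" "Srt (pi_sort p p') \<preceq> T'"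
    using has_ty_PiD Pi_Type.prems by blast
  have wf: "wfc ((s, A) # \<Gamma>)" "wfc ((s, A') # \<Gamma>')" using Pi_Type * by auto
  \<comment> \<open>The codomain is a type, hence has tag \<open>Dia\<close>, and the induction
    hypothesis fixes its sort up to the level. This decides which of the two product rules was used
    on the other side.\<close>
  have "eqb (norm (Srt (Type i))) (norm (Srt p'))"
    using Pi_Type.IH(2)[OF *(3)] t' wf Pi_Type.prems tg_type[OF Pi_Type.hyps(3) wf(1)] by simp
  then have "st p' = Dia" using eqb_norm_SrtD[of "Type i" p'] by simp
  then show ?case using subtype_norm[OF *(4)] lvl_cong[of "pi_sort p p'" "max_Type q i"] by simp
next
  case (Pi_Prop \<Gamma> A q s B)
  then obtain A' B' where t': "t' = Pi s A' B'" "norm A' = norm A" "norm B' = norm B"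
    by (auto dest!: erase_eq_PiD[OF sym])
  then obtain p p' where *: "has_ty \<Gamma>' A' (Srt p)" "st p = s" "has_ty ((s, A') # \<Gamma>') B' (Srt p')" "Srt (pi_sort p p') \<preceq> T'"
    using has_ty_PiD Pi_Prop.prems by blast
  have wf: "wfc ((s, A) # \<Gamma>)" "wfc ((s, A') # \<Gamma>')" using Pi_Prop * by auto
  have "eqb (norm (Srt Prop)) (norm (Srt p'))"
    using Pi_Prop.IH(2)[OF *(3)] t' wf Pi_Prop.prems tg_type[OF Pi_Prop.hyps(3) wf(1)] by simp
  then have "st p' = Star" using eqb_norm_SrtD[of Prop p'] by simp
  then show ?case using subtype_norm[OF *(4)] lvl_cong[of "pi_sort p p'" "Prop"] by simp
next
  case (Lam \<Gamma> A q s t B)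
  then obtain A' b' where t': "t' = Lam s A' b'" "norm A' = norm A" "norm b' = norm t"
    by (auto dest!: erase_eq_LamD[OF sym])
  then obtain p B' where *: "has_ty \<Gamma>' A' (Srt p)" "st p = s" "has_ty ((s, A') # \<Gamma>') b' B'" "Pi s A' B' \<preceq> T'"
    using has_ty_LamD Lam.prems by blast
  have "wfc ((s, A) # \<Gamma>)" "wfc ((s, A') # \<Gamma>')" using Lam * by auto
  then have "eqb (norm B) (norm B')"
    using Lam.IH(2)[OF *(3)] t' Lam.prems by simp
  then have "eqb (norm (Pi s A B)) (norm (Pi s A' B'))" using t'(2) by (simp add: eqb_Pi)
  then show ?case using subtype_norm[OF *(4)] by (rule eqb_trans)
next
  case (App \<Gamma> t s A B u)
  then obtain a b where t': "t' = App a b" "norm a = norm t" "norm b = norm u"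
    by (auto dest!: erase_eq_AppD[OF sym])
  then obtain s' A' B' where *: "has_ty \<Gamma>' a (Pi s' A' B')" "has_ty \<Gamma>' b A'" "tg b = s'" "sb (single s' b) B' \<preceq> T'"
    using has_ty_AppD App.prems by blast
  have "eqb (norm (Pi s A B)) (norm (Pi s' A' B'))"
    using App.IH(1)[OF *(1)] t' App.prems by auto
  from eqb_PiD[OF this[simplified]] have "s = s'" "eqb (norm B) (norm B')" by blast+
  moreover from this have "tg b = s" using *(3) by simp
  ultimately have "eqb (norm (sb (single s u) B)) (norm (sb (single s' b) B'))"
    unfolding erase_single[OF App.hyps(3)] erase_single[OF *(3)] t'(3)
    using App.hyps(3) by (metis eqb_single tg_erase)
  then show ?case using subtype_norm[OF *(4)] by (rule eqb_trans)
next
  case (Sig \<Gamma> A i B q s)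
  then obtain A' B' where t': "t' = Sig s Dia A' B'"
    by (auto dest!: erase_eq_SigD[OF sym])
  with Sig.prems show ?case by (auto dest!: has_ty_SigD subtype_norm)
next
  case (Pair \<Gamma> a A b r B s i)
  then obtain A' B' a' b' where t': "t' = Pair s r A' B' a' b'" "norm A' = norm A" "norm B' = norm B"
    by (auto dest!: erase_eq_PairD[OF sym])
  with Pair.prems show ?case by (auto dest!: has_ty_PairD subtype_norm)
next
  case (Fst \<Gamma> t s r A B)
  then obtain p where t': "t' = Fst p" "norm p = norm t"
    by (auto dest!: erase_eq_FstD[OF sym])
  then obtain s' r' A' B' where *: "has_ty \<Gamma>' p (Sig s' r' A' B')" "A' \<preceq> T'"
    using has_ty_FstD Fst.prems by blast
  have "eqb (norm (Sig s r A B)) (norm (Sig s' r' A' B'))"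
    using Fst.IH[OF *(1)] t' Fst.prems tg_Sig_elem[OF Fst(1)] by auto
  then show ?case using subtype_norm[OF *(2)] by (auto dest!: eqb_SigD intro: eqb_trans)
next
  case (Snd \<Gamma> t s r A B i q)
  then have "s = Dia" by simp
  with Snd obtain p where t': "t' = Snd s p" "norm p = norm t"
    by (auto dest!: erase_eq_SndD[OF sym])
  then obtain A' B' where *: "has_ty \<Gamma>' p (Sig s Dia A' B')" "sb (single Dia (Fst p)) B' \<preceq> T'"
    using has_ty_SndD Snd.prems by blast
  have "eqb (norm (Sig s r A B)) (norm (Sig s Dia A' B'))"
    using Snd.IH(1)[OF *(1)] t' Snd.prems tg_Sig_elem[OF Snd(1)] by auto
  from eqb_SigD[OF this[simplified]] have "eqb (norm B) (norm B')" by blast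
  then have "eqb (norm (sb (single r (Fst t)) B)) (norm (sb (single Dia (Fst p)) B'))"
    using Snd.hyps(5) t'(2) eqb_single[of "norm B" "norm B'" "Fst (norm t)" Dia]
    by (simp add: erase_single[of "Fst t" Dia] erase_single[of "Fst p" Dia])
  then show ?case using subtype_norm[OF *(2)] by (rule eqb_trans)
qed

lemma unique_sort:
  assumes "has_ty \<Gamma> A (Srt q)" "has_ty \<Gamma>' A' (Srt q')" "norm_ctx \<Gamma> = norm_ctx \<Gamma>'" "norm A = norm A'"
    "wfc \<Gamma>" "wfc \<Gamma>'"
  shows "st q = st q'"
  using unique_type[OF assms(1-4) tg_type assms(5,6)] assms eqb_norm_SrtD by blast

subsection \<open>Subject reduction\<close>

text \<open>Replacing a declared type by a convertible one is the identity substitution: the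
  variable is retyped by \<open>Conv\<close>, whose tag premise holds because the sort
  \<open>q\<close> satisfies \<open>st q = s\<close>.\<close>

lemma sb_ok_conv:
  assumes "has_ty \<Gamma> A (Srt q)" "has_ty \<Gamma> A' (Srt q)" "st q = s" "conv A A'"
  shows "sb_ok Var ((s, A) # \<Gamma>) ((s, A') # \<Gamma>)"
  unfolding sb_ok_def
proof (intro conjI allI impI)
  fix r n B
  assume "lookup ((s, A) # \<Gamma>) r n B"
  then show "has_ty ((s, A') # \<Gamma>) (Var r n) (sb Var B)"
  proof (cases rule: lookup_ConsE)
    case 1
    have "has_ty ((s, A') # \<Gamma>) (Var s 0) (ren (shf s) A')" by (intro has_ty.Var lookup_here)
    moreover have "has_ty ((s, A') # \<Gamma>) (ren (shf s) A) (Srt q)" using has_ty_weaken[OF assms(1)] by simp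
    moreover have "ren (shf s) A' \<preceq> ren (shf s) A" by (rule subtype_ren[OF subtype.conv[OF conv_sym[OF assms(4)]]])
    ultimately show ?thesis using 1 assms(3) has_ty.Conv[of _ "Var s 0" "ren (shf s) A'" "ren (shf s) A" q] by simp
  next
    case (2 m C)
    then show ?thesis by (auto intro: has_ty.Var lookup_there)
  qed
qed simp

lemma has_ty_ctx_conv:
  assumes "has_ty ((s, A) # \<Gamma>) t T" "has_ty \<Gamma> A (Srt q)" "has_ty \<Gamma> A' (Srt q)" "st q = s" "conv A A'"
  shows "has_ty ((s, A') # \<Gamma>) t T"
  using has_ty_sb[OF assms(1) sb_ok_conv[OF assms(2-5)]] by simp

text \<open>Injectivity of products moves the argument to the domain annotated on the abstraction,
  where the substitution lemma applies.\<close>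

lemma has_ty_redexD:
  assumes "has_ty \<Gamma> (Lam s' A' b) (Pi s A B)" "has_ty \<Gamma> u A" "tg u = s"
  shows "s' = s" "\<exists>q B'. has_ty \<Gamma> A' (Srt q) \<and> st q = s \<and> has_ty ((s, A') # \<Gamma>) b B' \<and> has_ty \<Gamma> u A' \<and> B' \<preceq> B"
proof -
  obtain q B' where *: "has_ty \<Gamma> A' (Srt q)" "st q = s'" "has_ty ((s', A') # \<Gamma>) b B'" "Pi s' A' B' \<preceq> Pi s A B"
    using has_ty_LamD assms(1) by blast
  note inv = subtype_PiD[OF *(4)]
  show "s' = s" by (rule inv(1))
  have "has_ty \<Gamma> u A'"
    using has_ty.Conv[OF assms(2) *(1) subtype.conv[OF conv_sym[OF inv(2)]]] *(2) assms(3) inv(1) by simp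
  then show "\<exists>q B'. has_ty \<Gamma> A' (Srt q) \<and> st q = s \<and> has_ty ((s, A') # \<Gamma>) b B' \<and> has_ty \<Gamma> u A' \<and> B' \<preceq> B"
    using * inv by blast
qed

lemma subject_reduction: "has_ty \<Gamma> t T \<Longrightarrow> wfc \<Gamma> \<Longrightarrow> beta t t' \<Longrightarrow> has_ty \<Gamma> t' T"
proof (induction arbitrary: t' rule: has_ty.induct)
  case (Conv \<Gamma> t A B q)
  then show ?case by (metis has_ty.Conv beta_tg)
next
  case (Pi_Type \<Gamma> A q s B i)
  from Pi_Type.prems(2) show ?case
    by (rule beta_PiE) (use Pi_Type has_ty_ctx_conv[OF Pi_Type.hyps(3,1) _ _ conv_beta] in \<open>auto intro: has_ty.Pi_Type\<close>)
next
  case (Pi_Prop \<Gamma> A q s B)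
  from Pi_Prop.prems(2) show ?case
    by (rule beta_PiE) (use Pi_Prop has_ty_ctx_conv[OF Pi_Prop.hyps(3,1) _ _ conv_beta] in \<open>auto intro: has_ty.Pi_Prop\<close>)
next
  case (Lam \<Gamma> A q s t B)
  from Lam.prems(2) show ?case
  proof (rule beta_LamE)
    fix A' assume *: "t' = Lam s A' t" "beta A A'"
    with Lam have A': "has_ty \<Gamma> A' (Srt q)" by blast
    have "has_ty ((s, A') # \<Gamma>) t B" using has_ty_ctx_conv[OF Lam.hyps(3,1) A' Lam.hyps(2)] * conv_beta by blast
    then have 1: "has_ty \<Gamma> t' (Pi s A' B)" using has_ty.Lam A' Lam.hyps(2) * by blast
    \<comment> \<open>The reduct has type \<open>Pi s A' B\<close>; returning to
      \<open>Pi s A B\<close> by \<open>Conv\<close> requires a sort of the latter.\<close>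
    have "wfc ((s, A) # \<Gamma>)" using Lam by auto
    then obtain q' where B: "has_ty ((s, A) # \<Gamma>) B (Srt q')" "tg t = st q'" using has_ty_sort[OF Lam.hyps(3)] by blast
    have "has_ty \<Gamma> (Pi s A B) (Srt (pi_sort q q'))" by (rule has_ty_Pi[OF Lam.hyps(1,2) B(1)])
    moreover have "Pi s A' B \<preceq> Pi s A B" 
      using * by (simp add: subtype.conv[OF conv_sym] conv_beta ctxt_closure.Pi1)
    ultimately show ?thesis using has_ty.Conv[OF 1] B(2) * by simp
  next
    fix t'' assume "t' = Lam s A t''" "beta t t''"
    with Lam show ?thesis by (auto intro: has_ty.Lam)
  qed simp
next
  case (App \<Gamma> t s A B u)
  have T: "has_ty \<Gamma> (App t u) (sb (single s u) B)" using App has_ty.App by blast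
  then obtain q where q: "has_ty \<Gamma> (sb (single s u) B) (Srt q)" "tg t = st q"
    using has_ty_sort App.prems(1) by fastforce
  from App.prems(2) show ?case
  proof (rule beta_AppE)
    assume "beta_step (App t u) t'"
    then obtain s' A' b where t: "t = Lam s' A' b" "t' = sb (single s' u) b" "tg u = s'"
      by (auto elim!: beta_step_AppE simp: tag_of_eq)
    then obtain B' where B': "has_ty ((s, A') # \<Gamma>) b B'" "has_ty \<Gamma> u A'" "B' \<preceq> B" and s: "s' = s"
      using has_ty_redexD[of \<Gamma> s' A' b s A B u] App.hyps by blast
    have "has_ty \<Gamma> t' (sb (single s u) B')" using has_ty_single[OF B'(1,2)] t s by blast
    moreover have "sb (single s u) B' \<preceq> sb (single s u) B"
      using B'(3) App.hyps(3) by (intro subtype_sb good_single)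
    moreover have "tg t' = st q" using q(2) t by (simp add: good_single)
    ultimately show ?thesis using q(1) by (blast intro: has_ty.Conv)
  next
    fix t'' assume "t' = App t'' u" "beta t t''"
    with App show ?thesis by (auto intro: has_ty.App)
  next
    fix u' assume *: "t' = App t u'" "beta u u'"
    then have "has_ty \<Gamma> t' (sb (single s u') B)" using App by (auto intro!: has_ty.App simp: beta_tg)
    moreover have "sb (single s u') B \<preceq> sb (single s u) B"
      using conv_single[OF *(2) App(3)] by (rule subtype.conv[OF conv_sym])
    ultimately show ?thesis using has_ty.Conv[OF _ q(1)] q(2) * by simp
  qed
next
  case (Sig \<Gamma> A i B q s)
  from Sig.prems(2) show ?case
  proof (rule beta_SigE)
    fix A' assume *: "t' = Sig s Dia A' B" "beta A A'"
    with Sig have A': "has_ty \<Gamma> A' (Srt (Type i))" by blast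
    have "has_ty ((Dia, A') # \<Gamma>) B (Srt q)" using has_ty_ctx_conv[OF Sig(2,1) A'] * conv_beta by simp
    then show ?thesis using has_ty.Sig[OF A'] Sig * by blast
  next
    fix B' assume *: "t' = Sig s Dia A B'" "beta B B'"
    have "wfc ((Dia, A) # \<Gamma>)" using Sig.hyps(1) Sig.prems(1) by auto
    then have "has_ty ((Dia, A) # \<Gamma>) B' (Srt q)" using Sig.IH(2) * by blast
    then show ?thesis using has_ty.Sig[OF Sig.hyps(1) _ Sig.hyps(3,4)] * by blast
  qed simp
next
  case (Pair \<Gamma> a A b r B s i)
  obtain q where r: "r = Dia" and Sig: "has_ty ((r, A) # \<Gamma>) B (Srt q)" "st q = s"
    using has_ty_SigD[OF Pair.hyps(3)] by blast
  have "has_ty \<Gamma> (sb (single r a) B) (Srt q)"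
    using has_ty_single[OF Sig(1) Pair.hyps(1,4)] by simp
  then have b: "tg b = s"
    using has_ty_sort[OF Pair.hyps(2) Pair.prems(1)] unique_sort Pair.prems(1) Sig(2) by metis
  \<comment> \<open>One claim for all four positions in which a pair can reduce: annotations may
    move to convertible ones and components to others of the same types, and the original type is
    restored at the end.\<close>
  have *: "has_ty \<Gamma> (Pair s r A' B' a' b') (Sig s r A B)"
    if *: "has_ty \<Gamma> (Sig s r A' B') (Srt (Type i))" "conv A A'" "conv B B'" "has_ty \<Gamma> a' A" "tg a' = r"
      "conv (sb (single r a) B) (sb (single r a') B)" "has_ty \<Gamma> b' (sb (single r a) B)" "tg b' = s"
    for A' B' a' b'
  proof -
    obtain j q' where gen: "has_ty \<Gamma> A' (Srt (Type j))" "has_ty ((r, A') # \<Gamma>) B' (Srt q')" "st q' = s"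
      using has_ty_SigD[OF *(1)] r by blast
    have a': "has_ty \<Gamma> a' A'"
      using has_ty.Conv[OF *(4) gen(1)] *(2,5) r by (simp add: subtype.conv)
    have "conv (sb (single r a) B) (sb (single r a') B')"
      using *(6) conv_sb[OF *(3) good_single[OF *(5)]] by (rule conv_trans)
    moreover have "has_ty \<Gamma> (sb (single r a') B') (Srt q')"
      using has_ty_single[OF gen(2) a' *(5)] by simp
    ultimately have "has_ty \<Gamma> b' (sb (single r a') B')"
      using has_ty.Conv[OF *(7)] gen(3) *(8) by (simp add: subtype.conv)
    then have "has_ty \<Gamma> (Pair s r A' B' a' b') (Sig s r A' B')"
      using has_ty.Pair a' *(1,5) by blast
    moreover have "conv (Sig s r A' B') (Sig s r A B)"
      using *(2,3) unfolding conv_iff_eqb eqb_def by simp (meson closure_rtranclp_Sig)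
    ultimately show ?thesis using has_ty.Conv[OF _ Pair.hyps(3)] by (simp add: subtype.conv)
  qed
  from Pair.prems(2) show ?case
  proof (rule beta_PairE)
    fix A' assume "t' = Pair s r A' B a b" "beta A A'"
    then show ?thesis using * Pair b conv_beta ctxt_closure.Sig1 by auto
  next
    fix B' assume "t' = Pair s r A B' a b" "beta B B'"
    then show ?thesis using * Pair b conv_beta ctxt_closure.Sig2 by auto
  next
    fix a' assume a': "t' = Pair s r A B a' b" "beta a a'"
    then have "conv (sb (single r a) B) (sb (single r a') B)" using conv_single Pair.hyps(4) by blast
    then show ?thesis using * Pair b a' beta_tg by auto
  next
    fix b' assume "t' = Pair s r A B a b'" "beta b b'"
    then show ?thesis using * Pair b beta_tg by auto
  qed simp
next
  case (Fst \<Gamma> t s r A B)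
  from Fst.prems(2) show ?case
  proof (rule beta_FstE)
    assume "beta_step (Fst t) t'"
    then obtain s' r' A' B' b where t: "t = Pair s' r' A' B' t' b" by (auto elim!: beta_step_FstE)
    then have *: "has_ty \<Gamma> t' A'" "tg t' = r'" "Sig s' r' A' B' \<preceq> Sig s r A B" using has_ty_PairD Fst.hyps by blast+
    note inv = subtype_SigD[OF *(3)]
    obtain q where "has_ty \<Gamma> (Sig s r A B) (Srt q)" using has_ty_sort Fst by blast
    then obtain j where "has_ty \<Gamma> A (Srt (Type j))" "r = Dia" using has_ty_SigD by blast
    then show ?thesis using has_ty.Conv[OF *(1)] * inv by (simp add: subtype.conv)
  next
    fix t'' assume "t' = Fst t''" "beta t t''"
    with Fst show ?thesis by (auto intro: has_ty.Fst)
  qed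
next
  case (Snd \<Gamma> t s r A B i q)
  have T: "has_ty \<Gamma> (sb (single r (Fst t)) B) (Srt q)"
    using has_ty_single[OF Snd.hyps(3) has_ty.Fst[OF Snd.hyps(1)]] Snd.hyps(5) by simp
  from Snd.prems(2) show ?case
  proof (rule beta_SndE)
    assume "beta_step (Snd s t) t'"
    then obtain s' r' A' B' a where t: "t = Pair s' r' A' B' a t'" "tg t' = s" by (auto elim!: beta_step_SndE simp: tag_of_eq)
    then have *: "has_ty \<Gamma> t' (sb (single r' a) B')" "tg a = r'" "Sig s' r' A' B' \<preceq> Sig s r A B"
      using has_ty_PairD Snd.hyps(1) by blast+
    note inv = subtype_SigD[OF *(3)]
    have "conv (sb (single r a) B') (sb (single r a) B)" using inv *(2) by (intro conv_sb good_single) auto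
    \<comment> \<open>This projection fires only if \<open>a\<close> has tag \<open>Dia\<close>,
      which the tag premise of \<open>Pair\<close> and the premise \<open>r = Dia\<close> of
      \<open>Snd\<close> guarantee.\<close>
    moreover have "beta (Fst t) a"
      using t(1) * inv(2) Snd.hyps(5) by (auto intro!: ctxt_closure.base beta_step.intros simp: tag_of_eq)
    then have "conv (sb (single r a) B) (sb (single r (Fst t)) B)"
      using conv_single Snd.hyps(5) by (intro conv_sym[OF conv_single]) auto
    ultimately have "conv (sb (single r a) B') (sb (single r (Fst t)) B)" by (rule conv_trans)
    then show ?thesis using has_ty.Conv[OF *(1) T] inv(2) t(2) Snd.hyps(4) by (simp add: subtype.conv)
  next
    fix t'' assume *: "t' = Snd s t''" "beta t t''"
    then have "has_ty \<Gamma> t' (sb (single r (Fst t'')) B)"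
      using Snd by (auto intro!: has_ty.Snd[where A = A and i = i and q = q])
    moreover have "conv (sb (single r (Fst t'')) B) (sb (single r (Fst t)) B)"
      using conv_single[OF ctxt_closure.Fst[OF *(2)]] Snd.hyps(5) by (simp add: conv_sym)
    ultimately show ?thesis using has_ty.Conv[OF _ T] Snd.hyps(4) * by (simp add: subtype.conv)
  qed
qed (auto elim: beta_SrtE beta_VarE)

lemma subject_reduction_rtranclp: "beta\<^sup>*\<^sup>* t t' \<Longrightarrow> has_ty \<Gamma> t T \<Longrightarrow> wfc \<Gamma> \<Longrightarrow> has_ty \<Gamma> t' T"
  by (induction rule: rtranclp_induct) (auto intro: subject_reduction)

lemma norm_erase [simp]: "norm (extr t) = norm t"
  by (simp add: erase_erase)

lemma le_norm: "le t u \<Longrightarrow> norm t = norm u"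
  by (induction rule: le.induct) auto

text \<open>Reducts keep their sorts by subject reduction and coincide after \<open>norm\<close>, so
  uniqueness of sorts applies to them. This supplies the tag premise of \<open>has_ty.Conv\<close>
  when original derivations are translated.\<close>

lemma subtype_sort:
  assumes "has_ty \<Gamma> A (Srt q)" "has_ty \<Gamma> B (Srt q')" "A \<preceq> B" "wfc \<Gamma>"
  shows "st q = st q'"
proof -
  obtain v w where *: "beta\<^sup>*\<^sup>* A v" "beta\<^sup>*\<^sup>* B w" "le (extr v) (extr w)"
    using subtype_lift[OF assms(3)] by blast
  then have "norm v = norm w" using le_norm by fastforce
  then show ?thesis
    using unique_sort[OF subject_reduction_rtranclp[OF *(1)] subject_reduction_rtranclp[OF *(2)]] assms by blast
qed

subsection \<open>Equivalence with the original system\<close>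

text \<open>The tag premises are recovered from the theory of the auxiliary system: for
  \<open>Conv\<close> by \<open>subtype_sort\<close>, for products by uniqueness of the sort of the
  domain, for \<open>Pair\<close> and \<open>Snd\<close> by inverting the \<Sigma>-type.\<close>

lemma typing_imp_has_ty:
  shows "\<turnstile> \<Gamma> wf \<Longrightarrow> wfc \<Gamma>" and "\<Gamma> \<turnstile> t \<Colon> T \<Longrightarrow> wfc \<Gamma> \<and> has_ty \<Gamma> t T"
proof (induction rule: wf_ctx_typing.inducts)
  case (Cons_Dia \<Gamma> A i)
  then show ?case by (auto intro!: exI[of _ "Type i"])
next
  case (Cons_Star \<Gamma> A)
  then show ?case by (auto intro!: exI[of _ "Prop"])
next
  case (Conv \<Gamma> t A B q)
  then obtain q1 where q1: "has_ty \<Gamma> A (Srt q1)" "tg t = st q1" using has_ty_sort by blast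
  then have "st q1 = st q" using subtype_sort Conv by blast
  then show ?case using has_ty.Conv Conv q1 by metis
next
  case (Pi_Type \<Gamma> A q s B i)
  then have "st q = s" using unique_sort[of \<Gamma> A q \<Gamma> A] by auto
  then show ?case using has_ty.Pi_Type Pi_Type by blast
next
  case (Pi_Prop \<Gamma> A q s B)
  then have "st q = s" using unique_sort[of \<Gamma> A q \<Gamma> A] by auto
  then show ?case using has_ty.Pi_Prop Pi_Prop by blast
next
  case (Lam s A \<Gamma> t B)
  then show ?case using has_ty.Lam by auto
next
  case (App \<Gamma> t s A B u)
  then show ?case using has_ty.App by (auto simp: tag_of_eq)
next
  case (Sig_Dia \<Gamma> A i B)
  then show ?case using has_ty.Sig[of \<Gamma> A i B "Type i"] by auto
next
  case (Sig_Star \<Gamma> A i B)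
  then show ?case using has_ty.Sig[of \<Gamma> A i B "Prop"] by auto
next
  case (Pair \<Gamma> a A b B r s i)
  then obtain j where r: "r = Dia" "has_ty \<Gamma> A (Srt (Type j))" using has_ty_SigD by blast
  obtain q where "has_ty \<Gamma> A (Srt q)" "tg a = st q" using Pair has_ty_sort by blast
  then have "tg a = Dia" using unique_sort[OF _ r(2)] Pair by auto
  then show ?case using Pair has_ty.Pair r(1) by auto
next
  case (Fst \<Gamma> t s r A B)
  then show ?case using has_ty.Fst by blast
next
  case (Snd \<Gamma> t s r A B)
  then obtain p where "has_ty \<Gamma> (Sig s r A B) (Srt p)" using has_ty_sort by blast
  then obtain i q where "has_ty \<Gamma> A (Srt (Type i))" "has_ty ((Dia, A) # \<Gamma>) B (Srt q)" "st q = s" "r = Dia"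
    using has_ty_SigD by blast
  then show ?case using has_ty.Snd Snd by auto
qed (auto intro: has_ty.intros)

lemma has_ty_imp_typing: "has_ty \<Gamma> t T \<Longrightarrow> \<turnstile> \<Gamma> wf \<Longrightarrow> \<Gamma> \<turnstile> t \<Colon> T"
proof (induction rule: has_ty.induct)
  case (Pi_Type \<Gamma> A q s B i)
  then have "\<turnstile> (s, A) # \<Gamma> wf" by (cases q) (auto intro: wf_ctx_typing.intros)
  then show ?case using Pi_Type by (auto intro: wf_ctx_typing.Pi_Type)
next
  case (Pi_Prop \<Gamma> A q s B)
  then have "\<turnstile> (s, A) # \<Gamma> wf" by (cases q) (auto intro: wf_ctx_typing.intros)
  then show ?case using Pi_Prop by (auto intro: wf_ctx_typing.Pi_Prop)
next
  case (Lam \<Gamma> A q s t B)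
  then have "\<turnstile> (s, A) # \<Gamma> wf" by (cases q) (auto intro: wf_ctx_typing.intros)
  then show ?case using Lam by (auto intro: wf_ctx_typing.Lam)
next
  case (App \<Gamma> t s A B u)
  then show ?case using wf_ctx_typing.App[of \<Gamma> t s A B u] by (simp add: tag_of_eq)
next
  case (Sig \<Gamma> A i B q s)
  then have "\<turnstile> (Dia, A) # \<Gamma> wf" by (auto intro: wf_ctx_typing.intros)
  then show ?case using Sig by (auto intro: wf_ctx_typing.Sig_Dia wf_ctx_typing.Sig_Star)
next
  case (Pair \<Gamma> a A b r B s i)
  then show ?case using wf_ctx_typing.Pair[of \<Gamma> a A b r B s i] by simp
next
  case (Fst \<Gamma> t s r A B)
  then show ?case using wf_ctx_typing.Fst by blast
next
  case (Snd \<Gamma> t s r A B i q)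
  then show ?case using wf_ctx_typing.Snd[of \<Gamma> t s r A B] by simp
next
  case (Conv \<Gamma> t A B q)
  then show ?case using wf_ctx_typing.Conv by blast
qed (auto intro: wf_ctx_typing.Prop wf_ctx_typing.Type wf_ctx_typing.Var)

lemma wfc_imp_wf_ctx: "wfc \<Gamma> \<Longrightarrow> \<turnstile> \<Gamma> wf"
proof (induction \<Gamma>)
  case (Cons d \<Gamma>)
  then obtain q where "has_ty \<Gamma> (snd d) (Srt q)" "st q = fst d" "\<turnstile> \<Gamma> wf" by auto
  then show ?case by (cases d; cases q) (auto intro: wf_ctx_typing.intros has_ty_imp_typing)
qed (rule wf_ctx_typing.Nil)

lemma typing_iff: "\<Gamma> \<turnstile> t \<Colon> T \<longleftrightarrow> wfc \<Gamma> \<and> has_ty \<Gamma> t T"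
  using typing_imp_has_ty(2) has_ty_imp_typing wfc_imp_wf_ctx by blast

section \<open>Set theory\<close>

text \<open>\<open>mk\<close> is a definite description and is meaningful only for collections that
  are sets; this predicate isolates that obligation.\<close>

definition small :: "'v::zf set \<Rightarrow> bool" where
  "small X \<longleftrightarrow> (\<exists>z. elts z = X)"

lemma elts_mk: "small X \<Longrightarrow> elts (mk X) = X"
  unfolding small_def mk_def by (rule theI') (metis extensionality)

lemma small_pair [simp]: "small {x, y}"
  by (simp add: small_def pairing)

lemma small_singleton [simp]: "small {x}"
  using small_pair[of x x] by simp

lemma small_subset: "X \<subseteq> elts a \<Longrightarrow> small X"
proof -
  assume "X \<subseteq> elts a"
  then have "{x \<in> elts a. x \<in> X} = X" by blast
  then show "small X" using separation[of a "\<lambda>x. x \<in> X"] by (simp add: small_def)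
qed

lemma small_empty [simp]: "small {}"
  using small_subset by blast

lemma small_image [simp]: "small (F ` elts a)" for F :: "'v::zf \<Rightarrow> 'v"
  unfolding small_def by (rule replacement)

lemma small_UN [simp]: "small (\<Union>x\<in>elts a. elts (F x))" for F :: "'v::zf \<Rightarrow> 'v"
proof -
  obtain z where "elts z = F ` elts a" using replacement by metis
  moreover obtain u where "elts u = (\<Union>y\<in>elts z. elts y)" using union by metis
  ultimately show ?thesis by (auto simp: small_def)
qed

lemma small_Pow [simp]: "small {y. elts y \<subseteq> elts x}"
  by (simp add: small_def powerset)

lemma elts_vempty [simp]: "elts vempty = {}"
  by (simp add: vempty_def elts_mk)

lemma elts_vone [simp]: "elts vone = {vempty}"
  by (simp add: vone_def elts_mk)

lemma vpair_inject [simp]: "vpair x y = vpair x' y' \<longleftrightarrow> x = x' \<and> y = y'"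
proof
  assume "vpair x y = vpair x' y'"
  then have "{mk {x}, mk {x, y}} = {mk {x'}, mk {x', y'}}"
    unfolding vpair_def by (metis elts_mk small_pair)
  then have "elts ` {mk {x}, mk {x, y}} = elts ` {mk {x'}, mk {x', y'}}" by simp
  then have "{{x}, {x, y}} = {{x'}, {x', y'}}" by (simp add: elts_mk)
  then show "x = x' \<and> y = y'" by (auto simp: doubleton_eq_iff)
qed simp

lemma is_vpair_vpair [simp]: "is_vpair (vpair x y)"
  by (auto simp: is_vpair_def)

lemma vfst_vpair [simp]: "vfst (vpair x y) = x"
  by (simp add: vfst_def)

lemma vsnd_vpair [simp]: "vsnd (vpair x y) = y"
  by (simp add: vsnd_def)

lemma elts_vlam: "elts (vlam a F) = (\<lambda>x. vpair x (F x)) ` elts a"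
  by (simp add: vlam_def elts_mk)

lemma vlam_props [simp]:
  "is_vfun (vlam a F)" "vdom (vlam a F) = elts a" "x \<in> elts a \<Longrightarrow> vapp (vlam a F) x = F x"
  by (auto simp: is_vfun_def vdom_def vapp_def elts_vlam image_iff)

lemma elts_vSigma: "elts (vSigma a B) = {vpair x y | x y. x \<in> elts a \<and> y \<in> elts (B x)}"
proof -
  have "{vpair x y | x y. x \<in> elts a \<and> y \<in> elts (B x)} = (\<Union>x\<in>elts a. elts (mk (vpair x ` elts (B x))))"
    by (auto simp: elts_mk)
  then have "small {vpair x y | x y. x \<in> elts a \<and> y \<in> elts (B x)}" by simp
  then show ?thesis by (simp add: vSigma_def elts_mk)
qed

text \<open>The power set of the \<Sigma>-set bounds the function space; this shows both that
  \<open>vPi\<close> is a set and that universes are closed under it.\<close>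

lemma vfun_subset_vSigma:
  assumes "is_vfun f" "vdom f = elts a" "\<forall>x\<in>elts a. vapp f x \<in> elts (B x)"
  shows "elts f \<subseteq> elts (vSigma a B)"
proof
  fix p assume p: "p \<in> elts f"
  with assms(1) obtain x y where xy: "p = vpair x y" by (auto simp: is_vfun_def is_vpair_def)
  have "vapp f x = y" using assms(1) p xy unfolding vapp_def is_vfun_def by blast
  moreover have "x \<in> elts a" using p xy assms(2) unfolding vdom_def by blast
  ultimately show "p \<in> elts (vSigma a B)" using assms(3) xy by (auto simp: elts_vSigma)
qed

lemma elts_vPi: "elts (vPi a B) = {f. is_vfun f \<and> vdom f = elts a \<and> (\<forall>x\<in>elts a. vapp f x \<in> elts (B x))}"
proof -
  have "{f. is_vfun f \<and> vdom f = elts a \<and> (\<forall>x\<in>elts a. vapp f x \<in> elts (B x))}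
      \<subseteq> elts (mk {y. elts y \<subseteq> elts (vSigma a B)})"
    using vfun_subset_vSigma by (auto simp: elts_mk)
  then show ?thesis unfolding vPi_def by (intro elts_mk small_subset)
qed

lemma elts_vInter: "elts a \<noteq> {} \<Longrightarrow> elts (vInter a B) = (\<Inter>x\<in>elts a. elts (B x))"
proof -
  assume a: "elts a \<noteq> {}"
  then obtain x where "x \<in> elts a" by blast
  then have "(\<Inter>x\<in>elts a. elts (B x)) \<subseteq> elts (B x)" by blast
  then show ?thesis using a by (simp add: vInter_def elts_mk small_subset)
qed

lemma vInter_empty: "elts a = {} \<Longrightarrow> vInter a B = vone"
  by (simp add: vInter_def)

text \<open>These operations look at the family on members of \<open>a\<close> only, so the
  arbitrary values \<open>the None\<close> that \<open>over\<close> may pass outside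
  \<open>a\<close> do no harm.\<close>

lemma op_cong:
  assumes "\<And>x. x \<in> elts a \<Longrightarrow> F x = G x"
  shows "vlam a F = vlam a G" "vPi a F = vPi a G" "vSigma a F = vSigma a G" "vInter a F = vInter a G"
proof -
  show "vlam a F = vlam a G" unfolding vlam_def using assms by (auto intro!: arg_cong[where f = mk])
  show "vPi a F = vPi a G" by (rule extensionality) (use assms in \<open>auto simp: elts_vPi\<close>)
  show "vSigma a F = vSigma a G" by (rule extensionality) (use assms in \<open>auto simp: elts_vSigma\<close>)
  show "vInter a F = vInter a G" unfolding vInter_def using assms by (auto intro!: arg_cong[where f = mk])
qed

text \<open>A set-theoretic function determines its domain, so only the codomain varies, which
  matches the shape of \<open>le\<close>.\<close>

lemma vPi_mono: "(\<And>x. x \<in> elts a \<Longrightarrow> elts (B x) \<subseteq> elts (C x)) \<Longrightarrow> elts (vPi a B) \<subseteq> elts (vPi a C)"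
  by (auto simp: elts_vPi)

lemma vInter_mono: "(\<And>x. x \<in> elts a \<Longrightarrow> elts (B x) \<subseteq> elts (C x)) \<Longrightarrow> elts (vInter a B) \<subseteq> elts (vInter a C)"
proof (cases "elts a = {}")
  case False
  assume "\<And>x. x \<in> elts a \<Longrightarrow> elts (B x) \<subseteq> elts (C x)"
  then show ?thesis unfolding elts_vInter[OF False] by blast
qed (simp add: vInter_empty)

section \<open>Truth values\<close>

abbreviation vbool :: "'v::zf" where
  "vbool \<equiv> mk {vempty, vone}"

lemma elts_vbool: "elts vbool = {vempty, vone}"
  by (simp add: elts_mk)

lemma vbool_iff: "x \<in> elts vbool \<longleftrightarrow> elts x \<subseteq> {vempty}"
proof
  assume "elts x \<subseteq> {vempty}"
  then have "elts x = elts vempty \<or> elts x = elts vone" by auto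
  then have "x = vempty \<or> x = vone" using extensionality by blast
  then show "x \<in> elts vbool" by (simp add: elts_vbool)
qed (auto simp: elts_vbool)

text \<open>The index set is arbitrary: this is the impredicativity of \<open>Prop\<close>. Over an
  empty index set the intersection is \<open>vone\<close>, again a truth value.\<close>

lemma vInter_vbool: "(\<And>x. x \<in> elts a \<Longrightarrow> B x \<in> elts vbool) \<Longrightarrow> vInter a B \<in> elts vbool"
proof (cases "elts a = {}")
  case False
  assume "\<And>x. x \<in> elts a \<Longrightarrow> B x \<in> elts vbool"
  then show ?thesis using False unfolding vbool_iff elts_vInter[OF False] by blast
qed (simp add: vInter_empty vbool_iff)

section \<open>Closure properties of universes\<close>

lemma univ_trans: "universe u \<Longrightarrow> x \<in> elts u \<Longrightarrow> y \<in> elts x \<Longrightarrow> y \<in> elts u"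
  by (auto simp: universe_def)

lemma univ_pair: "universe u \<Longrightarrow> x \<in> elts u \<Longrightarrow> y \<in> elts u \<Longrightarrow> mk {x, y} \<in> elts u"
  by (auto simp: universe_def)

lemma univ_singleton: "universe u \<Longrightarrow> x \<in> elts u \<Longrightarrow> mk {x} \<in> elts u"
  using univ_pair[of u x x] by simp

lemma univ_Pow: "universe u \<Longrightarrow> x \<in> elts u \<Longrightarrow> mk {y. elts y \<subseteq> elts x} \<in> elts u"
  by (auto simp: universe_def)

lemma univ_UN: "universe u \<Longrightarrow> x \<in> elts u \<Longrightarrow> (\<And>y. y \<in> elts x \<Longrightarrow> F y \<in> elts u) \<Longrightarrow>
    mk (\<Union>y\<in>elts x. elts (F y)) \<in> elts u"
  unfolding universe_def by blast

lemma univ_vempty: "universe u \<Longrightarrow> vempty \<in> elts u"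
  unfolding universe_def by blast

text \<open>A subset of a member belongs to the power set of that member, and universes are
  transitive.\<close>

lemma univ_subset: "universe u \<Longrightarrow> y \<in> elts u \<Longrightarrow> elts x \<subseteq> elts y \<Longrightarrow> x \<in> elts u"
  using univ_trans[OF _ univ_Pow, of u y x] by (simp add: elts_mk)

lemma univ_vone: "universe u \<Longrightarrow> vone \<in> elts u"
  by (simp add: vone_def univ_singleton univ_vempty)

lemma univ_vbool: "universe u \<Longrightarrow> vbool \<in> elts u"
  by (simp add: univ_pair univ_vone univ_vempty)

lemma univ_vpair: "universe u \<Longrightarrow> x \<in> elts u \<Longrightarrow> y \<in> elts u \<Longrightarrow> vpair x y \<in> elts u"
  by (simp add: vpair_def univ_pair univ_singleton)

lemma univ_vSigma:
  assumes "universe u" "a \<in> elts u" "\<And>x. x \<in> elts a \<Longrightarrow> B x \<in> elts u"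
  shows "vSigma a B \<in> elts u"
proof -
  \<comment> \<open>The \<Sigma>-set is written as a double union of singletons, because universes
    provide replacement in the form of unions of families.\<close>
  have "mk (\<Union>y\<in>elts (B x). elts (mk {vpair x y})) \<in> elts u" if "x \<in> elts a" for x
    using that assms by (intro univ_UN univ_singleton univ_vpair) (auto intro: univ_trans)
  then have "mk (\<Union>x\<in>elts a. elts (mk (\<Union>y\<in>elts (B x). elts (mk {vpair x y})))) \<in> elts u"
    by (rule univ_UN[OF assms(1,2)])
  moreover have "(\<Union>x\<in>elts a. elts (mk (\<Union>y\<in>elts (B x). elts (mk {vpair x y}))))
      = {vpair x y | x y. x \<in> elts a \<and> y \<in> elts (B x)}"
    unfolding elts_mk[OF small_UN] by (auto simp: elts_mk)
  ultimately show ?thesis by (simp add: vSigma_def)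
qed

lemma univ_vPi:
  assumes "universe u" "a \<in> elts u" "\<And>x. x \<in> elts a \<Longrightarrow> B x \<in> elts u"
  shows "vPi a B \<in> elts u"
proof (rule univ_subset[OF assms(1) univ_Pow[OF assms(1) univ_vSigma[OF assms]]])
  show "elts (vPi a B) \<subseteq> elts (mk {y. elts y \<subseteq> elts (vSigma a B)})"
    unfolding elts_mk[OF small_Pow] elts_vPi using vfun_subset_vSigma by auto
qed

lemma universes_mono:
  assumes "universes U" "i \<le> j"
  shows "elts (U i) \<subseteq> elts (U j)"
  using assms(2)
proof (induction rule: dec_induct)
  case (step n)
  moreover have "elts (U n) \<subseteq> elts (U (Suc n))"
    using assms(1) unfolding universes_def universe_def by blast
  ultimately show ?case by blast
qed simp

lemma universes_mem:
  assumes "universes U" "1 \<le> p"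
  shows "U i \<in> elts (U (i + p))"
proof -
  have "U i \<in> elts (U (Suc i))" using assms(1) by (simp add: universes_def)
  then show ?thesis using universes_mono[OF assms(1), of "Suc i" "i + p"] assms(2) by auto
qed

section \<open>The interpretation\<close>

lemma upd_simps [simp]: "upd s \<alpha> I s 0 = \<alpha>" "upd s \<alpha> I r (shf s r m) = I r m"
  by (auto simp: upd_def shf_def)

lemma tail_upd [simp]: "tail s (upd s \<alpha> I) = I"
  by (auto simp: tail_def under_eq_shf fun_eq_iff)

lemma over_eq_Some:
  "over op a F = Some y \<longleftrightarrow> (\<exists>x. a = Some x \<and> (\<forall>\<alpha>\<in>elts x. F \<alpha> \<noteq> None) \<and> y = op x (\<lambda>\<alpha>. the (F \<alpha>)))"
  by (auto simp: over_def split: option.splits)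

text \<open>Definedness and values travel together from the first family to the second, which may be
  defined in more places. Membership in the list of operations stands for insensitivity to the
  family outside its index set.\<close>

lemma over_mono:
  assumes "over op a F = Some y" "op \<in> {vlam, vPi, vSigma, vInter}" "\<And>x. a = Some x \<Longrightarrow> a' = Some x"
    "\<And>x \<alpha> v. a = Some x \<Longrightarrow> \<alpha> \<in> elts x \<Longrightarrow> F \<alpha> = Some v \<Longrightarrow> F' \<alpha> = Some v"
  shows "over op a' F' = Some y"
proof -
  obtain x where x: "a = Some x" "\<forall>\<alpha>\<in>elts x. F \<alpha> \<noteq> None" "y = op x (\<lambda>\<alpha>. the (F \<alpha>))"
    using assms(1) by (auto simp: over_eq_Some)
  have *: "F' \<alpha> = F \<alpha>" if "\<alpha> \<in> elts x" for \<alpha> using assms(4) x that by fastforce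
  then have "op x (\<lambda>\<alpha>. the (F \<alpha>)) = op x (\<lambda>\<alpha>. the (F' \<alpha>))"
    using assms(2) op_cong[of x "\<lambda>\<alpha>. the (F \<alpha>)" "\<lambda>\<alpha>. the (F' \<alpha>)"] by auto
  with * x assms(3) show ?thesis by (auto simp: over_eq_Some)
qed

subsection \<open>Equations for typed terms\<close>

primrec srt_set :: "(nat \<Rightarrow> 'v::zf) \<Rightarrow> sort \<Rightarrow> 'v" where
  "srt_set U Prop = vbool"
| "srt_set U (Type i) = U i"

lemma interp_Star: "wfc \<Gamma> \<Longrightarrow> has_ty \<Gamma> t T \<Longrightarrow> tg t = Star \<Longrightarrow> interp U \<Gamma> t I = Some vempty"
  by (subst interp.simps) (auto simp: typing_iff tag_of_eq)

lemma interp_Srt [simp]: "wfc \<Gamma> \<Longrightarrow> interp U \<Gamma> (Srt q) I = Some (srt_set U q)"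
  using has_ty.Prop[of \<Gamma> 0] has_ty.Type[of 1 \<Gamma>]
  by (subst interp.simps) (cases q, auto simp: typing_iff tag_of_eq)

lemma interp_Var: "wfc \<Gamma> \<Longrightarrow> lookup \<Gamma> Dia n A \<Longrightarrow> interp U \<Gamma> (Var Dia n) I = Some (I Dia n)"
  using has_ty.Var[of \<Gamma> Dia n A] by (subst interp.simps) (auto simp: typing_iff tag_of_eq)

lemma interp_Lam: "wfc \<Gamma> \<Longrightarrow> has_ty \<Gamma> (Lam s A b) T \<Longrightarrow> tg b = Dia \<Longrightarrow>
    interp U \<Gamma> (Lam s A b) I = over vlam (interp U \<Gamma> A I) (\<lambda>\<alpha>. interp U ((s, A) # \<Gamma>) b (upd s \<alpha> I))"
  by (subst interp.simps) (auto simp: typing_iff tag_of_eq)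

lemma interp_App: "wfc \<Gamma> \<Longrightarrow> has_ty \<Gamma> (App f u) T \<Longrightarrow> tg f = Dia \<Longrightarrow>
    interp U \<Gamma> (App f u) I = (case (interp U \<Gamma> f I, interp U \<Gamma> u I) of
            (Some x, Some y) \<Rightarrow> if is_vfun x \<and> y \<in> vdom x then Some (vapp x y) else None
          | _ \<Rightarrow> None)"
  by (subst interp.simps) (auto simp: typing_iff tag_of_eq)

definition pi_op :: "sort \<Rightarrow> 'v::zf \<Rightarrow> ('v \<Rightarrow> 'v) \<Rightarrow> 'v" where
  "pi_op q = (if st q = Star then vInter else vPi)"

lemma pi_op_in: "pi_op q \<in> {vlam, vPi, vSigma, vInter}"
  by (simp add: pi_op_def)

text \<open>The definition tests whether the product has type \<open>Prop\<close>; by uniqueness of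
  sorts, any sort known for the product answers the test.\<close>

lemma interp_Pi:
  assumes "wfc \<Gamma>" "has_ty \<Gamma> (Pi s A B) (Srt q)"
  shows "interp U \<Gamma> (Pi s A B) I =
    over (pi_op q) (interp U \<Gamma> A I) (\<lambda>\<alpha>. interp U ((s, A) # \<Gamma>) B (upd s \<alpha> I))"
proof -
  have "has_ty \<Gamma> (Pi s A B) (Srt Prop) \<longleftrightarrow> st q = Star"
    using unique_sort[OF assms(2) _ refl refl assms(1,1), of Prop] assms(2) by (cases q) auto
  then show ?thesis using assms by (subst interp.simps) (auto simp: typing_iff tag_of_eq pi_op_def)
qed

lemma interp_Sig: "wfc \<Gamma> \<Longrightarrow> has_ty \<Gamma> (Sig q s A B) T \<Longrightarrow>
    interp U \<Gamma> (Sig q s A B) I = over vSigma (interp U \<Gamma> A I) (\<lambda>\<alpha>. interp U ((s, A) # \<Gamma>) B (upd s \<alpha> I))"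
  by (subst interp.simps) (auto simp: typing_iff tag_of_eq)

lemma interp_Pair: "wfc \<Gamma> \<Longrightarrow> has_ty \<Gamma> (Pair q s A B a b) T \<Longrightarrow>
    interp U \<Gamma> (Pair q s A B a b) I = (case (interp U \<Gamma> a I, interp U \<Gamma> b I) of
            (Some x, Some y) \<Rightarrow> Some (vpair x y) | _ \<Rightarrow> None)"
  by (subst interp.simps) (auto simp: typing_iff tag_of_eq)

lemma interp_Fst: "wfc \<Gamma> \<Longrightarrow> has_ty \<Gamma> (Fst p) T \<Longrightarrow>
    interp U \<Gamma> (Fst p) I = (case interp U \<Gamma> p I of
            Some x \<Rightarrow> if is_vpair x then Some (vfst x) else None | None \<Rightarrow> None)"
  by (subst interp.simps) (auto simp: typing_iff tag_of_eq)

lemma interp_Snd: "wfc \<Gamma> \<Longrightarrow> has_ty \<Gamma> (Snd Dia p) T \<Longrightarrow>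
    interp U \<Gamma> (Snd Dia p) I = (case interp U \<Gamma> p I of
            Some x \<Rightarrow> if is_vpair x then Some (vsnd x) else None | None \<Rightarrow> None)"
  by (subst interp.simps) (auto simp: typing_iff tag_of_eq)

lemma wfc_Cons: "wfc \<Gamma> \<Longrightarrow> has_ty \<Gamma> A (Srt q) \<Longrightarrow> st q = s \<Longrightarrow> wfc ((s, A) # \<Gamma>)"
  by auto

subsection \<open>Renaming and substitution\<close>

text \<open>\<open>interp\<close> never reads the values of proof variables, so agreement is
  required for the tag \<open>Dia\<close> only.\<close>

definition ren_val :: "ren \<Rightarrow> ctx \<Rightarrow> 'v valuation \<Rightarrow> 'v valuation \<Rightarrow> bool" where
  "ren_val \<rho> \<Gamma> I I' \<longleftrightarrow> (\<forall>n A. lookup \<Gamma> Dia n A \<longrightarrow> I' Dia (\<rho> Dia n) = I Dia n)"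

lemma ren_val_upd: "ren_val \<rho> \<Gamma> I I' \<Longrightarrow> ren_val (upr s \<rho>) ((s, A) # \<Gamma>) (upd s \<alpha> I) (upd s \<alpha> I')"
  unfolding ren_val_def by (auto elim!: lookup_ConsE)

text \<open>An equality of partial values, undefinedness included. Typing transfers along the
  renaming, so the tests for typability and for \<open>Prop\<close> have the same outcome on both
  sides.\<close>

lemma interp_ren:
  assumes "has_ty \<Gamma> t T" "wfc \<Gamma>" "wfc \<Delta>" "ren_ok \<rho> \<Gamma> \<Delta>" "ren_val \<rho> \<Gamma> I I'"
  shows "interp U \<Delta> (ren \<rho> t) I' = interp U \<Gamma> t I"
  using assms
proof (induction arbitrary: \<Delta> \<rho> I I' rule: has_ty.induct)
  case (Var \<Gamma> s n A)
  have ty: "has_ty \<Gamma> (Var s n) A" "has_ty \<Delta> (Var s (\<rho> s n)) (ren \<rho> A)" "lookup \<Delta> s (\<rho> s n) (ren \<rho> A)"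
    using Var by (auto simp: ren_ok_def intro: has_ty.Var)
  show ?case
  proof (cases s)
    case Star
    then show ?thesis using ty Var by (simp add: interp_Star)
  next
    case Dia
    then show ?thesis using ty Var by (auto simp: interp_Var ren_val_def)
  qed
next
  case (Pi_Type \<Gamma> A q s B i)
  have ty: "has_ty \<Gamma> (Pi s A B) (Srt (max_Type q i))" using Pi_Type.hyps by (rule has_ty.Pi_Type)
  then have ty': "has_ty \<Delta> (Pi s (ren \<rho> A) (ren (upr s \<rho>) B)) (Srt (max_Type q i))"
    using has_ty_ren[OF ty Pi_Type.prems(3)] by simp
  have wf: "wfc ((s, A) # \<Gamma>)" "wfc ((s, ren \<rho> A) # \<Delta>)"
    using Pi_Type has_ty_ren[OF Pi_Type.hyps(1) Pi_Type.prems(3)] by auto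
  show ?case
    using Pi_Type.IH(1)[OF Pi_Type.prems]
      Pi_Type.IH(2)[OF wf ren_ok_upr[OF Pi_Type.prems(3)] ren_val_upd[OF Pi_Type.prems(4)]]
    by (simp add: interp_Pi[OF Pi_Type.prems(1) ty] interp_Pi[OF Pi_Type.prems(2) ty'])
next
  case (Pi_Prop \<Gamma> A q s B)
  have ty: "has_ty \<Gamma> (Pi s A B) (Srt Prop)" using Pi_Prop.hyps by (rule has_ty.Pi_Prop)
  then have ty': "has_ty \<Delta> (Pi s (ren \<rho> A) (ren (upr s \<rho>) B)) (Srt Prop)"
    using has_ty_ren[OF ty Pi_Prop.prems(3)] by simp
  have wf: "wfc ((s, A) # \<Gamma>)" "wfc ((s, ren \<rho> A) # \<Delta>)"
    using Pi_Prop has_ty_ren[OF Pi_Prop.hyps(1) Pi_Prop.prems(3)] by auto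
  show ?case
    using Pi_Prop.IH(1)[OF Pi_Prop.prems]
      Pi_Prop.IH(2)[OF wf ren_ok_upr[OF Pi_Prop.prems(3)] ren_val_upd[OF Pi_Prop.prems(4)]]
    by (simp add: interp_Pi[OF Pi_Prop.prems(1) ty] interp_Pi[OF Pi_Prop.prems(2) ty'])
next
  case (Lam \<Gamma> A q s t B)
  have ty: "has_ty \<Gamma> (Lam s A t) (Pi s A B)" using Lam.hyps by (rule has_ty.Lam)
  then have ty': "has_ty \<Delta> (Lam s (ren \<rho> A) (ren (upr s \<rho>) t)) (ren \<rho> (Pi s A B))"
    using has_ty_ren[OF ty Lam.prems(3)] by simp
  have wf: "wfc ((s, A) # \<Gamma>)" "wfc ((s, ren \<rho> A) # \<Delta>)"
    using Lam has_ty_ren[OF Lam.hyps(1) Lam.prems(3)] by auto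
  show ?case
  proof (cases "tg t")
    case Star
    then show ?thesis by (simp add: interp_Star[OF Lam.prems(1) ty] interp_Star[OF Lam.prems(2) ty'])
  next
    case Dia
    then show ?thesis
      using Lam.IH(1)[OF Lam.prems] Lam.IH(2)[OF wf ren_ok_upr[OF Lam.prems(3)] ren_val_upd[OF Lam.prems(4)]]
      by (simp add: interp_Lam[OF Lam.prems(1) ty] interp_Lam[OF Lam.prems(2) ty'])
  qed
next
  case (App \<Gamma> t s A B u)
  have ty: "has_ty \<Gamma> (App t u) (sb (single s u) B)" using App.hyps by (rule has_ty.App)
  then have ty': "has_ty \<Delta> (App (ren \<rho> t) (ren \<rho> u)) (ren \<rho> (sb (single s u) B))"
    using has_ty_ren[OF ty App.prems(3)] by simp
  show ?case
  proof (cases "tg t")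
    case Star
    then show ?thesis by (simp add: interp_Star[OF App.prems(1) ty] interp_Star[OF App.prems(2) ty'])
  next
    case Dia
    then show ?thesis using App.IH(1)[OF App.prems] App.IH(2)[OF App.prems]
      by (simp add: interp_App[OF App.prems(1) ty] interp_App[OF App.prems(2) ty'])
  qed
next
  case (Sig \<Gamma> A i B q s)
  have ty: "has_ty \<Gamma> (Sig s Dia A B) (Srt (Type i))" using Sig.hyps by (rule has_ty.Sig)
  then have ty': "has_ty \<Delta> (Sig s Dia (ren \<rho> A) (ren (upr Dia \<rho>) B)) (Srt (Type i))"
    using has_ty_ren[OF ty Sig.prems(3)] by simp
  have wf: "wfc ((Dia, A) # \<Gamma>)" "wfc ((Dia, ren \<rho> A) # \<Delta>)"
    using Sig.prems Sig.hyps(1) has_ty_ren[OF Sig.hyps(1) Sig.prems(3)] by (auto intro!: exI[of _ "Type i"])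
  show ?case
    using Sig.IH(1)[OF Sig.prems] Sig.IH(2)[OF wf ren_ok_upr[OF Sig.prems(3)] ren_val_upd[OF Sig.prems(4)]]
    by (simp add: interp_Sig[OF Sig.prems(1) ty] interp_Sig[OF Sig.prems(2) ty'])
next
  case (Pair \<Gamma> a A b r B s i)
  have ty: "has_ty \<Gamma> (Pair s r A B a b) (Sig s r A B)" using Pair.hyps by (rule has_ty.Pair)
  then have ty': "has_ty \<Delta> (Pair s r (ren \<rho> A) (ren (upr r \<rho>) B) (ren \<rho> a) (ren \<rho> b)) (ren \<rho> (Sig s r A B))"
    using has_ty_ren[OF ty Pair.prems(3)] by simp
  show ?case using Pair.IH(1)[OF Pair.prems] Pair.IH(2)[OF Pair.prems]
    by (simp add: interp_Pair[OF Pair.prems(1) ty] interp_Pair[OF Pair.prems(2) ty'])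
next
  case (Fst \<Gamma> t s r A B)
  have ty: "has_ty \<Gamma> (Fst t) A" using Fst.hyps by (rule has_ty.Fst)
  then have ty': "has_ty \<Delta> (Fst (ren \<rho> t)) (ren \<rho> A)"
    using has_ty_ren[OF ty Fst.prems(3)] by simp
  show ?case using Fst.IH(1)[OF Fst.prems]
    by (simp add: interp_Fst[OF Fst.prems(1) ty] interp_Fst[OF Fst.prems(2) ty'])
next
  case (Snd \<Gamma> t s r A B i q)
  have ty: "has_ty \<Gamma> (Snd s t) (sb (single r (Fst t)) B)" using Snd.hyps by (rule has_ty.Snd)
  then have ty': "has_ty \<Delta> (Snd s (ren \<rho> t)) (ren \<rho> (sb (single r (Fst t)) B))"
    using has_ty_ren[OF ty Snd.prems(3)] by simp
  show ?case
  proof (cases s)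
    case Star
    then show ?thesis using interp_Star[OF Snd.prems(1) ty, of U I] interp_Star[OF Snd.prems(2) ty', of U I'] by simp
  next
    case Dia
    then show ?thesis using Snd.IH(1)[OF Snd.prems] ty ty' Snd.prems by (simp add: interp_Snd)
  qed
qed simp_all

definition sb_val :: "(nat \<Rightarrow> 'v::zf) \<Rightarrow> sbs \<Rightarrow> ctx \<Rightarrow> ctx \<Rightarrow> 'v valuation \<Rightarrow> 'v valuation \<Rightarrow> bool" where
  "sb_val U \<sigma> \<Gamma> \<Delta> I I' \<longleftrightarrow> (\<forall>n A. lookup \<Gamma> Dia n A \<longrightarrow> interp U \<Delta> (\<sigma> Dia n) I' = Some (I Dia n))"

lemma sb_val_upd:
  assumes "sb_val U \<sigma> \<Gamma> \<Delta> I I'" "sb_ok \<sigma> \<Gamma> \<Delta>" "wfc \<Delta>" "wfc ((s, C) # \<Delta>)"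
  shows "sb_val U (ups s \<sigma>) ((s, A) # \<Gamma>) ((s, C) # \<Delta>) (upd s \<alpha> I) (upd s \<alpha> I')"
  unfolding sb_val_def
proof (intro allI impI)
  fix n B
  assume "lookup ((s, A) # \<Gamma>) Dia n B"
  then show "interp U ((s, C) # \<Delta>) (ups s \<sigma> Dia n) (upd s \<alpha> I') = Some (upd s \<alpha> I Dia n)"
  proof (cases rule: lookup_ConsE)
    case 1
    then show ?thesis using interp_Var[OF assms(4), of 0 "ren (shf s) C" U] lookup_here[of s C \<Delta>] by auto
  next
    case (2 m D)
    then have "has_ty \<Delta> (\<sigma> Dia m) (sb \<sigma> D)" using assms(2) by (auto simp: sb_ok_def)
    then have "interp U ((s, C) # \<Delta>) (ren (shf s) (\<sigma> Dia m)) (upd s \<alpha> I') = interp U \<Delta> (\<sigma> Dia m) I'"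
      by (rule interp_ren[OF _ assms(3,4) ren_ok_shf]) (simp add: ren_val_def)
    then show ?thesis using 2 assms(1) by (auto simp: sb_val_def)
  qed
qed

text \<open>As for renamings, typing and tags are stable, so both sides take the same branches. A
  proof variable and the proof substituted for it both denote the empty set, which is why
  \<open>sb_val\<close> constrains \<open>Dia\<close> variables only.\<close>

lemma interp_sb:
  assumes "has_ty \<Gamma> t T" "wfc \<Gamma>" "wfc \<Delta>" "sb_ok \<sigma> \<Gamma> \<Delta>" "sb_val U \<sigma> \<Gamma> \<Delta> I I'"
  shows "interp U \<Delta> (sb \<sigma> t) I' = interp U \<Gamma> t I"
  using assms
proof (induction arbitrary: \<Delta> \<sigma> I I' rule: has_ty.induct)
  case (Var \<Gamma> s n A)
  then have *: "has_ty \<Delta> (\<sigma> s n) (sb \<sigma> A)" "tg (\<sigma> s n) = s" by (auto simp: sb_ok_def good_def)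
  show ?case
  proof (cases s)
    case Star
    then show ?thesis
      using interp_Star[OF Var.prems(1) has_ty.Var[OF Var.hyps(1)], of U I] interp_Star[OF Var.prems(2) *(1), of U I'] * by simp
  next
    case Dia
    then show ?thesis using Var by (auto simp: interp_Var sb_val_def)
  qed
next
  case (Pi_Type \<Gamma> A q s B i)
  have ty: "has_ty \<Gamma> (Pi s A B) (Srt (max_Type q i))" using Pi_Type.hyps by (rule has_ty.Pi_Type)
  then have ty': "has_ty \<Delta> (Pi s (sb \<sigma> A) (sb (ups s \<sigma>) B)) (Srt (max_Type q i))"
    using has_ty_sb[OF ty Pi_Type.prems(3)] by simp
  have wf: "wfc ((s, A) # \<Gamma>)" "wfc ((s, sb \<sigma> A) # \<Delta>)"
    using Pi_Type has_ty_sb[OF Pi_Type.hyps(1) Pi_Type.prems(3)] by auto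
  show ?case
    using Pi_Type.IH(1)[OF Pi_Type.prems]
      Pi_Type.IH(2)[OF wf sb_ok_ups[OF Pi_Type.prems(3)] sb_val_upd[OF Pi_Type.prems(4,3,2) wf(2)]]
    by (simp add: interp_Pi[OF Pi_Type.prems(1) ty] interp_Pi[OF Pi_Type.prems(2) ty'])
next
  case (Pi_Prop \<Gamma> A q s B)
  have ty: "has_ty \<Gamma> (Pi s A B) (Srt Prop)" using Pi_Prop.hyps by (rule has_ty.Pi_Prop)
  then have ty': "has_ty \<Delta> (Pi s (sb \<sigma> A) (sb (ups s \<sigma>) B)) (Srt Prop)"
    using has_ty_sb[OF ty Pi_Prop.prems(3)] by simp
  have wf: "wfc ((s, A) # \<Gamma>)" "wfc ((s, sb \<sigma> A) # \<Delta>)"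
    using Pi_Prop has_ty_sb[OF Pi_Prop.hyps(1) Pi_Prop.prems(3)] by auto
  show ?case
    using Pi_Prop.IH(1)[OF Pi_Prop.prems]
      Pi_Prop.IH(2)[OF wf sb_ok_ups[OF Pi_Prop.prems(3)] sb_val_upd[OF Pi_Prop.prems(4,3,2) wf(2)]]
    by (simp add: interp_Pi[OF Pi_Prop.prems(1) ty] interp_Pi[OF Pi_Prop.prems(2) ty'])
next
  case (Lam \<Gamma> A q s t B)
  have ty: "has_ty \<Gamma> (Lam s A t) (Pi s A B)" using Lam.hyps by (rule has_ty.Lam)
  then have ty': "has_ty \<Delta> (Lam s (sb \<sigma> A) (sb (ups s \<sigma>) t)) (sb \<sigma> (Pi s A B))"
    using has_ty_sb[OF ty Lam.prems(3)] by simp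
  have wf: "wfc ((s, A) # \<Gamma>)" "wfc ((s, sb \<sigma> A) # \<Delta>)"
    using Lam has_ty_sb[OF Lam.hyps(1) Lam.prems(3)] by auto
  have [simp]: "tg (sb (ups s \<sigma>) t) = tg t" using sb_ok_good[OF Lam.prems(3)] by (simp add: good_ups)
  show ?case
  proof (cases "tg t")
    case Star
    then show ?thesis by (simp add: interp_Star[OF Lam.prems(1) ty] interp_Star[OF Lam.prems(2) ty'])
  next
    case Dia
    then show ?thesis
      using Lam.IH(1)[OF Lam.prems] Lam.IH(2)[OF wf sb_ok_ups[OF Lam.prems(3)] sb_val_upd[OF Lam.prems(4,3,2) wf(2)]]
      by (simp add: interp_Lam[OF Lam.prems(1) ty] interp_Lam[OF Lam.prems(2) ty'])
  qed
next
  case (App \<Gamma> t s A B u)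
  have ty: "has_ty \<Gamma> (App t u) (sb (single s u) B)" using App.hyps by (rule has_ty.App)
  then have ty': "has_ty \<Delta> (App (sb \<sigma> t) (sb \<sigma> u)) (sb \<sigma> (sb (single s u) B))"
    using has_ty_sb[OF ty App.prems(3)] by simp
  have [simp]: "tg (sb \<sigma> t) = tg t" using sb_ok_good[OF App.prems(3)] by simp
  show ?case
  proof (cases "tg t")
    case Star
    then show ?thesis by (simp add: interp_Star[OF App.prems(1) ty] interp_Star[OF App.prems(2) ty'])
  next
    case Dia
    then show ?thesis using App.IH(1)[OF App.prems] App.IH(2)[OF App.prems]
      by (simp add: interp_App[OF App.prems(1) ty] interp_App[OF App.prems(2) ty'])
  qed
next
  case (Sig \<Gamma> A i B q s)
  have ty: "has_ty \<Gamma> (Sig s Dia A B) (Srt (Type i))" using Sig.hyps by (rule has_ty.Sig)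
  then have ty': "has_ty \<Delta> (Sig s Dia (sb \<sigma> A) (sb (ups Dia \<sigma>) B)) (Srt (Type i))"
    using has_ty_sb[OF ty Sig.prems(3)] by simp
  have wf: "wfc ((Dia, A) # \<Gamma>)" "wfc ((Dia, sb \<sigma> A) # \<Delta>)"
    using Sig.prems Sig.hyps(1) has_ty_sb[OF Sig.hyps(1) Sig.prems(3)] by (auto intro!: exI[of _ "Type i"])
  show ?case
    using Sig.IH(1)[OF Sig.prems] Sig.IH(2)[OF wf sb_ok_ups[OF Sig.prems(3)] sb_val_upd[OF Sig.prems(4,3,2) wf(2)]]
    by (simp add: interp_Sig[OF Sig.prems(1) ty] interp_Sig[OF Sig.prems(2) ty'])
next
  case (Pair \<Gamma> a A b r B s i)
  have ty: "has_ty \<Gamma> (Pair s r A B a b) (Sig s r A B)" using Pair.hyps by (rule has_ty.Pair)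
  then have ty': "has_ty \<Delta> (Pair s r (sb \<sigma> A) (sb (ups r \<sigma>) B) (sb \<sigma> a) (sb \<sigma> b)) (sb \<sigma> (Sig s r A B))"
    using has_ty_sb[OF ty Pair.prems(3)] by simp
  show ?case using Pair.IH(1)[OF Pair.prems] Pair.IH(2)[OF Pair.prems]
    by (simp add: interp_Pair[OF Pair.prems(1) ty] interp_Pair[OF Pair.prems(2) ty'])
next
  case (Fst \<Gamma> t s r A B)
  have ty: "has_ty \<Gamma> (Fst t) A" using Fst.hyps by (rule has_ty.Fst)
  then have ty': "has_ty \<Delta> (Fst (sb \<sigma> t)) (sb \<sigma> A)"
    using has_ty_sb[OF ty Fst.prems(3)] by simp
  show ?case using Fst.IH(1)[OF Fst.prems]
    by (simp add: interp_Fst[OF Fst.prems(1) ty] interp_Fst[OF Fst.prems(2) ty'])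
next
  case (Snd \<Gamma> t s r A B i q)
  have ty: "has_ty \<Gamma> (Snd s t) (sb (single r (Fst t)) B)" using Snd.hyps by (rule has_ty.Snd)
  then have ty': "has_ty \<Delta> (Snd s (sb \<sigma> t)) (sb \<sigma> (sb (single r (Fst t)) B))"
    using has_ty_sb[OF ty Snd.prems(3)] by simp
  show ?case
  proof (cases s)
    case Star
    then show ?thesis using interp_Star[OF Snd.prems(1) ty, of U I] interp_Star[OF Snd.prems(2) ty', of U I'] by simp
  next
    case Dia
    then show ?thesis using Snd.IH(1)[OF Snd.prems] ty ty' Snd.prems by (simp add: interp_Snd)
  qed
qed simp_all

lemma interp_single:
  assumes "has_ty ((s, A) # \<Gamma>) t T" "wfc ((s, A) # \<Gamma>)" "has_ty \<Gamma> u A" "tg u = s" "interp U \<Gamma> u I = Some y"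
  shows "interp U \<Gamma> (sb (single s u) t) I = interp U ((s, A) # \<Gamma>) t (upd s y I)"
proof (rule interp_sb[OF assms(1,2) _ sb_ok_single[OF assms(3,4)]])
  show "wfc \<Gamma>" using assms(2) by simp
  show "sb_val U (single s u) ((s, A) # \<Gamma>) \<Gamma> (upd s y I) I"
    unfolding sb_val_def using assms(5) interp_Var[OF \<open>wfc \<Gamma>\<close>] by (auto elim!: lookup_ConsE)
qed

text \<open>The identity is a substitution between the two contexts.\<close>

lemma interp_ctx_conv:
  assumes "has_ty ((s, A) # \<Gamma>) t T" "wfc \<Gamma>" "has_ty \<Gamma> A (Srt q)" "has_ty \<Gamma> A' (Srt q)" "st q = s" "conv A A'"
  shows "interp U ((s, A') # \<Gamma>) t I = interp U ((s, A) # \<Gamma>) t I"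
proof -
  have wf: "wfc ((s, A) # \<Gamma>)" "wfc ((s, A') # \<Gamma>)" using assms by auto
  have "sb_val U Var ((s, A) # \<Gamma>) ((s, A') # \<Gamma>) I I"
    unfolding sb_val_def
  proof (intro allI impI)
    fix n B
    assume "lookup ((s, A) # \<Gamma>) Dia n B"
    then obtain B' where "lookup ((s, A') # \<Gamma>) Dia n B'"
      by (cases rule: lookup_ConsE) (auto intro: lookup_here lookup_there)
    then show "interp U ((s, A') # \<Gamma>) (Var Dia n) I = Some (I Dia n)" by (rule interp_Var[OF wf(2)])
  qed
  then show ?thesis using interp_sb[OF assms(1) wf sb_ok_conv[OF assms(3-6)]] by simp
qed

subsection \<open>Invariance under reduction\<close>

lemma interp_beta:
  assumes "has_ty \<Gamma> t T" "wfc \<Gamma>" "beta t t'" "interp U \<Gamma> t I = Some x"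
  shows "interp U \<Gamma> t' I = Some x"
proof -
  \<comment> \<open>For a proof the kind of step is irrelevant: subject reduction types the reduct,
    its tag is again \<open>Star\<close>, and both values are the empty set.\<close>
  have proofs: "interp U \<Gamma> t' I = Some x"
    if "has_ty \<Gamma> t T" "wfc \<Gamma>" "beta t t'" "interp U \<Gamma> t I = Some x" "tg t = Star" for \<Gamma> t T t' I x
    using interp_Star[OF that(2,1,5), of U I] interp_Star[OF that(2) subject_reduction[OF that(1,2,3)], of U I]
      that(4,5) beta_tg[OF that(3)] by simp
  show ?thesis using assms
  proof (induction arbitrary: t' I x rule: has_ty.induct)
    case (Pi_Type \<Gamma> A q s B i)
    have ty: "has_ty \<Gamma> (Pi s A B) (Srt (max_Type q i))" using Pi_Type.hyps by (rule has_ty.Pi_Type)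
    note ty' = subject_reduction[OF ty Pi_Type.prems(1,2)]
    have wf: "wfc ((s, A) # \<Gamma>)" using Pi_Type by auto
    note x = Pi_Type.prems(3)[unfolded interp_Pi[OF Pi_Type.prems(1) ty]]
    from Pi_Type.prems(2) show ?case
    proof (rule beta_PiE)
      fix A' assume *: "t' = Pi s A' B" "beta A A'"
      have A': "has_ty \<Gamma> A' (Srt q)" using subject_reduction Pi_Type * by blast
      note [simp] = interp_ctx_conv[OF Pi_Type.hyps(3) Pi_Type.prems(1) Pi_Type.hyps(1) A' Pi_Type.hyps(2) conv_beta[OF *(2)]]
      show ?thesis using *(1) ty' Pi_Type.IH(1)[OF Pi_Type.prems(1) *(2)]
        by (auto simp: interp_Pi[OF Pi_Type.prems(1)] intro!: over_mono[OF x pi_op_in])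
    next
      fix B' assume *: "t' = Pi s A B'" "beta B B'"
      show ?thesis using *(1) ty' Pi_Type.IH(2)[OF wf *(2)]
        by (auto simp: interp_Pi[OF Pi_Type.prems(1)] intro!: over_mono[OF x pi_op_in])
    qed simp
  next
    case (Pi_Prop \<Gamma> A q s B)
    have ty: "has_ty \<Gamma> (Pi s A B) (Srt Prop)" using Pi_Prop.hyps by (rule has_ty.Pi_Prop)
    note ty' = subject_reduction[OF ty Pi_Prop.prems(1,2)]
    have wf: "wfc ((s, A) # \<Gamma>)" using Pi_Prop by auto
    note x = Pi_Prop.prems(3)[unfolded interp_Pi[OF Pi_Prop.prems(1) ty]]
    from Pi_Prop.prems(2) show ?case
    proof (rule beta_PiE)
      fix A' assume *: "t' = Pi s A' B" "beta A A'"
      have A': "has_ty \<Gamma> A' (Srt q)" using subject_reduction Pi_Prop * by blast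
      note [simp] = interp_ctx_conv[OF Pi_Prop.hyps(3) Pi_Prop.prems(1) Pi_Prop.hyps(1) A' Pi_Prop.hyps(2) conv_beta[OF *(2)]]
      show ?thesis using *(1) ty' Pi_Prop.IH(1)[OF Pi_Prop.prems(1) *(2)]
        by (auto simp: interp_Pi[OF Pi_Prop.prems(1)] intro!: over_mono[OF x pi_op_in])
    next
      fix B' assume *: "t' = Pi s A B'" "beta B B'"
      show ?thesis using *(1) ty' Pi_Prop.IH(2)[OF wf *(2)]
        by (auto simp: interp_Pi[OF Pi_Prop.prems(1)] intro!: over_mono[OF x pi_op_in])
    qed simp
  next
    case (Lam \<Gamma> A q s t B)
    have ty: "has_ty \<Gamma> (Lam s A t) (Pi s A B)" using Lam.hyps by (rule has_ty.Lam)
    note ty' = subject_reduction[OF ty Lam.prems(1,2)]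
    have wf: "wfc ((s, A) # \<Gamma>)" using Lam by auto
    show ?case
    proof (cases "tg t")
      case Star
      then show ?thesis using proofs[OF ty Lam.prems] by simp
    next
      case Dia
      note x = Lam.prems(3)[unfolded interp_Lam[OF Lam.prems(1) ty Dia]]
      from Lam.prems(2) show ?thesis
      proof (rule beta_LamE)
        fix A' assume *: "t' = Lam s A' t" "beta A A'"
        have A': "has_ty \<Gamma> A' (Srt q)" using subject_reduction Lam * by blast
        note [simp] = interp_ctx_conv[OF Lam.hyps(3) Lam.prems(1) Lam.hyps(1) A' Lam.hyps(2) conv_beta[OF *(2)]]
        show ?thesis using *(1) ty' Lam.IH(1)[OF Lam.prems(1) *(2)] Dia
          by (auto simp: interp_Lam[OF Lam.prems(1)] intro!: over_mono[OF x])
      next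
        fix b' assume *: "t' = Lam s A b'" "beta t b'"
        show ?thesis using *(1) ty' Lam.IH(2)[OF wf *(2)] Dia beta_tg[OF *(2)]
          by (auto simp: interp_Lam[OF Lam.prems(1)] intro!: over_mono[OF x])
      qed simp
    qed
  next
    case (App \<Gamma> t s A B u)
    have ty: "has_ty \<Gamma> (App t u) (sb (single s u) B)" using App.hyps by (rule has_ty.App)
    note ty' = subject_reduction[OF ty App.prems(1,2)]
    show ?case
    proof (cases "tg t")
      case Star
      then show ?thesis using proofs[OF ty App.prems] by simp
    next
      case Dia
      from App.prems(3)[unfolded interp_App[OF App.prems(1) ty Dia]] obtain f y where
        x: "interp U \<Gamma> t I = Some f" "interp U \<Gamma> u I = Some y" "is_vfun f" "y \<in> vdom f" "x = vapp f y"
        by (auto split: option.splits if_splits)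
      from App.prems(2) show ?thesis
      proof (rule beta_AppE)
        assume "beta_step (App t u) t'"
        then obtain s' A' b where t: "t = Lam s' A' b" "t' = sb (single s' u) b" "tg u = s'"
          by (auto elim!: beta_step_AppE simp: tag_of_eq)
        then obtain q B' where B': "has_ty \<Gamma> A' (Srt q)" "st q = s" "has_ty ((s, A') # \<Gamma>) b B'" "has_ty \<Gamma> u A'" and s: "s' = s"
          using has_ty_redexD[of \<Gamma> s' A' b s A B u] App.hyps by blast
        \<comment> \<open>The value \<open>y\<close> lies in the domain of \<open>f\<close>, which
          is the value of the annotation \<open>A'\<close>. So the application evaluates to the
          value of the body at \<open>y\<close>, which the substitution lemma identifies with that
          of the contractum.\<close>
        have "interp U \<Gamma> t' I = interp U ((s, A') # \<Gamma>) b (upd s y I)"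
          unfolding t(2) s using interp_single[OF B'(3) wfc_Cons B'(4) App.hyps(3) x(2)] B' App.prems(1) by blast
        moreover have "over vlam (interp U \<Gamma> A' I) (\<lambda>\<alpha>. interp U ((s, A') # \<Gamma>) b (upd s \<alpha> I)) = Some f"
          using x(1) App.hyps(1) Dia t s by (simp add: interp_Lam[OF App.prems(1)])
        ultimately show ?thesis using x(4,5) by (auto simp: over_eq_Some)
      next
        fix t'' assume *: "t' = App t'' u" "beta t t''"
        then show ?thesis using App.IH(1)[OF App.prems(1) *(2) x(1)] x ty' Dia beta_tg[OF *(2)]
          by (simp add: interp_App[OF App.prems(1)])
      next
        fix u' assume *: "t' = App t u'" "beta u u'"
        then show ?thesis using App.IH(2)[OF App.prems(1) *(2) x(2)] x ty' Dia
          by (simp add: interp_App[OF App.prems(1)])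
      qed
    qed
  next
    case (Sig \<Gamma> A i B q s)
    have ty: "has_ty \<Gamma> (Sig s Dia A B) (Srt (Type i))" using Sig.hyps by (rule has_ty.Sig)
    note ty' = subject_reduction[OF ty Sig.prems(1,2)]
    have wf: "wfc ((Dia, A) # \<Gamma>)" using wfc_Cons[OF Sig.prems(1) Sig.hyps(1)] by simp
    note x = Sig.prems(3)[unfolded interp_Sig[OF Sig.prems(1) ty]]
    from Sig.prems(2) show ?case
    proof (rule beta_SigE)
      fix A' assume *: "t' = Sig s Dia A' B" "beta A A'"
      have A': "has_ty \<Gamma> A' (Srt (Type i))" using subject_reduction Sig * by blast
      note [simp] = interp_ctx_conv[OF Sig.hyps(2) Sig.prems(1) Sig.hyps(1) A' st_simps(2) conv_beta[OF *(2)]]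
      show ?thesis using *(1) ty' Sig.IH(1)[OF Sig.prems(1) *(2)]
        by (auto simp: interp_Sig[OF Sig.prems(1)] intro!: over_mono[OF x])
    next
      fix B' assume *: "t' = Sig s Dia A B'" "beta B B'"
      show ?thesis using *(1) ty' Sig.IH(2)[OF wf *(2)]
        by (auto simp: interp_Sig[OF Sig.prems(1)] intro!: over_mono[OF x])
    qed simp
  next
    case (Pair \<Gamma> a A b r B s i)
    have ty: "has_ty \<Gamma> (Pair s r A B a b) (Sig s r A B)" using Pair.hyps by (rule has_ty.Pair)
    note ty' = subject_reduction[OF ty Pair.prems(1,2)]
    from Pair.prems(3)[unfolded interp_Pair[OF Pair.prems(1) ty]] obtain y z where
      x: "interp U \<Gamma> a I = Some y" "interp U \<Gamma> b I = Some z" "x = vpair y z"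
      by (auto split: option.splits)
    from Pair.prems(2) show ?case
      by (rule beta_PairE) (use ty' x Pair.IH(1)[OF Pair.prems(1) _ x(1)] Pair.IH(2)[OF Pair.prems(1) _ x(2)] in
        \<open>auto simp: interp_Pair[OF Pair.prems(1)]\<close>)
  next
    case (Fst \<Gamma> t s r A B)
    have ty: "has_ty \<Gamma> (Fst t) A" using Fst.hyps by (rule has_ty.Fst)
    note ty' = subject_reduction[OF ty Fst.prems(1,2)]
    from Fst.prems(3)[unfolded interp_Fst[OF Fst.prems(1) ty]] obtain y where
      x: "interp U \<Gamma> t I = Some y" "x = vfst y"
      by (auto split: option.splits if_splits)
    from Fst.prems(3)[unfolded interp_Fst[OF Fst.prems(1) ty]] x(1) have y: "is_vpair y"
      by (auto split: if_splits)
    from Fst.prems(2) show ?case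
    proof (rule beta_FstE)
      assume "beta_step (Fst t) t'"
      then obtain p q A' B' b where t: "t = Pair p q A' B' t' b" by (auto elim!: beta_step_FstE)
      then show ?thesis using x Fst.hyps by (auto simp: interp_Pair[OF Fst.prems(1)] split: option.splits)
    next
      fix t'' assume *: "t' = Fst t''" "beta t t''"
      then show ?thesis using Fst.IH[OF Fst.prems(1) *(2) x(1)] x y ty' by (simp add: interp_Fst[OF Fst.prems(1)])
    qed
  next
    case (Snd \<Gamma> t s r A B i q)
    have ty: "has_ty \<Gamma> (Snd s t) (sb (single r (Fst t)) B)" using Snd.hyps by (rule has_ty.Snd)
    note ty' = subject_reduction[OF ty Snd.prems(1,2)]
    show ?case
    proof (cases s)
      case Star
      then show ?thesis using proofs[OF ty Snd.prems] by simp
    next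
      case Dia
      from Snd.prems(3)[unfolded Dia interp_Snd[OF Snd.prems(1) ty[unfolded Dia]]] obtain y where
        x: "interp U \<Gamma> t I = Some y" "x = vsnd y" "is_vpair y"
        by (auto split: option.splits if_splits)
      from Snd.prems(2) show ?thesis
      proof (rule beta_SndE)
        assume "beta_step (Snd s t) t'"
        then obtain p q A' B' a where t: "t = Pair p q A' B' a t'" by (auto elim!: beta_step_SndE)
        then show ?thesis using x Snd.hyps by (auto simp: interp_Pair[OF Snd.prems(1)] split: option.splits)
      next
        fix t'' assume *: "t' = Snd s t''" "beta t t''"
        then show ?thesis using Snd.IH(1)[OF Snd.prems(1) *(2) x(1)] x ty' Dia
          by (simp add: interp_Snd[OF Snd.prems(1)])
      qed
    qed
  qed (auto elim: beta_SrtE beta_VarE)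
qed

lemma interp_beta_rtranclp:
  assumes "beta\<^sup>*\<^sup>* t t'" "has_ty \<Gamma> t T" "wfc \<Gamma>" "interp U \<Gamma> t I = Some x"
  shows "interp U \<Gamma> t' I = Some x"
  using assms(1)
proof (induction rule: rtranclp_induct)
  case (step y z)
  then show ?case using interp_beta subject_reduction_rtranclp[OF step(1)] assms(2,3) by blast
qed (rule assms(4))

subsection \<open>Proof irrelevance and monotonicity\<close>

abbreviation erase_ctx :: "ctx \<Rightarrow> ctx" where
  "erase_ctx \<equiv> map (\<lambda>d. (fst d, extr (snd d)))"

lemma norm_if_erase_eq: "extr t = extr t' \<Longrightarrow> norm t = norm t'"
  by (metis norm_erase)

lemma norm_ctx_if_erase_eq:
  assumes "erase_ctx \<Gamma> = erase_ctx \<Gamma>'"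
  shows "norm_ctx \<Gamma> = norm_ctx \<Gamma>'"
proof -
  have "norm_ctx \<Gamma> = norm_ctx (erase_ctx \<Gamma>)" for \<Gamma>
    by (simp add: erase_erase)
  from this[of \<Gamma>] this[of \<Gamma>'] show ?thesis using assms by simp
qed

lemma lookup_erase_ctx: "lookup \<Gamma> s n A \<Longrightarrow> erase_ctx \<Gamma> = erase_ctx \<Gamma>' \<Longrightarrow> \<exists>A'. lookup \<Gamma>' s n A'"
proof (induction arbitrary: \<Gamma>' rule: lookup.induct)
  case (here s A \<Gamma>)
  then obtain B \<Delta> where "\<Gamma>' = (s, B) # \<Delta>" by (cases \<Gamma>') auto
  then show ?case using lookup_here by blast
next
  case (there \<Gamma> s n A r B)
  then obtain C \<Delta> where "\<Gamma>' = (r, C) # \<Delta>" "erase_ctx \<Gamma> = erase_ctx \<Delta>" by (cases \<Gamma>') auto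
  then show ?case using there.IH lookup_there unfolding under_eq_shf by blast
qed

text \<open>Proof irrelevance of the model: terms with equal extractions differ only in proofs, all
  of which denote the empty set. The contexts vary as well, since annotations of binders may contain
  different proofs. The two typings are unrelated, so the induction is on the term.\<close>

lemma interp_erase:
  assumes "has_ty \<Gamma> t T" "has_ty \<Gamma>' t' T'" "extr t = extr t'" "erase_ctx \<Gamma> = erase_ctx \<Gamma>'"
    "wfc \<Gamma>" "wfc \<Gamma>'"
  shows "interp U \<Gamma> t I = interp U \<Gamma>' t' I"
proof -
  have proofs: "interp U \<Gamma> t I = interp U \<Gamma>' t' I"
    if "has_ty \<Gamma> t T" "has_ty \<Gamma>' t' T'" "extr t = extr t'" "erase_ctx \<Gamma> = erase_ctx \<Gamma>'"
      "wfc \<Gamma>" "wfc \<Gamma>'" "tg t = Star" for \<Gamma> t T \<Gamma>' t' T' I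
  proof -
    have "tg t' = Star" using that(3,7) tg_erase by metis
    then show ?thesis
      using interp_Star[OF that(5,1,7), of U I] interp_Star[OF that(6,2), of U I] by simp
  qed
  show ?thesis using assms
  proof (induction t arbitrary: \<Gamma> T \<Gamma>' t' T' I)
    case (Srt q)
    then have "t' = Srt q" by (auto dest!: erase_eq_SrtD[OF sym])
    with Srt show ?case by simp
  next
    case (Var s n)
    show ?case
    proof (cases s)
      case Dia
      then have t': "t' = Var Dia n" using Var(3) by (auto dest!: erase_eq_VarD[OF sym])
      obtain A where A: "lookup \<Gamma> Dia n A" using Var(1) Dia has_ty_VarD by blast
      obtain A' where "lookup \<Gamma>' Dia n A'" using lookup_erase_ctx[OF A Var(4)] by blast
      then show ?thesis using A Dia t' Var(5,6) by (simp add: interp_Var)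
    qed (use proofs[OF Var] in simp)
  next
    case (Lam s A b)
    show ?case
    proof (cases "tg b")
      case Dia
      then obtain A' b' where t': "t' = Lam s A' b'" "extr A' = extr A" "extr b' = extr b" "tg b' = Dia"
        using Lam.prems(3) by (auto dest!: erase_eq_LamD[OF sym])
      obtain q B where ty: "has_ty \<Gamma> A (Srt q)" "st q = s" "has_ty ((s, A) # \<Gamma>) b B"
        using Lam.prems(1) has_ty_LamD by blast
      obtain q' B' where ty': "has_ty \<Gamma>' A' (Srt q')" "st q' = s" "has_ty ((s, A') # \<Gamma>') b' B'"
        using Lam.prems(2) t'(1) has_ty_LamD by blast
      have wf: "wfc ((s, A) # \<Gamma>)" "wfc ((s, A') # \<Gamma>')" using ty ty' Lam.prems by auto
      have "erase_ctx ((s, A) # \<Gamma>) = erase_ctx ((s, A') # \<Gamma>')" using Lam.prems(4) t'(2) by simp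
      then show ?thesis
        using Lam.IH(1)[OF ty(1) ty'(1) t'(2)[symmetric] Lam.prems(4-6)] Lam.IH(2)[OF ty(3) ty'(3) t'(3)[symmetric] _ wf]
          interp_Lam[OF Lam.prems(5,1) Dia, of U I] interp_Lam[OF Lam.prems(6,2)[unfolded t'(1)] t'(4), of U I]
        unfolding t'(1) by simp
    qed (use proofs[OF Lam.prems] in simp)
  next
    case (App f u)
    show ?case
    proof (cases "tg f")
      case Dia
      then obtain f' u' where t': "t' = App f' u'" "extr f = extr f'" "extr u = extr u'"
        using App.prems(3) by (auto dest!: erase_eq_AppD[OF sym])
      then have "tg f' = Dia" using Dia tg_erase by metis
      moreover obtain P A where "has_ty \<Gamma> f P" "has_ty \<Gamma> u A"
        using App.prems(1) has_ty_AppD by blast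
      moreover obtain P' A' where "has_ty \<Gamma>' f' P'" "has_ty \<Gamma>' u' A'"
        using App.prems(2) t'(1) has_ty_AppD by blast
      ultimately show ?thesis
        using App.IH(1)[OF _ _ t'(2) App.prems(4-6)] App.IH(2)[OF _ _ t'(3) App.prems(4-6)]
          interp_App[OF App.prems(5,1) Dia, of U I] interp_App[OF App.prems(6,2)[unfolded t'(1)], of U I]
        unfolding t'(1) by simp
    qed (use proofs[OF App.prems] in simp)
  next
    case (Pi s A B)
    then obtain A' B' where t': "t' = Pi s A' B'" "extr A = extr A'" "extr B = extr B'"
      by (auto dest!: erase_eq_PiD[OF sym])
    obtain q p where ty: "has_ty \<Gamma> A (Srt q)" "st q = s" "has_ty ((s, A) # \<Gamma>) B (Srt p)"
      using Pi.prems(1) has_ty_PiD by blast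
    obtain q' p' where ty': "has_ty \<Gamma>' A' (Srt q')" "st q' = s" "has_ty ((s, A') # \<Gamma>') B' (Srt p')"
      using Pi.prems(2) t'(1) has_ty_PiD by blast
    note pi = has_ty_Pi[OF ty] has_ty_Pi[OF ty']
    \<comment> \<open>Uniqueness of sorts ensures that both products are intersections or both are
      function spaces.\<close>
    have "st (pi_sort q p) = st (pi_sort q' p')"
      using unique_sort[OF pi norm_ctx_if_erase_eq[OF Pi.prems(4)] norm_if_erase_eq Pi.prems(5,6)] Pi.prems(3) t'(1) by blast
    then have "pi_op (pi_sort q p) = (pi_op (pi_sort q' p') :: 'a \<Rightarrow> _)" by (simp add: pi_op_def)
    moreover have wf: "wfc ((s, A) # \<Gamma>)" "wfc ((s, A') # \<Gamma>')" using ty ty' Pi.prems by auto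
    moreover have "erase_ctx ((s, A) # \<Gamma>) = erase_ctx ((s, A') # \<Gamma>')" using Pi.prems(4) t'(2) by simp
    ultimately show ?case
      using Pi.IH(1)[OF ty(1) ty'(1) t'(2) Pi.prems(4-6)] Pi.IH(2)[OF ty(3) ty'(3) t'(3) _ wf]
        interp_Pi[OF Pi.prems(5) pi(1), of U I] interp_Pi[OF Pi.prems(6) pi(2), of U I]
      unfolding t'(1) by simp
  next
    case (Sig q s A B)
    then obtain A' B' where t': "t' = Sig q s A' B'" "extr A = extr A'" "extr B = extr B'"
      by (auto dest!: erase_eq_SigD[OF sym])
    obtain i p where ty: "has_ty \<Gamma> A (Srt (Type i))" "has_ty ((s, A) # \<Gamma>) B (Srt p)" "s = Dia"
      using Sig.prems(1) has_ty_SigD by blast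
    obtain i' p' where ty': "has_ty \<Gamma>' A' (Srt (Type i'))" "has_ty ((s, A') # \<Gamma>') B' (Srt p')"
      using Sig.prems(2) t'(1) has_ty_SigD by blast
    have wf: "wfc ((s, A) # \<Gamma>)" "wfc ((s, A') # \<Gamma>')"
      using wfc_Cons[OF Sig.prems(5) ty(1)] wfc_Cons[OF Sig.prems(6) ty'(1)] ty(3) by simp_all
    moreover have "erase_ctx ((s, A) # \<Gamma>) = erase_ctx ((s, A') # \<Gamma>')" using Sig.prems(4) t'(2) by simp
    ultimately show ?case
      using Sig.IH(1)[OF ty(1) ty'(1) t'(2) Sig.prems(4-6)] Sig.IH(2)[OF ty(2) ty'(2) t'(3) _ wf]
        interp_Sig[OF Sig.prems(5,1), of U I] interp_Sig[OF Sig.prems(6,2)[unfolded t'(1)], of U I]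
      unfolding t'(1) by simp
  next
    case (Pair q s A B a b)
    then obtain A' B' a' b' where t': "t' = Pair q s A' B' a' b'" "extr a' = extr a" "extr b' = extr b"
      by (auto dest!: erase_eq_PairD[OF sym])
    obtain P Q where "has_ty \<Gamma> a P" "has_ty \<Gamma> b Q" using Pair.prems(1) has_ty_PairD by blast
    moreover obtain P' Q' where "has_ty \<Gamma>' a' P'" "has_ty \<Gamma>' b' Q'"
      using Pair.prems(2) t'(1) has_ty_PairD by blast
    ultimately show ?case
      using Pair.IH(3)[OF _ _ t'(2)[symmetric] Pair.prems(4-6)] Pair.IH(4)[OF _ _ t'(3)[symmetric] Pair.prems(4-6)]
        interp_Pair[OF Pair.prems(5,1), of U I] interp_Pair[OF Pair.prems(6,2)[unfolded t'(1)], of U I]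
      unfolding t'(1) by simp
  next
    case (Fst p)
    then obtain p' where t': "t' = Fst p'" "extr p = extr p'"
      by (auto dest!: erase_eq_FstD[OF sym])
    obtain P where "has_ty \<Gamma> p P" using Fst.prems(1) has_ty_FstD by blast
    moreover obtain P' where "has_ty \<Gamma>' p' P'" using Fst.prems(2) t'(1) has_ty_FstD by blast
    ultimately show ?case
      using Fst.IH[OF _ _ t'(2) Fst.prems(4-6)]
        interp_Fst[OF Fst.prems(5,1), of U I] interp_Fst[OF Fst.prems(6,2)[unfolded t'(1)], of U I]
      unfolding t'(1) by simp
  next
    case (Snd q p)
    show ?case
    proof (cases q)
      case Dia
      then obtain p' where t': "t' = Snd Dia p'" "extr p = extr p'"
        using Snd.prems(3) by (auto dest!: erase_eq_SndD[OF sym])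
      obtain P where "has_ty \<Gamma> p P" using Snd.prems(1) has_ty_SndD by blast
      moreover obtain P' where "has_ty \<Gamma>' p' P'" using Snd.prems(2) t'(1) has_ty_SndD by blast
      ultimately show ?thesis
        using Snd.IH[OF _ _ t'(2) Snd.prems(4-6)] Dia
          interp_Snd[OF Snd.prems(5,1)[unfolded Dia], of U I] interp_Snd[OF Snd.prems(6,2)[unfolded t'(1)], of U I]
        unfolding t'(1) by simp
    qed (use proofs[OF Snd.prems] in simp)
  qed (simp add: gen_Eps)
qed

text \<open>Domains have equal extractions, hence equal values, and only codomains grow. Two
  contexts occur because the domains agree only up to extraction.\<close>

lemma interp_le:
  assumes "le (extr v) (extr w)" "has_ty \<Gamma> v (Srt q)" "has_ty \<Gamma>' w (Srt q')"
    "erase_ctx \<Gamma> = erase_ctx \<Gamma>'" "wfc \<Gamma>" "wfc \<Gamma>'" "universes U"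
    "interp U \<Gamma> v I = Some a" "interp U \<Gamma>' w I = Some b"
  shows "elts a \<subseteq> elts b"
  using assms
proof (induction "extr v" "extr w" arbitrary: v w \<Gamma> \<Gamma>' q q' I a b rule: le.induct)
  case Refl
  then show ?case using interp_erase[OF Refl(2,3,1,4,5,6), of U I] by simp
next
  case (Type i j)
  then have "v = Srt (Type i)" "w = Srt (Type j)" by (auto dest!: erase_eq_SrtD[OF sym])
  then show ?case using Type universes_mono[of U i j] by auto
next
  case (Pi C C' s D)
  obtain A B where v: "v = Pi s A B" "D = extr A" "C = extr B" using erase_eq_PiD[OF Pi(3)[symmetric]] by blast
  obtain A' B' where w: "w = Pi s A' B'" "D = extr A'" "C' = extr B'" using erase_eq_PiD[OF Pi(4)[symmetric]] by blast
  obtain r p where ty: "has_ty \<Gamma> A (Srt r)" "st r = s" "has_ty ((s, A) # \<Gamma>) B (Srt p)"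
    using Pi.prems(1) v has_ty_PiD by blast
  obtain r' p' where ty': "has_ty \<Gamma>' A' (Srt r')" "st r' = s" "has_ty ((s, A') # \<Gamma>') B' (Srt p')"
    using Pi.prems(2) w has_ty_PiD by blast
  note pi = has_ty_Pi[OF ty] has_ty_Pi[OF ty']
  have A: "interp U \<Gamma> A I = interp U \<Gamma>' A' I"
    using interp_erase[OF ty(1) ty'(1) _ Pi.prems(3-5)] v w by simp
  have wf: "wfc ((s, A) # \<Gamma>)" "wfc ((s, A') # \<Gamma>')" using ty ty' Pi.prems by auto
  have ctx: "erase_ctx ((s, A) # \<Gamma>) = erase_ctx ((s, A') # \<Gamma>')" using Pi.prems(3) v w by simp
  have "norm B = norm B'" using le_norm[OF Pi(1)] v w by simp
  moreover have "norm A = norm A'" using v w by (metis norm_erase)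
  ultimately have "st (pi_sort r p) = st (pi_sort r' p')"
    using unique_sort[OF pi norm_ctx_if_erase_eq[OF Pi.prems(3)] _ Pi.prems(4,5)] by simp
  then have op: "pi_op (pi_sort r p) = (pi_op (pi_sort r' p') :: 'a \<Rightarrow> _)" by (simp add: pi_op_def)
  define F where "F \<alpha> = interp U ((s, A) # \<Gamma>) B (upd s \<alpha> I)" for \<alpha>
  define G where "G \<alpha> = interp U ((s, A') # \<Gamma>') B' (upd s \<alpha> I)" for \<alpha>
  have "over (pi_op (pi_sort r p)) (interp U \<Gamma> A I) F = Some a"
    using Pi.prems(7) interp_Pi[OF Pi.prems(4) pi(1), of U I] v by (simp add: F_def[abs_def])
  moreover have "over (pi_op (pi_sort r p)) (interp U \<Gamma> A I) G = Some b"
    using Pi.prems(8) interp_Pi[OF Pi.prems(5) pi(2), of U I] w op A by (simp add: G_def[abs_def])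
  ultimately obtain x where x: "\<forall>\<alpha>\<in>elts x. F \<alpha> \<noteq> None" "\<forall>\<alpha>\<in>elts x. G \<alpha> \<noteq> None"
    "a = pi_op (pi_sort r p) x (\<lambda>\<alpha>. the (F \<alpha>))" "b = pi_op (pi_sort r p) x (\<lambda>\<alpha>. the (G \<alpha>))"
    by (auto simp: over_eq_Some)
  have "elts (the (F \<alpha>)) \<subseteq> elts (the (G \<alpha>))" if "\<alpha> \<in> elts x" for \<alpha>
    using Pi.hyps(2)[OF v(3) w(3) ty(3) ty'(3) ctx wf Pi.prems(6)] x(1,2) that by (auto simp: F_def G_def)
  then have "elts (vPi x (\<lambda>\<alpha>. the (F \<alpha>))) \<subseteq> elts (vPi x (\<lambda>\<alpha>. the (G \<alpha>)))"
    "elts (vInter x (\<lambda>\<alpha>. the (F \<alpha>))) \<subseteq> elts (vInter x (\<lambda>\<alpha>. the (G \<alpha>)))"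
    by (auto intro!: vPi_mono vInter_mono)
  then show ?case unfolding x(3,4) pi_op_def by simp
qed

lemma interp_subtype:
  assumes "A \<preceq> B" "has_ty \<Gamma> A (Srt q)" "has_ty \<Gamma> B (Srt q')" "wfc \<Gamma>" "universes U"
    "interp U \<Gamma> A I = Some a" "interp U \<Gamma> B I = Some b"
  shows "elts a \<subseteq> elts b"
proof -
  obtain v w where *: "beta\<^sup>*\<^sup>* A v" "beta\<^sup>*\<^sup>* B w" "le (extr v) (extr w)"
    using subtype_lift[OF assms(1)] by blast
  show ?thesis
    using interp_le[OF *(3) subject_reduction_rtranclp[OF *(1) assms(2,4)]
        subject_reduction_rtranclp[OF *(2) assms(3,4)] refl assms(4,4,5)
        interp_beta_rtranclp[OF *(1) assms(2,4,6)] interp_beta_rtranclp[OF *(2) assms(3,4,7)]] .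
qed

subsection \<open>Soundness\<close>

text \<open>
  The interpretation of a proof variable is \<open>\<emptyset>\<close> whatever the valuation says, hence the last conjunct.
\<close>

definition sound_ctx :: "(nat \<Rightarrow> 'v::zf) \<Rightarrow> ctx \<Rightarrow> bool" where
  "sound_ctx U \<Gamma> \<longleftrightarrow> (\<forall>I. valid U \<Gamma> I \<longrightarrow> (\<forall>s n A. lookup \<Gamma> s n A \<longrightarrow>
     (\<exists>a. interp U \<Gamma> A I = Some a \<and> I s n \<in> elts a \<and> (s = Star \<longrightarrow> I s n = vempty))))"

definition sound :: "(nat \<Rightarrow> 'v::zf) \<Rightarrow> ctx \<Rightarrow> tm \<Rightarrow> tm \<Rightarrow> bool" where
  "sound U \<Gamma> t T \<longleftrightarrow> (\<forall>I. valid U \<Gamma> I \<longrightarrow>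
     (\<exists>x X. interp U \<Gamma> t I = Some x \<and> interp U \<Gamma> T I = Some X \<and> x \<in> elts X))"

lemma valid_upd: "valid U \<Gamma> I \<Longrightarrow> interp U \<Gamma> A I = Some a \<Longrightarrow> \<alpha> \<in> elts a \<Longrightarrow> valid U ((s, A) # \<Gamma>) (upd s \<alpha> I)"
  by simp

lemma sound_ctx_Cons:
  assumes "wfc \<Gamma>" "has_ty \<Gamma> A (Srt q)" "st q = s" "sound_ctx U \<Gamma>" "sound U \<Gamma> A (Srt q)"
  shows "sound_ctx U ((s, A) # \<Gamma>)"
  unfolding sound_ctx_def
proof (intro allI impI)
  fix I r n B
  assume I: "valid U ((s, A) # \<Gamma>) I" and "lookup ((s, A) # \<Gamma>) r n B"
  then obtain a where a: "valid U \<Gamma> (tail s I)" "interp U \<Gamma> A (tail s I) = Some a" "I s 0 \<in> elts a" by auto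
  have wf: "wfc ((s, A) # \<Gamma>)" using assms by auto
  have lift: "interp U ((s, A) # \<Gamma>) (ren (shf s) C) I = interp U \<Gamma> C (tail s I)" if "has_ty \<Gamma> C P" for C P
    by (rule interp_ren[OF that assms(1) wf ren_ok_shf]) (simp add: ren_val_def tail_def under_eq_shf)
  from \<open>lookup ((s, A) # \<Gamma>) r n B\<close>
  show "\<exists>a. interp U ((s, A) # \<Gamma>) B I = Some a \<and> I r n \<in> elts a \<and> (r = Star \<longrightarrow> I r n = vempty)"
  proof (cases rule: lookup_ConsE)
    case 1
    \<comment> \<open>The type of a proof variable has a truth value, whose only possible member is
      the empty set; this is where soundness of the declared type enters.\<close>
    have "I s 0 = vempty" if "s = Star"
    proof -
      have "q = Prop" using that assms(3) by (cases q) auto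
      then have "a \<in> elts vbool" using assms(1,5) a(1,2) by (auto simp: sound_def)
      then show ?thesis using a(3) by (auto simp: vbool_iff)
    qed
    then show ?thesis using 1 a lift[OF assms(2)] by simp
  next
    case (2 m C)
    obtain p where "has_ty \<Gamma> C (Srt p)" using lookup_has_ty[OF 2(3) assms(1)] by blast
    from lift[OF this] show ?thesis
      using 2 assms(4) a(1) unfolding sound_ctx_def by (fastforce simp: tail_def under_eq_shf)
  qed
qed

lemma soundD:
  assumes "sound U \<Gamma> t T" "valid U \<Gamma> I"
  obtains x X where "interp U \<Gamma> t I = Some x" "interp U \<Gamma> T I = Some X" "x \<in> elts X"
  using assms by (auto simp: sound_def)

text \<open>Choice turns the values that exist at each point of \<open>a\<close> into functions
  \<open>F\<close> and \<open>G\<close>, the form expected by \<open>over_Some\<close>.\<close>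

lemma sound_familyD:
  assumes "sound U \<Gamma> A (Srt q)" "sound U ((s, A) # \<Gamma>) t T" "valid U \<Gamma> I" "wfc \<Gamma>"
  obtains a F G where "interp U \<Gamma> A I = Some a" "a \<in> elts (srt_set U q)"
    "\<And>\<alpha>. \<alpha> \<in> elts a \<Longrightarrow> interp U ((s, A) # \<Gamma>) t (upd s \<alpha> I) = Some (F \<alpha>)"
    "\<And>\<alpha>. \<alpha> \<in> elts a \<Longrightarrow> interp U ((s, A) # \<Gamma>) T (upd s \<alpha> I) = Some (G \<alpha>)"
    "\<And>\<alpha>. \<alpha> \<in> elts a \<Longrightarrow> F \<alpha> \<in> elts (G \<alpha>)"
proof -
  obtain a where a: "interp U \<Gamma> A I = Some a" "a \<in> elts (srt_set U q)"
    using assms(1,3,4) by (auto elim: soundD)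
  have "\<exists>x X. interp U ((s, A) # \<Gamma>) t (upd s \<alpha> I) = Some x \<and> interp U ((s, A) # \<Gamma>) T (upd s \<alpha> I) = Some X \<and> x \<in> elts X"
    if "\<alpha> \<in> elts a" for \<alpha>
    using assms(2) valid_upd[OF assms(3) a(1) that] by (auto simp: sound_def)
  then show ?thesis using that[OF a] by metis
qed

lemma over_Some:
  assumes "op \<in> {vlam, vPi, vSigma, vInter}" "\<And>\<alpha>. \<alpha> \<in> elts a \<Longrightarrow> F \<alpha> = Some (G \<alpha>)"
  shows "over op (Some a) F = Some (op a G)"
proof -
  have "over op (Some a) (\<lambda>\<alpha>. Some (G \<alpha>)) = Some (op a G)" by (simp add: over_def)
  then show ?thesis by (rule over_mono[OF _ assms(1)]) (use assms(2) in auto)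
qed

lemma soundness:
  assumes "has_ty \<Gamma> t T" "wfc \<Gamma>" "sound_ctx U \<Gamma>" "universes U"
  shows "sound U \<Gamma> t T"
  using assms
proof (induction rule: has_ty.induct)
  case (Prop \<Gamma> i)
  then show ?case by (auto simp: sound_def univ_vbool universes_def)
next
  case (Type p \<Gamma> i)
  then show ?case by (auto simp: sound_def universes_mem)
next
  case (Var \<Gamma> s n A)
  show ?case unfolding sound_def
  proof (intro allI impI)
    fix I assume "valid U \<Gamma> I"
    then obtain a where a: "interp U \<Gamma> A I = Some a" "I s n \<in> elts a" "s = Star \<longrightarrow> I s n = vempty"
      using Var unfolding sound_ctx_def by blast
    have "interp U \<Gamma> (Var s n) I = Some (I s n)"
      using a(3) Var.prems(1) Var.hyps interp_Star[OF Var.prems(1) has_ty.Var[OF Var.hyps], of U I]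
      by (cases s) (auto simp: interp_Var)
    then show "\<exists>x X. interp U \<Gamma> (Var s n) I = Some x \<and> interp U \<Gamma> A I = Some X \<and> x \<in> elts X"
      using a by blast
  qed
next
  case (Conv \<Gamma> t A B q)
  show ?case unfolding sound_def
  proof (intro allI impI)
    fix I assume I: "valid U \<Gamma> I"
    obtain x a where x: "interp U \<Gamma> t I = Some x" "interp U \<Gamma> A I = Some a" "x \<in> elts a"
      using Conv.IH(1)[OF Conv.prems] I by (rule soundD)
    obtain b where b: "interp U \<Gamma> B I = Some b" using Conv.IH(2)[OF Conv.prems] I by (rule soundD)
    obtain p where "has_ty \<Gamma> A (Srt p)" using has_ty_sort Conv.hyps(1) Conv.prems(1) by blast
    from interp_subtype[OF Conv.hyps(3) this Conv.hyps(2) Conv.prems(1,3) x(2) b]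
    show "\<exists>x X. interp U \<Gamma> t I = Some x \<and> interp U \<Gamma> B I = Some X \<and> x \<in> elts X"
      using x b by blast
  qed
next
  case (Pi_Type \<Gamma> A q s B i)
  have ty: "has_ty \<Gamma> (Pi s A B) (Srt (max_Type q i))" using Pi_Type.hyps by (rule has_ty.Pi_Type)
  have wf: "wfc ((s, A) # \<Gamma>)" using Pi_Type by auto
  note A = Pi_Type.IH(1)[OF Pi_Type.prems]
  note B = Pi_Type.IH(2)[OF wf sound_ctx_Cons[OF Pi_Type.prems(1) Pi_Type.hyps(1,2) Pi_Type.prems(2) A] Pi_Type.prems(3)]
  show ?case unfolding sound_def
  proof (intro allI impI)
    fix I assume I: "valid U \<Gamma> I"
    obtain a F G where a: "interp U \<Gamma> A I = Some a" "a \<in> elts (srt_set U q)"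
      and F: "\<And>\<alpha>. \<alpha> \<in> elts a \<Longrightarrow> interp U ((s, A) # \<Gamma>) B (upd s \<alpha> I) = Some (F \<alpha>)"
        "\<And>\<alpha>. \<alpha> \<in> elts a \<Longrightarrow> interp U ((s, A) # \<Gamma>) (Srt (Type i)) (upd s \<alpha> I) = Some (G \<alpha>)"
        "\<And>\<alpha>. \<alpha> \<in> elts a \<Longrightarrow> F \<alpha> \<in> elts (G \<alpha>)"
      using sound_familyD[OF A B I Pi_Type.prems(1)] by blast
    have F': "F \<alpha> \<in> elts (U i)" if "\<alpha> \<in> elts a" for \<alpha>
      using F(2,3)[OF that] wf by simp
    \<comment> \<open>A domain in \<open>Prop\<close> has one of two values, which belong to every
      universe, so the level of the codomain suffices; otherwise the larger of the two levels is
      taken.\<close>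
    obtain m where m: "max_Type q i = Type m" "i \<le> m" "elts (srt_set U q) \<subseteq> elts (U m)"
    proof (cases q)
      case Prop
      have "universe (U i)" using Pi_Type.prems(3) by (simp add: universes_def)
      then show ?thesis using that[of i] Prop by (auto simp: elts_vbool univ_vempty univ_vone)
    next
      case (Type j)
      then show ?thesis using that[of "max j i"] universes_mono[OF Pi_Type.prems(3), of j "max j i"] by simp
    qed
    have "vPi a F \<in> elts (U m)"
      using Pi_Type.prems(3) a(2) m(3) F' universes_mono[OF Pi_Type.prems(3) m(2)]
      by (intro univ_vPi) (auto simp: universes_def)
    moreover have "interp U \<Gamma> (Pi s A B) I = Some (vPi a F)"
      unfolding interp_Pi[OF Pi_Type.prems(1) ty] a(1) using F(1) by (simp add: over_Some pi_op_def)
    ultimately show "\<exists>x X. interp U \<Gamma> (Pi s A B) I = Some x \<and> interp U \<Gamma> (Srt (max_Type q i)) I = Some X \<and> x \<in> elts X"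
      using m(1) Pi_Type.prems(1) by simp
  qed
next
  case (Pi_Prop \<Gamma> A q s B)
  have ty: "has_ty \<Gamma> (Pi s A B) (Srt Prop)" using Pi_Prop.hyps by (rule has_ty.Pi_Prop)
  have wf: "wfc ((s, A) # \<Gamma>)" using Pi_Prop by auto
  note A = Pi_Prop.IH(1)[OF Pi_Prop.prems]
  note B = Pi_Prop.IH(2)[OF wf sound_ctx_Cons[OF Pi_Prop.prems(1) Pi_Prop.hyps(1,2) Pi_Prop.prems(2) A] Pi_Prop.prems(3)]
  show ?case unfolding sound_def
  proof (intro allI impI)
    fix I assume I: "valid U \<Gamma> I"
    obtain a F G where a: "interp U \<Gamma> A I = Some a" "a \<in> elts (srt_set U q)"
      and F: "\<And>\<alpha>. \<alpha> \<in> elts a \<Longrightarrow> interp U ((s, A) # \<Gamma>) B (upd s \<alpha> I) = Some (F \<alpha>)"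
        "\<And>\<alpha>. \<alpha> \<in> elts a \<Longrightarrow> interp U ((s, A) # \<Gamma>) (Srt Prop) (upd s \<alpha> I) = Some (G \<alpha>)"
        "\<And>\<alpha>. \<alpha> \<in> elts a \<Longrightarrow> F \<alpha> \<in> elts (G \<alpha>)"
      using sound_familyD[OF A B I Pi_Prop.prems(1)] by blast
    have F': "F \<alpha> \<in> elts vbool" if "\<alpha> \<in> elts a" for \<alpha>
      using F(2,3)[OF that] wf by simp
    have "vInter a F \<in> elts vbool" by (intro vInter_vbool F')
    moreover have "interp U \<Gamma> (Pi s A B) I = Some (vInter a F)"
      unfolding interp_Pi[OF Pi_Prop.prems(1) ty] a(1) using F(1) by (simp add: over_Some pi_op_def)
    ultimately show "\<exists>x X. interp U \<Gamma> (Pi s A B) I = Some x \<and> interp U \<Gamma> (Srt Prop) I = Some X \<and> x \<in> elts X"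
      using Pi_Prop.prems(1) by simp
  qed
next
  case (Lam \<Gamma> A q s t B)
  have ty: "has_ty \<Gamma> (Lam s A t) (Pi s A B)" using Lam.hyps by (rule has_ty.Lam)
  have wf: "wfc ((s, A) # \<Gamma>)" using Lam by auto
  obtain p where p: "has_ty ((s, A) # \<Gamma>) B (Srt p)" "tg t = st p" using has_ty_sort[OF Lam.hyps(3) wf] by blast
  note pi = has_ty_Pi[OF Lam.hyps(1,2) p(1)]
  note A = Lam.IH(1)[OF Lam.prems]
  note B = Lam.IH(2)[OF wf sound_ctx_Cons[OF Lam.prems(1) Lam.hyps(1,2) Lam.prems(2) A] Lam.prems(3)]
  show ?case unfolding sound_def
  proof (intro allI impI)
    fix I assume I: "valid U \<Gamma> I"
    obtain a F G where a: "interp U \<Gamma> A I = Some a" "a \<in> elts (srt_set U q)"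
      and F: "\<And>\<alpha>. \<alpha> \<in> elts a \<Longrightarrow> interp U ((s, A) # \<Gamma>) t (upd s \<alpha> I) = Some (F \<alpha>)"
        "\<And>\<alpha>. \<alpha> \<in> elts a \<Longrightarrow> interp U ((s, A) # \<Gamma>) B (upd s \<alpha> I) = Some (G \<alpha>)"
        "\<And>\<alpha>. \<alpha> \<in> elts a \<Longrightarrow> F \<alpha> \<in> elts (G \<alpha>)"
      using sound_familyD[OF A B I Lam.prems(1)] by blast
    have G: "interp U \<Gamma> (Pi s A B) I = Some (pi_op (pi_sort q p) a G)"
      unfolding interp_Pi[OF Lam.prems(1) pi] a(1) using F(2) by (simp add: over_Some[OF pi_op_in])
    show "\<exists>x X. interp U \<Gamma> (Lam s A t) I = Some x \<and> interp U \<Gamma> (Pi s A B) I = Some X \<and> x \<in> elts X"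
    proof (cases "tg t")
      case Star
      \<comment> \<open>The body is a proof, so its value, the empty set, belongs to every
        proposition of the family and hence to the intersection; over an empty domain the
        intersection is \<open>vone\<close>.\<close>
      have "vempty \<in> elts (G \<alpha>)" if "\<alpha> \<in> elts a" for \<alpha>
        using F(1,3)[OF that] interp_Star[OF wf Lam.hyps(3) Star, of U "upd s \<alpha> I"] by simp
      then have "vempty \<in> elts (vInter a G)" by (cases "elts a = {}") (simp_all add: elts_vInter vInter_empty)
      then show ?thesis using interp_Star[OF Lam.prems(1) ty, of U I] Star p(2) G by (simp add: pi_op_def)
    next
      case Dia
      have "vlam a F \<in> elts (vPi a G)" using F(3) by (simp add: elts_vPi)
      moreover have "interp U \<Gamma> (Lam s A t) I = Some (vlam a F)"
        unfolding interp_Lam[OF Lam.prems(1) ty Dia] a(1) using F(1) by (simp add: over_Some)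
      ultimately show ?thesis using Dia p(2) G by (simp add: pi_op_def)
    qed
  qed
next
  case (App \<Gamma> t s A B u)
  have ty: "has_ty \<Gamma> (App t u) (sb (single s u) B)" using App.hyps by (rule has_ty.App)
  obtain q where q: "has_ty \<Gamma> (Pi s A B) (Srt q)" "tg t = st q" using has_ty_sort App.hyps(1) App.prems(1) by blast
  then obtain p p' where p: "has_ty \<Gamma> A (Srt p)" "st p = s" "has_ty ((s, A) # \<Gamma>) B (Srt p')"
    using has_ty_PiD by blast
  then have wf: "wfc ((s, A) # \<Gamma>)" using App by auto
  show ?case unfolding sound_def
  proof (intro allI impI)
    fix I assume I: "valid U \<Gamma> I"
    obtain f P where f: "interp U \<Gamma> t I = Some f" "interp U \<Gamma> (Pi s A B) I = Some P" "f \<in> elts P"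
      using App.IH(1)[OF App.prems] I by (rule soundD)
    obtain y a where y: "interp U \<Gamma> u I = Some y" "interp U \<Gamma> A I = Some a" "y \<in> elts a"
      using App.IH(2)[OF App.prems] I by (rule soundD)
    define G where "G \<alpha> = the (interp U ((s, A) # \<Gamma>) B (upd s \<alpha> I))" for \<alpha>
    have P: "P = pi_op q a G" "\<forall>\<alpha>\<in>elts a. interp U ((s, A) # \<Gamma>) B (upd s \<alpha> I) \<noteq> None"
      using f(2) y(2) unfolding interp_Pi[OF App.prems(1) q(1)] by (auto simp: over_eq_Some G_def[abs_def])
    have T: "interp U \<Gamma> (sb (single s u) B) I = Some (G y)"
      unfolding interp_single[OF p(3) wf App.hyps(2,3) y(1)] using P(2) y(3) by (auto simp: G_def)
    show "\<exists>x X. interp U \<Gamma> (App t u) I = Some x \<and> interp U \<Gamma> (sb (single s u) B) I = Some X \<and> x \<in> elts X"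
    proof (cases "tg t")
      case Star
      then have "f = vempty" using interp_Star[OF App.prems(1) App.hyps(1), of U I] f(1) by simp
      moreover have "P = vInter a G" using P(1) Star q(2) by (simp add: pi_op_def)
      \<comment> \<open>The argument inhabits the domain, so the convention for empty intersections
        does not interfere.\<close>
      moreover have "elts a \<noteq> {}" using y(3) by blast
      ultimately have "vempty \<in> elts (G y)" using f(3) y(3) by (simp add: elts_vInter)
      then show ?thesis using T interp_Star[OF App.prems(1) ty, of U I] Star by simp
    next
      case Dia
      then have "P = vPi a G" using P(1) q(2) by (simp add: pi_op_def)
      then have "is_vfun f" "y \<in> vdom f" "vapp f y \<in> elts (G y)" using f(3) y(3) by (auto simp: elts_vPi)
      then show ?thesis using T f(1) y(1) by (simp add: interp_App[OF App.prems(1) ty Dia])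
    qed
  qed
next
  case (Sig \<Gamma> A i B q s)
  have ty: "has_ty \<Gamma> (Sig s Dia A B) (Srt (Type i))" using Sig.hyps by (rule has_ty.Sig)
  have wf: "wfc ((Dia, A) # \<Gamma>)" using wfc_Cons[OF Sig.prems(1) Sig.hyps(1)] by simp
  note A = Sig.IH(1)[OF Sig.prems]
  note B = Sig.IH(2)[OF wf sound_ctx_Cons[OF Sig.prems(1) Sig.hyps(1) st_simps(2) Sig.prems(2) A] Sig.prems(3)]
  have U: "universe (U i)" using Sig.prems(3) by (simp add: universes_def)
  show ?case unfolding sound_def
  proof (intro allI impI)
    fix I assume I: "valid U \<Gamma> I"
    obtain a F G where a: "interp U \<Gamma> A I = Some a" "a \<in> elts (srt_set U (Type i))"
      and F: "\<And>\<alpha>. \<alpha> \<in> elts a \<Longrightarrow> interp U ((Dia, A) # \<Gamma>) B (upd Dia \<alpha> I) = Some (F \<alpha>)"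
        "\<And>\<alpha>. \<alpha> \<in> elts a \<Longrightarrow> interp U ((Dia, A) # \<Gamma>) (Srt q) (upd Dia \<alpha> I) = Some (G \<alpha>)"
        "\<And>\<alpha>. \<alpha> \<in> elts a \<Longrightarrow> F \<alpha> \<in> elts (G \<alpha>)"
      using sound_familyD[OF A B I Sig.prems(1)] by blast
    have F': "F \<alpha> \<in> elts (U i)" if "\<alpha> \<in> elts a" for \<alpha>
    proof -
      have "F \<alpha> \<in> elts (srt_set U q)" using F(2,3)[OF that] wf by simp
      then show ?thesis using Sig.hyps(4) univ_vempty[OF U] univ_vone[OF U] by (auto simp: elts_vbool)
    qed
    have "vSigma a F \<in> elts (U i)" using U a(2) F' by (intro univ_vSigma) auto
    moreover have "interp U \<Gamma> (Sig s Dia A B) I = Some (vSigma a F)"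
      unfolding interp_Sig[OF Sig.prems(1) ty] a(1) using F(1) by (simp add: over_Some)
    ultimately show "\<exists>x X. interp U \<Gamma> (Sig s Dia A B) I = Some x \<and> interp U \<Gamma> (Srt (Type i)) I = Some X \<and> x \<in> elts X"
      using Sig.prems(1) by simp
  qed
next
  case (Pair \<Gamma> a A b r B s i)
  have ty: "has_ty \<Gamma> (Pair s r A B a b) (Sig s r A B)" using Pair.hyps by (rule has_ty.Pair)
  obtain j p where p: "has_ty \<Gamma> A (Srt (Type j))" "has_ty ((r, A) # \<Gamma>) B (Srt p)" "r = Dia"
    using has_ty_SigD[OF Pair.hyps(3)] by blast
  have wf: "wfc ((r, A) # \<Gamma>)" using wfc_Cons[OF Pair.prems(1) p(1)] p(3) by simp
  show ?case unfolding sound_def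
  proof (intro allI impI)
    fix I assume I: "valid U \<Gamma> I"
    obtain x \<alpha> where x: "interp U \<Gamma> a I = Some x" "interp U \<Gamma> A I = Some \<alpha>" "x \<in> elts \<alpha>"
      using Pair.IH(1)[OF Pair.prems] I by (rule soundD)
    obtain y \<beta> where y: "interp U \<Gamma> b I = Some y" "interp U \<Gamma> (sb (single r a) B) I = Some \<beta>" "y \<in> elts \<beta>"
      using Pair.IH(2)[OF Pair.prems] I by (rule soundD)
    obtain S where S: "interp U \<Gamma> (Sig s r A B) I = Some S"
      using Pair.IH(3)[OF Pair.prems] I by (rule soundD)
    have "interp U ((r, A) # \<Gamma>) B (upd r x I) = Some \<beta>"
      using interp_single[OF p(2) wf Pair.hyps(1,4) x(1)] y(2) by simp
    then have "vpair x y \<in> elts S"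
      using S x(2,3) y(3) unfolding interp_Sig[OF Pair.prems(1) Pair.hyps(3)] by (auto simp: over_eq_Some elts_vSigma)
    then show "\<exists>x X. interp U \<Gamma> (Pair s r A B a b) I = Some x \<and> interp U \<Gamma> (Sig s r A B) I = Some X \<and> x \<in> elts X"
      using S x(1) y(1) by (simp add: interp_Pair[OF Pair.prems(1) ty])
  qed
next
  case (Fst \<Gamma> t s r A B)
  have ty: "has_ty \<Gamma> (Fst t) A" using Fst.hyps by (rule has_ty.Fst)
  obtain q where sig: "has_ty \<Gamma> (Sig s r A B) (Srt q)" using has_ty_sort Fst.hyps(1) Fst.prems(1) by blast
  show ?case unfolding sound_def
  proof (intro allI impI)
    fix I assume I: "valid U \<Gamma> I"
    obtain x S where x: "interp U \<Gamma> t I = Some x" "interp U \<Gamma> (Sig s r A B) I = Some S" "x \<in> elts S"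
      using Fst.IH[OF Fst.prems] I by (rule soundD)
    then show "\<exists>x X. interp U \<Gamma> (Fst t) I = Some x \<and> interp U \<Gamma> A I = Some X \<and> x \<in> elts X"
      unfolding interp_Fst[OF Fst.prems(1) ty] interp_Sig[OF Fst.prems(1) sig] by (auto simp: over_eq_Some elts_vSigma)
  qed
next
  case (Snd \<Gamma> t s r A B i q)
  have ty: "has_ty \<Gamma> (Snd s t) (sb (single r (Fst t)) B)" using Snd.hyps by (rule has_ty.Snd)
  have ty1: "has_ty \<Gamma> (Fst t) A" using Snd.hyps(1) by (rule has_ty.Fst)
  obtain p where sig: "has_ty \<Gamma> (Sig s r A B) (Srt p)" using has_ty_sort Snd.hyps(1) Snd.prems(1) by blast
  have wf: "wfc ((r, A) # \<Gamma>)" using wfc_Cons[OF Snd.prems(1) Snd.hyps(2)] Snd.hyps(5) by simp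
  note A = Snd.IH(2)[OF Snd.prems]
  have "sound_ctx U ((r, A) # \<Gamma>)"
    using sound_ctx_Cons[OF Snd.prems(1) Snd.hyps(2) _ Snd.prems(2) A] Snd.hyps(5) by simp
  \<comment> \<open>The premise on \<open>B\<close> in rule \<open>Snd\<close> provides this
    hypothesis; inverting the typing of the \<Sigma>-type would give a derivation outside the reach
    of the induction.\<close>
  note B = Snd.IH(3)[OF wf this Snd.prems(3)]
  show ?case unfolding sound_def
  proof (intro allI impI)
    fix I assume I: "valid U \<Gamma> I"
    obtain x S where x: "interp U \<Gamma> t I = Some x" "interp U \<Gamma> (Sig s r A B) I = Some S" "x \<in> elts S"
      using Snd.IH(1)[OF Snd.prems] I by (rule soundD)
    obtain a F G where a: "interp U \<Gamma> A I = Some a" "a \<in> elts (srt_set U (Type i))"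
      and F: "\<And>\<alpha>. \<alpha> \<in> elts a \<Longrightarrow> interp U ((r, A) # \<Gamma>) B (upd r \<alpha> I) = Some (F \<alpha>)"
        "\<And>\<alpha>. \<alpha> \<in> elts a \<Longrightarrow> interp U ((r, A) # \<Gamma>) (Srt q) (upd r \<alpha> I) = Some (G \<alpha>)"
        "\<And>\<alpha>. \<alpha> \<in> elts a \<Longrightarrow> F \<alpha> \<in> elts (G \<alpha>)"
      using sound_familyD[OF A B I Snd.prems(1)] by blast
    have "interp U \<Gamma> (Sig s r A B) I = Some (vSigma a F)"
      unfolding interp_Sig[OF Snd.prems(1) sig] a(1) using F(1) by (simp add: over_Some)
    then obtain y z where yz: "x = vpair y z" "y \<in> elts a" "z \<in> elts (F y)" using x(2,3) by (auto simp: elts_vSigma)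
    have "interp U \<Gamma> (Fst t) I = Some y" using x(1) yz(1) by (simp add: interp_Fst[OF Snd.prems(1) ty1])
    then have T: "interp U \<Gamma> (sb (single r (Fst t)) B) I = Some (F y)"
      using interp_single[OF Snd.hyps(3) wf ty1, of U I y] F(1) yz(2) Snd.hyps(5) by simp
    have "interp U \<Gamma> (Snd s t) I = Some z"
    proof (cases s)
      case Star
      \<comment> \<open>A projection with tag \<open>Star\<close> denotes the empty set by decree.
        The actual second component is a member of a truth value, hence also empty.\<close>
      then have "q = Prop" using Snd.hyps(4) by (cases q) auto
      then have "F y \<in> elts vbool" using F(2,3)[OF yz(2)] wf by simp
      then have "z = vempty" using yz(3) by (auto simp: vbool_iff)
      then show ?thesis using interp_Star[OF Snd.prems(1) ty, of U I] Star by simp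
    next
      case Dia
      then show ?thesis using x(1) yz(1) ty Snd.prems(1) by (simp add: interp_Snd)
    qed
    then show "\<exists>x X. interp U \<Gamma> (Snd s t) I = Some x \<and> interp U \<Gamma> (sb (single r (Fst t)) B) I = Some X \<and> x \<in> elts X"
      using T yz(3) by blast
  qed
qed

text \<open>\<open>soundness\<close> assumes a sound context and extends it under binders by itself.
  A separate induction on the context discharges the assumption: each declared type is sound over
  the declarations before it.\<close>

lemma sound_ctx_wfc: "wfc \<Gamma> \<Longrightarrow> universes U \<Longrightarrow> sound_ctx U \<Gamma>"
proof (induction \<Gamma>)
  case Nil
  then show ?case by (auto simp: sound_ctx_def elim: lookup.cases)
next
  case (Cons d \<Gamma>)
  then obtain q where "has_ty \<Gamma> (snd d) (Srt q)" "st q = fst d" "wfc \<Gamma>" "sound_ctx U \<Gamma>" by auto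
  then show ?case
    using sound_ctx_Cons[of \<Gamma> "snd d" q "fst d" U] soundness[of \<Gamma> "snd d" "Srt q" U] Cons.prems(2) by simp
qed

theorem theorem7p6:
  fixes U :: "nat \<Rightarrow> 'v::zf"
  assumes "universes U"
  shows "(\<forall>\<Gamma>. \<turnstile> \<Gamma> wf \<longrightarrow>
            (\<forall>\<Delta> s A \<Gamma>' I. \<Gamma> = \<Delta> @ (s, A) # \<Gamma>' \<longrightarrow> valid U \<Gamma>' I \<longrightarrow> interp U \<Gamma>' A I \<noteq> None)) \<and>
         (\<forall>\<Gamma> t T I. \<Gamma> \<turnstile> t \<Colon> T \<longrightarrow> valid U \<Gamma> I \<longrightarrow>
            (\<exists>x X. interp U \<Gamma> t I = Some x \<and> interp U \<Gamma> T I = Some X \<and> x \<in> elts X))"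
proof (intro conjI allI impI)
  have sound: "sound U \<Gamma> t T" if "wfc \<Gamma>" "has_ty \<Gamma> t T" for \<Gamma> t T
    using soundness[OF that(2,1) sound_ctx_wfc[OF that(1) assms] assms] .
  {
    fix \<Gamma> \<Delta> s A \<Gamma>' I
    assume "\<turnstile> \<Gamma> wf" "\<Gamma> = \<Delta> @ (s, A) # \<Gamma>'" and I: "valid U \<Gamma>' I"
    then have "wfc (\<Delta> @ (s, A) # \<Gamma>')" using typing_imp_has_ty(1) by blast
    \<comment> \<open>The most recent declaration comes first, so a prefix of the context is a
      suffix of the list.\<close>
    then have "wfc ((s, A) # \<Gamma>')" by (induction \<Delta>) auto
    then obtain q where "wfc \<Gamma>'" "has_ty \<Gamma>' A (Srt q)" by auto
    from soundD[OF sound[OF this] I] show "interp U \<Gamma>' A I \<noteq> None" by blast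
  next
    fix \<Gamma> t T I
    assume "\<Gamma> \<turnstile> t \<Colon> T" "valid U \<Gamma> I"
    then show "\<exists>x X. interp U \<Gamma> t I = Some x \<and> interp U \<Gamma> T I = Some X \<and> x \<in> elts X"
      using sound by (auto simp: typing_iff sound_def)
  }
qed

end
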